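(* For each $n$ let $M_n'$ be an $n\times n$ GUE matrix and $W_n' := \frac{1}{\sqrt n} M_n'$. Let $(I_n)_n$ be a sequence of intervals in $\mathbb{R}$ and let $N_{I_n}(W_n')$ be the number of eigenvalues of $W_n'$ in $I_n$. If $\mathbb{V}(N_{I_n}(W_n')) \to \infty$ as $n \to \infty$, then for any sequence $(a_n)_n$ of real numbers such that $$1 \ll a_n \ll \sqrt{\mathbb{V}(N_{I_n}(W_n'))}$$ the sequence $(Z_n)_n$ with $$Z_n = \frac{N_{I_n}(W_n') - \mathbb{E}[N_{I_n}(W_n')]}{a_n \sqrt{\mathbb{V}(N_{I_n}(W_n'))}}$$ satisfies a moderate deviation principle (MDP) with speed $a_n^2$ and rate function $I(x)=\frac{x^2}{2}$.
   Context: GUE: $M_n'$ is a random Hermitian $n\times n$ matrix whose entries on and above the diagonal are independent, the diagonal entries being real $N(0,1)$ variables and each entry above the diagonal being a centered complex Gaussian $Z$ with $\mathbb{E}Z^2=0$, $\mathbb{E}|Z|^2=1$ (real and imaginary parts independent $N(0,1/2)$). Counting function: for a Hermitian matrix $W$ with eigenvalues $\lambda_1,\dots,\lambda_n$ and $I\subset\mathbb{R}$, $N_I(W)=\sum_{i=1}^n 1_{\{\lambda_i\in I\}}$. $\mathbb{E}$ and $\mathbb{V}$ denote expectation and variance. Notation: $a_n\ll b_n$ means $\lim_{n\to\infty} a_n/b_n=0$. MDP: a sequence of real random variables $(Z_n)_n$ satisfies the MDP (formally, a large deviation principle) with speed $s_n\to\infty$ and (good) rate function $I:\mathbb{R}\to[0,\infty)$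 if the level sets $\{x: I(x)\le M\}$, $0\le M<\infty$, are compact, $\limsup_{n\to\infty} s_n^{-1}\log P(Z_n\in F)\le -\inf_{x\in F} I(x)$ for all closed $F\subset\mathbb{R}$, and $\liminf_{n\to\infty} s_n^{-1}\log P(Z_n\in O)\ge -\inf_{x\in O} I(x)$ for all open $O\subset\mathbb{R}$. *)

theory Defs
  imports
    "HOL-Probability.Probability"
    "Jordan_Normal_Form.Char_Poly"
    "Jordan_Normal_Form.Schur_Decomposition"
begin

definition hermitian_mat :: "complex mat \<Rightarrow> bool" where
  "hermitian_mat A \<longleftrightarrow> square_mat A \<and> mat_adjoint A = A"

text \<open>The eigenvalues are counted with multiplicity. For a Hermitian matrix the algebraic
  multiplicity used here is also the geometric one.\<close>

definition eigenvalue_mset :: "complex mat \<Rightarrow> complex multiset" where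
  "eigenvalue_mset A = proots (char_poly A)"

definition eigenvalue_count :: "real set \<Rightarrow> complex mat \<Rightarrow> nat" where
  "eigenvalue_count I A = size (filter_mset (\<lambda>z. z \<in> complex_of_real ` I) (eigenvalue_mset A))"

text \<open>The second parameter of \<^const>\<open>normal_density\<close> is the standard deviation, so
  variance $1/2$ is \<open>sqrt (1 / 2)\<close>. The diagonal entries are real because the
  matrix is Hermitian.\<close>

definition GUE :: "nat \<Rightarrow> 'a measure \<Rightarrow> ('a \<Rightarrow> complex mat) \<Rightarrow> bool" where
  "GUE n M X \<longleftrightarrow>
     prob_space M \<and>
     (\<forall>\<omega>\<in>space M. X \<omega> \<in> carrier_mat n n \<and> hermitian_mat (X \<omega>)) \<and>
     prob_space.indep_vars M (\<lambda>_. borel) (\<lambda>(i, j) \<omega>. X \<omega> $$ (i, j)) {(i, j). i \<le> j \<and> j < n} \<and>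
     (\<forall>i<n. distributed M lborel (\<lambda>\<omega>. Re (X \<omega> $$ (i, i))) (normal_density 0 1)) \<and>
     (\<forall>j<n. \<forall>i<j.
        prob_space.indep_var M borel (\<lambda>\<omega>. Re (X \<omega> $$ (i, j))) borel (\<lambda>\<omega>. Im (X \<omega> $$ (i, j))) \<and>
        distributed M lborel (\<lambda>\<omega>. Re (X \<omega> $$ (i, j))) (normal_density 0 (sqrt (1 / 2))) \<and>
        distributed M lborel (\<lambda>\<omega>. Im (X \<omega> $$ (i, j))) (normal_density 0 (sqrt (1 / 2))))"

text \<open>The condition on \<open>b\<close> only ensures that the quotients are meaningful, since
  division by zero yields zero in HOL.\<close>

definition much_less :: "(nat \<Rightarrow> real) \<Rightarrow> (nat \<Rightarrow> real) \<Rightarrow> bool" where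
  "much_less a b \<longleftrightarrow> (\<forall>\<^sub>F n in sequentially. b n \<noteq> 0) \<and> (\<lambda>n. a n / b n) \<longlonglongrightarrow> 0"

text \<open>The logarithm of a probability, with $\log 0 = -\infty$, whereas \<open>ln 0 = 0\<close> on the reals.\<close>

definition elog :: "real \<Rightarrow> ereal" where
  "elog p = (if p \<le> 0 then -\<infinity> else ereal (ln p))"

text \<open>The infima are taken in \<^typ>\<open>ereal\<close>, so that the infimum over the empty set is \<open>\<infinity>\<close>.
  The random variables may live on different probability spaces.\<close>

definition satisfies_MDP ::
  "(nat \<Rightarrow> 'a measure) \<Rightarrow> (nat \<Rightarrow> 'a \<Rightarrow> real) \<Rightarrow> (nat \<Rightarrow> real) \<Rightarrow> (real \<Rightarrow> real) \<Rightarrow> bool" where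
  "satisfies_MDP M Z s I \<longleftrightarrow>
     (\<forall>n. prob_space (M n) \<and> Z n \<in> borel_measurable (M n)) \<and>
     filterlim s at_top sequentially \<and>
     (\<forall>x. 0 \<le> I x) \<and>
     (\<forall>c\<ge>0. compact {x. I x \<le> c}) \<and>
     (\<forall>F. closed F \<longrightarrow>
        limsup (\<lambda>n. ereal (1 / s n) * elog (measure (M n) {\<omega> \<in> space (M n). Z n \<omega> \<in> F}))
          \<le> - (INF x\<in>F. ereal (I x))) \<and>
     (\<forall>U. open U \<longrightarrow>
        liminf (\<lambda>n. ereal (1 / s n) * elog (measure (M n) {\<omega> \<in> space (M n). Z n \<omega> \<in> U}))
          \<ge> - (INF x\<in>U. ereal (I x)))"

end

theory Submission
  imports Defs
begin

text \<open>The joint law of the eigenvalues is identified without integrating over the unitary group.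
  Gaussian integration by parts shows that the mixed moments of the traces of powers of a GUE
  matrix satisfy the loop (Schwinger-Dyson) equations
  \[ E[t_{k+1} P] = \sum_{r<k} E[t_r t_{k-1-r} P] + \sum_l k_l E[t_{k+k_l-1} P / t_{k_l}], \qquad
     P = \prod_l t_{k_l}, \]
  which determine all of them recursively. Integration by parts along the vector fields
  $\sum_i x_i^k \partial_i$ gives the same equations for the power sums of $n$ independent standard
  Gaussians weighted by the squared Vandermonde determinant. Exponential integrability turns the
  equality of moments into equality of the laws of eigenvalue counts. By Andreief's identity the
  generating function of a count is proportional to $\det(H_{B^c} + z H_B)$ for two positive
  semidefinite Hankel matrices, so all its zeros are real and nonpositive and the count is
  distributed as a sum of independent Bernoulli variables. The error of the second-order
  expansion of its centered log-Laplace transform is then controlled by the variance alone, and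
  the quadratic case of the Gaertner-Ellis theorem (Chernoff bounds and exponential tilting)
  concludes.\<close>

text \<open>The obstacle is measurability: diagonalisation supplies eigenvalues outcome by outcome,
  without a measurable labelling. The spectrum is therefore observed only through traces of powers,
  which are polynomials in the Gaussian coordinates, and counts are recovered from them by
  approximation. While all integrands are polynomials, integration by parts reduces to the recursion
  of the one-dimensional Gaussian moments, and no boundary terms arise. The exponent two of the
  Vandermonde factor is what makes the two recursions coincide: the divergence of the field
  \<open>sum x_i^k d_i\<close> cancels the diagonal terms produced by differentiating the weight.
  The variance controls the error because the third derivative of the log-Laplace transform of a
  Bernoulli(p) variable is, near zero, at most a constant times p(1-p), and the sum of the p(1-p) is
  the variance V. At tilt s = t a / sqrt V the cubic error |s|^3 V, divided by the speed a^2, is of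
  order |a| / sqrt V. This is where the upper growth condition on a enters; the lower one makes the
  speed diverge.\<close>

definition std_gauss :: "real measure" where
  "std_gauss = density lborel std_normal_density"

text \<open>The index type stays open: pairs index the real coordinates of a matrix, natural numbers
  the points of the Coulomb gas.\<close>

definition gauss :: "'i set \<Rightarrow> ('i \<Rightarrow> real) measure" where
  "gauss A = PiM A (\<lambda>_. std_gauss)"

lemma prob_space_std_gauss: "prob_space std_gauss"
  unfolding std_gauss_def by (rule prob_space_normal_density) simp

lemma sets_std_gauss [measurable_cong, simp]: "sets std_gauss = sets borel"
  and space_std_gauss [simp]: "space std_gauss = UNIV"
  by (simp_all add: std_gauss_def)

lemma prob_space_gauss: "prob_space (gauss A)"
  unfolding gauss_def by (rule prob_space_PiM) (rule prob_space_std_gauss)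

interpretation std_gauss: prob_space std_gauss by (rule prob_space_std_gauss)

interpretation std_gauss_product: product_sigma_finite "\<lambda>_. std_gauss" by standard

lemma gauss_coord_measurable:
  "\<alpha> \<in> A \<Longrightarrow> (\<lambda>x. x \<alpha>) \<in> borel_measurable (gauss A)"
  unfolding gauss_def by measurable

section \<open>Exponential moments and Stein's identity for one standard Gaussian\<close>

lemma std_normal_density_shift:
  "exp (c * t) * std_normal_density t = exp (c\<^sup>2 / 2) * normal_density c 1 t"
  by (simp add: normal_density_def exp_add [symmetric] power2_eq_square field_simps)

lemma integrable_std_gauss_exp: "integrable std_gauss (\<lambda>t. exp (c * t))"
proof -
  have "(\<lambda>t. std_normal_density t * exp (c * t)) = (\<lambda>t. exp (c\<^sup>2 / 2) * normal_density c 1 t)"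
    by (rule ext) (metis mult.commute std_normal_density_shift)
  then have "integrable lborel (\<lambda>t. std_normal_density t * exp (c * t))"
    by (simp add: integrable_normal_density)
  then show ?thesis
    unfolding std_gauss_def by (subst integrable_density) auto
qed

lemma integrable_std_gauss_exp_abs: "integrable std_gauss (\<lambda>t. exp (c * \<bar>t\<bar>))"
proof (rule Bochner_Integration.integrable_bound)
  show "integrable std_gauss (\<lambda>t. exp (c * t) + exp (- c * t))"
    by (intro Bochner_Integration.integrable_add integrable_std_gauss_exp)
  show "AE t in std_gauss. norm (exp (c * \<bar>t\<bar>)) \<le> norm (exp (c * t) + exp (- c * t))"
  proof (rule AE_I2)
    fix t
    have "exp (c * \<bar>t\<bar>) \<le> exp (c * t) + exp (- c * t)"
      using exp_gt_zero[of "c * t"] exp_gt_zero[of "- c * t"] by (cases "t \<ge> 0") (simp_all add: less_imp_le)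
    then show "norm (exp (c * \<bar>t\<bar>)) \<le> norm (exp (c * t) + exp (- c * t))"
      by (simp add: abs_of_pos add_pos_pos)
  qed
qed measurable

lemma integrable_gauss_exp:
  assumes "finite A"
  shows "integrable (gauss A) (\<lambda>x. exp (c * (\<Sum>\<alpha>\<in>A. \<bar>x \<alpha>\<bar>)))"
proof -
  have "integrable (gauss A) (\<lambda>x. \<Prod>\<alpha>\<in>A. exp (c * \<bar>x \<alpha>\<bar>))"
    unfolding gauss_def
    by (intro std_gauss_product.product_integrable_prod assms integrable_std_gauss_exp_abs)
  then show ?thesis
    by (simp add: exp_sum assms sum_distrib_left)
qed

lemma integrable_std_gauss_power:
  "integrable std_gauss (\<lambda>t. t ^ k)"
  unfolding std_gauss_def
  using integrable_std_normal_moment[of k] by (subst integrable_density) auto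

lemma integral_std_gauss_power:
  "(LINT t|std_gauss. t ^ (2 * k)) = fact (2 * k) / (2 ^ k * fact k)"
  "(LINT t|std_gauss. t ^ (2 * k + 1)) = 0"
  using std_normal_moment_even[of k] std_normal_moment_odd[of k]
  by (auto simp: std_gauss_def integral_density has_bochner_integral_iff)

text \<open>Integration by parts for monomials, read off from the closed formulas for the moments.
  At \<open>k = 0\<close> the factor \<open>real k\<close> makes the truncated exponent
  harmless.\<close>

lemma std_gauss_power_recursion:
  "(LINT t|std_gauss. t ^ (k + 1)) = real k * (LINT t|std_gauss. t ^ (k - 1))"
proof (cases "even k")
  case True
  then obtain m where m: "k = 2 * m" by (auto elim: evenE)
  show ?thesis
  proof (cases m)
    case (Suc m')
    then have "k - 1 = 2 * m' + 1" using m by simp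
    then show ?thesis
      unfolding m using integral_std_gauss_power(2)[of m] integral_std_gauss_power(2)[of m'] m by simp
  qed (use m integral_std_gauss_power(2)[of 0] in simp)
next
  case False
  then obtain m where m: "k = 2 * m + 1" by (auto elim: oddE)
  have e: "k + 1 = 2 * Suc m" "k - 1 = 2 * m" using m by simp_all
  have f: "fact (2 * Suc m) = (2 * real m + 2) * (2 * real m + 1) * fact (2 * m)"
    by (simp add: algebra_simps)
  have k: "real k = 2 * real m + 1" and
    g: "2 ^ Suc m * fact (Suc m) = (2 * real m + 2) * (2 ^ m * fact m)"
    using m by (simp_all add: algebra_simps)
  show ?thesis
    unfolding e integral_std_gauss_power f g k by simp
qed

lemma integrable_std_gauss_poly:
  "integrable std_gauss (\<lambda>t. poly p (complex_of_real t))"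
  unfolding poly_altdef of_real_power [symmetric]
  by (intro Bochner_Integration.integrable_sum integrable_mult_right integrable_of_real integrable_std_gauss_power)

text \<open>Both sides are linear in \<open>p\<close>, so the moment recursion for monomials is
  enough.\<close>

lemma std_gauss_Stein_poly:
  "(LINT t|std_gauss. complex_of_real t * poly p (complex_of_real t))
     = (LINT t|std_gauss. poly (pderiv p) (complex_of_real t))"
proof -
  have pm: "integrable std_gauss (\<lambda>t. complex_of_real t * poly q (complex_of_real t))" for q
    using integrable_std_gauss_poly[of "pCons 0 q"] by simp
  have mon: "(LINT t|std_gauss. complex_of_real t * poly (monom c k) (complex_of_real t))
     = (LINT t|std_gauss. poly (pderiv (monom c k)) (complex_of_real t))" for c k
  proof -
    have "(LINT t|std_gauss. complex_of_real t * poly (monom c k) (complex_of_real t))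
      = (LINT t|std_gauss. c * complex_of_real (t ^ (k + 1)))"
      by (simp add: poly_monom algebra_simps)
    also have "\<dots> = c * complex_of_real (real k * (LINT t|std_gauss. t ^ (k - 1)))"
      by (simp only: integral_mult_right_zero integral_complex_of_real std_gauss_power_recursion)
    also have "\<dots> = (LINT t|std_gauss. (c * of_nat k) * complex_of_real (t ^ (k - 1)))"
      by (simp only: integral_mult_right_zero integral_complex_of_real of_real_mult of_real_of_nat_eq mult.assoc)
    also have "\<dots> = (LINT t|std_gauss. poly (pderiv (monom c k)) (complex_of_real t))"
      by (simp add: pderiv_monom poly_monom algebra_simps)
    finally show ?thesis .
  qed
  have "(LINT t|std_gauss. complex_of_real t * poly (\<Sum>i\<in>S. monom (f i) i) (complex_of_real t))
     = (LINT t|std_gauss. poly (pderiv (\<Sum>i\<in>S. monom (f i) i)) (complex_of_real t))"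
    if "finite S" for S :: "nat set" and f :: "nat \<Rightarrow> complex"
    using that
  proof (induction S rule: finite_induct)
    case (insert i S)
    then show ?case
      by (simp add: distrib_left pderiv_add Bochner_Integration.integral_add pm integrable_std_gauss_poly mon)
  qed simp
  from this[of "{..degree p}" "coeff p"] show ?thesis
    by (simp only: finite_atMost poly_as_sum_of_monoms)
qed

section \<open>Complex polynomials in finitely many Gaussian coordinates\<close>

inductive poly_fun :: "'i set \<Rightarrow> (('i \<Rightarrow> real) \<Rightarrow> complex) \<Rightarrow> bool" for A where
  poly_fun_const: "poly_fun A (\<lambda>_. c)"
| poly_fun_coord: "\<alpha> \<in> A \<Longrightarrow> poly_fun A (\<lambda>x. complex_of_real (x \<alpha>))"
| poly_fun_add: "poly_fun A F \<Longrightarrow> poly_fun A G \<Longrightarrow> poly_fun A (\<lambda>x. F x + G x)"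
| poly_fun_mult: "poly_fun A F \<Longrightarrow> poly_fun A G \<Longrightarrow> poly_fun A (\<lambda>x. F x * G x)"

lemma poly_fun_measurable:
  "poly_fun A F \<Longrightarrow> F \<in> borel_measurable (gauss A)"
proof (induction rule: poly_fun.induct)
  case (poly_fun_coord \<alpha>)
  show ?case by (rule measurable_compose[OF gauss_coord_measurable[OF poly_fun_coord] borel_measurable_of_real])
qed (simp_all add: borel_measurable_times borel_measurable_add)

text \<open>An exponential envelope is chosen because rates simply add under sums and products, and
  because \<open>integrable_gauss_exp\<close> makes every such envelope integrable. The signs of
  \<open>C\<close> and \<open>R\<close> are part of the claim so that bounds may be enlarged in the
  induction.\<close>

lemma poly_fun_growth:
  assumes "poly_fun A F" "finite A"
  shows "\<exists>C\<ge>0. \<exists>R\<ge>0. \<forall>x. cmod (F x) \<le> C * exp (R * (\<Sum>\<alpha>\<in>A. \<bar>x \<alpha>\<bar>))"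
  using assms(1)
proof (induction rule: poly_fun.induct)
  case (poly_fun_const c)
  show ?case by (intro exI[of _ "cmod c"] exI[of _ 0] conjI) auto
next
  case (poly_fun_coord \<alpha>)
  have "\<bar>x \<alpha>\<bar> \<le> exp (\<Sum>\<alpha>\<in>A. \<bar>x \<alpha>\<bar>)" for x :: "'a \<Rightarrow> real"
  proof -
    have "\<bar>x \<alpha>\<bar> \<le> (\<Sum>\<alpha>\<in>A. \<bar>x \<alpha>\<bar>)" using assms poly_fun_coord by (intro member_le_sum) auto
    also have "\<dots> \<le> exp \<dots>" using exp_ge_add_one_self[of "\<Sum>\<alpha>\<in>A. \<bar>x \<alpha>\<bar>"] by linarith
    finally show ?thesis .
  qed
  then show ?case by (intro exI[of _ 1] conjI) auto
next
  case (poly_fun_add F G)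
  then obtain C R C' R' where *: "C \<ge> 0" "R \<ge> 0" "C' \<ge> 0" "R' \<ge> 0"
    "\<And>x. cmod (F x) \<le> C * exp (R * (\<Sum>\<alpha>\<in>A. \<bar>x \<alpha>\<bar>))"
    "\<And>x. cmod (G x) \<le> C' * exp (R' * (\<Sum>\<alpha>\<in>A. \<bar>x \<alpha>\<bar>))" by blast
  have "cmod (F x + G x) \<le> (C + C') * exp ((R + R') * (\<Sum>\<alpha>\<in>A. \<bar>x \<alpha>\<bar>))" for x
  proof -
    let ?S = "\<Sum>\<alpha>\<in>A. \<bar>x \<alpha>\<bar>"
    have S: "?S \<ge> 0" by (simp add: sum_nonneg)
    have "C * exp (R * ?S) \<le> C * exp ((R + R') * ?S)" "C' * exp (R' * ?S) \<le> C' * exp ((R + R') * ?S)"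
      using * S by (auto intro!: mult_left_mono mult_right_mono)
    then show ?thesis using *(5,6)[of x] norm_triangle_ineq[of "F x" "G x"]
      by (simp add: distrib_right)
  qed
  then show ?case using * by (intro exI[of _ "C + C'"] exI[of _ "R + R'"] conjI) auto
next
  case (poly_fun_mult F G)
  then obtain C R C' R' where *: "C \<ge> 0" "R \<ge> 0" "C' \<ge> 0" "R' \<ge> 0"
    "\<And>x. cmod (F x) \<le> C * exp (R * (\<Sum>\<alpha>\<in>A. \<bar>x \<alpha>\<bar>))"
    "\<And>x. cmod (G x) \<le> C' * exp (R' * (\<Sum>\<alpha>\<in>A. \<bar>x \<alpha>\<bar>))" by blast
  have "cmod (F x * G x) \<le> (C * C') * exp ((R + R') * (\<Sum>\<alpha>\<in>A. \<bar>x \<alpha>\<bar>))" for x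
  proof -
    let ?S = "\<Sum>\<alpha>\<in>A. \<bar>x \<alpha>\<bar>"
    have "cmod (F x * G x) \<le> (C * exp (R * ?S)) * (C' * exp (R' * ?S))"
      unfolding norm_mult using * by (intro mult_mono) auto
    then show ?thesis by (simp add: distrib_right exp_add mult_ac)
  qed
  then show ?case using * by (intro exI[of _ "C * C'"] exI[of _ "R + R'"] conjI) auto
qed

lemma poly_fun_integrable:
  assumes "poly_fun A F" "finite A"
  shows "integrable (gauss A) F"
proof -
  obtain C R where *: "C \<ge> 0" "\<And>x. cmod (F x) \<le> C * exp (R * (\<Sum>\<alpha>\<in>A. \<bar>x \<alpha>\<bar>))"
    using poly_fun_growth[OF assms] by blast
  have "integrable (gauss A) (\<lambda>x. C * exp (R * (\<Sum>\<alpha>\<in>A. \<bar>x \<alpha>\<bar>)))"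
    by (rule integrable_mult_right[OF integrable_gauss_exp[OF assms(2)]])
  then show ?thesis
    by (rule Bochner_Integration.integrable_bound[OF _ poly_fun_measurable[OF assms(1)]])
       (rule AE_I2, use * in \<open>simp add: abs_of_nonneg\<close>)
qed

lemma poly_fun_sum: "(\<And>i. i \<in> S \<Longrightarrow> poly_fun A (F i)) \<Longrightarrow> poly_fun A (\<lambda>x. \<Sum>i\<in>S. F i x)"
  by (induction S rule: infinite_finite_induct) (auto intro: poly_fun.intros)

text \<open>Partial differentiation is encoded algebraically, through the univariate polynomials
  obtained by freezing all the other coordinates.\<close>

definition partial_deriv ::
  "'i \<Rightarrow> (('i \<Rightarrow> real) \<Rightarrow> complex) \<Rightarrow> (('i \<Rightarrow> real) \<Rightarrow> complex) \<Rightarrow> bool" where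
  "partial_deriv \<alpha> F G \<longleftrightarrow> (\<forall>x. \<exists>p. \<forall>t. F (x(\<alpha> := t)) = poly p (complex_of_real t) \<and>
     G (x(\<alpha> := t)) = poly (pderiv p) (complex_of_real t))"

lemma partial_deriv_const: "partial_deriv \<alpha> (\<lambda>_. c) (\<lambda>_. 0)"
  unfolding partial_deriv_def by (auto intro!: exI[of _ "[:c:]"])

lemma partial_deriv_coord: "partial_deriv \<alpha> (\<lambda>x. complex_of_real (x \<beta>)) (\<lambda>_. if \<alpha> = \<beta> then 1 else 0)"
proof (cases "\<alpha> = \<beta>")
  case True
  then show ?thesis unfolding partial_deriv_def by (auto intro!: exI[of _ "[:0, 1:]"] simp: pderiv_pCons)
next
  case False
  then show ?thesis
    unfolding partial_deriv_def by (intro allI exI[of _ "[:complex_of_real (x \<beta>):]" for x]) auto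
qed

lemma partial_deriv_add:
  assumes "partial_deriv \<alpha> F F'" "partial_deriv \<alpha> G G'"
  shows "partial_deriv \<alpha> (\<lambda>x. F x + G x) (\<lambda>x. F' x + G' x)"
  unfolding partial_deriv_def
proof
  fix x
  obtain p q where "\<forall>t. F (x(\<alpha> := t)) = poly p (complex_of_real t) \<and>
     F' (x(\<alpha> := t)) = poly (pderiv p) (complex_of_real t)"
   "\<forall>t. G (x(\<alpha> := t)) = poly q (complex_of_real t) \<and>
     G' (x(\<alpha> := t)) = poly (pderiv q) (complex_of_real t)"
    using assms unfolding partial_deriv_def by metis
  then show "\<exists>p. \<forall>t. F (x(\<alpha> := t)) + G (x(\<alpha> := t)) = poly p (complex_of_real t) \<and>
     F' (x(\<alpha> := t)) + G' (x(\<alpha> := t)) = poly (pderiv p) (complex_of_real t)"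
    by (intro exI[of _ "p + q"]) (simp add: pderiv_add)
qed

lemma partial_deriv_mult:
  assumes "partial_deriv \<alpha> F F'" "partial_deriv \<alpha> G G'"
  shows "partial_deriv \<alpha> (\<lambda>x. F x * G x) (\<lambda>x. F x * G' x + F' x * G x)"
  unfolding partial_deriv_def
proof
  fix x
  obtain p q where "\<forall>t. F (x(\<alpha> := t)) = poly p (complex_of_real t) \<and>
     F' (x(\<alpha> := t)) = poly (pderiv p) (complex_of_real t)"
   "\<forall>t. G (x(\<alpha> := t)) = poly q (complex_of_real t) \<and>
     G' (x(\<alpha> := t)) = poly (pderiv q) (complex_of_real t)"
    using assms unfolding partial_deriv_def by metis
  then show "\<exists>p. \<forall>t. F (x(\<alpha> := t)) * G (x(\<alpha> := t)) = poly p (complex_of_real t) \<and>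
     F (x(\<alpha> := t)) * G' (x(\<alpha> := t)) + F' (x(\<alpha> := t)) * G (x(\<alpha> := t)) = poly (pderiv p) (complex_of_real t)"
    by (intro exI[of _ "p * q"]) (simp add: pderiv_mult algebra_simps)
qed

text \<open>Fubini isolates the coordinate \<open>\<alpha>\<close>; with the others frozen, the
  one-dimensional identity applies to the polynomial supplied by
  \<open>partial_deriv\<close>.\<close>

lemma gauss_Stein:
  assumes fin: "finite A" and \<alpha>: "\<alpha> \<in> A" and F: "poly_fun A F" and G: "poly_fun A G"
    and d: "partial_deriv \<alpha> F G"
  shows "(LINT x|gauss A. complex_of_real (x \<alpha>) * F x) = (LINT x|gauss A. G x)"
proof -
  let ?B = "A - {\<alpha>}"
  have A: "insert \<alpha> ?B = A" using \<alpha> by auto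
  have fub: "(LINT x|gauss A. H x) = (LINT x|gauss ?B. LINT t|std_gauss. H (x(\<alpha> := t)))"
    if "poly_fun A H" for H
    using std_gauss_product.product_integral_insert[of ?B \<alpha> H] fin poly_fun_integrable[OF that fin]
    unfolding gauss_def A by simp
  have "(LINT t|std_gauss. complex_of_real ((x(\<alpha> := t)) \<alpha>) * F (x(\<alpha> := t))) = (LINT t|std_gauss. G (x(\<alpha> := t)))" for x
  proof -
    obtain p where "\<forall>t. F (x(\<alpha> := t)) = poly p (complex_of_real t) \<and>
       G (x(\<alpha> := t)) = poly (pderiv p) (complex_of_real t)"
      using d unfolding partial_deriv_def by metis
    then show ?thesis using std_gauss_Stein_poly[of p] by simp
  qed
  then have "(LINT x|gauss ?B. LINT t|std_gauss. complex_of_real ((x(\<alpha> := t)) \<alpha>) * F (x(\<alpha> := t)))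
      = (LINT x|gauss ?B. LINT t|std_gauss. G (x(\<alpha> := t)))"
    by (simp only:)
  then show ?thesis
    unfolding fub[OF poly_fun_mult[OF poly_fun_coord[OF \<alpha>] F]] fub[OF G] .
qed

section \<open>Gaussian integration by parts along polynomial vector fields\<close>

definition has_partial :: "'i set \<Rightarrow> 'i \<Rightarrow> (('i \<Rightarrow> real) \<Rightarrow> complex) \<Rightarrow> (('i \<Rightarrow> real) \<Rightarrow> complex) \<Rightarrow> bool" where
  "has_partial A \<alpha> F G \<longleftrightarrow> poly_fun A F \<and> poly_fun A G \<and> partial_deriv \<alpha> F G"

lemma has_partial_const: "has_partial A \<alpha> (\<lambda>_. c) (\<lambda>_. 0)"
  by (simp add: has_partial_def poly_fun_const partial_deriv_const)

lemma has_partial_coord: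
  "\<beta> \<in> A \<Longrightarrow> has_partial A \<alpha> (\<lambda>x. complex_of_real (x \<beta>)) (\<lambda>_. if \<alpha> = \<beta> then 1 else 0)"
  by (simp add: has_partial_def poly_fun_const poly_fun_coord partial_deriv_coord)

lemma has_partial_add:
  "has_partial A \<alpha> F F' \<Longrightarrow> has_partial A \<alpha> G G' \<Longrightarrow>
    has_partial A \<alpha> (\<lambda>x. F x + G x) (\<lambda>x. F' x + G' x)"
  by (simp add: has_partial_def poly_fun_add partial_deriv_add)

lemma has_partial_mult:
  "has_partial A \<alpha> F F' \<Longrightarrow> has_partial A \<alpha> G G' \<Longrightarrow>
    has_partial A \<alpha> (\<lambda>x. F x * G x) (\<lambda>x. F x * G' x + F' x * G x)"
  by (simp add: has_partial_def poly_fun_add poly_fun_mult partial_deriv_mult)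

text \<open>The derivative along the field \<open>sum w_\<alpha> d_\<alpha>\<close>, with
  \<open>g\<close> a family of partial derivatives. Two fields are used: constant complex
  coefficients, which give differentiation by a matrix entry, and the coefficients
  \<open>x_i^k\<close> for the Coulomb gas.\<close>

definition vector_deriv ::
  "'i set \<Rightarrow> ('i \<Rightarrow> ('i \<Rightarrow> real) \<Rightarrow> complex) \<Rightarrow> (('i \<Rightarrow> real) \<Rightarrow> complex) \<Rightarrow> (('i \<Rightarrow> real) \<Rightarrow> complex) \<Rightarrow> bool"
  where
  "vector_deriv A w F G \<longleftrightarrow> poly_fun A F \<and> (\<exists>g. (\<forall>\<alpha>\<in>A. has_partial A \<alpha> F (g \<alpha>)) \<and>
     (\<forall>x. G x = (\<Sum>\<alpha>\<in>A. w \<alpha> x * g \<alpha> x)))"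

lemma vector_deriv_const: "vector_deriv A w (\<lambda>_. c) (\<lambda>_. 0)"
  unfolding vector_deriv_def
  by (auto intro!: exI[of _ "\<lambda>_ _. 0"] has_partial_const poly_fun_const)

lemma vector_deriv_coord:
  assumes "\<beta> \<in> A" "finite A"
  shows "vector_deriv A w (\<lambda>x. complex_of_real (x \<beta>)) (w \<beta>)"
  unfolding vector_deriv_def using assms
  by (intro conjI poly_fun_coord exI[of _ "\<lambda>\<alpha> _. if \<alpha> = \<beta> then 1 else 0"] ballI has_partial_coord)
    (auto simp: if_distrib [of "\<lambda>z. _ * z"] sum.delta cong: if_cong)

lemma vector_deriv_add:
  assumes "vector_deriv A w F F'" "vector_deriv A w G G'"
  shows "vector_deriv A w (\<lambda>x. F x + G x) (\<lambda>x. F' x + G' x)"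
proof -
  obtain f g where *: "\<forall>\<alpha>\<in>A. has_partial A \<alpha> F (f \<alpha>)" "\<forall>x. F' x = (\<Sum>\<alpha>\<in>A. w \<alpha> x * f \<alpha> x)"
    "\<forall>\<alpha>\<in>A. has_partial A \<alpha> G (g \<alpha>)" "\<forall>x. G' x = (\<Sum>\<alpha>\<in>A. w \<alpha> x * g \<alpha> x)"
    "poly_fun A F" "poly_fun A G"
    using assms unfolding vector_deriv_def by blast
  then show ?thesis
    unfolding vector_deriv_def
    by (intro conjI poly_fun_add exI[of _ "\<lambda>\<alpha> x. f \<alpha> x + g \<alpha> x"])
      (auto intro: has_partial_add simp: algebra_simps sum.distrib)
qed

lemma vector_deriv_mult:
  assumes "vector_deriv A w F F'" "vector_deriv A w G G'"
  shows "vector_deriv A w (\<lambda>x. F x * G x) (\<lambda>x. F x * G' x + F' x * G x)"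
proof -
  obtain f g where *: "\<forall>\<alpha>\<in>A. has_partial A \<alpha> F (f \<alpha>)" "\<forall>x. F' x = (\<Sum>\<alpha>\<in>A. w \<alpha> x * f \<alpha> x)"
    "\<forall>\<alpha>\<in>A. has_partial A \<alpha> G (g \<alpha>)" "\<forall>x. G' x = (\<Sum>\<alpha>\<in>A. w \<alpha> x * g \<alpha> x)"
    "poly_fun A F" "poly_fun A G"
    using assms unfolding vector_deriv_def by blast
  have "F x * G' x + F' x * G x = (\<Sum>\<alpha>\<in>A. w \<alpha> x * (F x * g \<alpha> x + f \<alpha> x * G x))" for x
    using *(2,4) by (simp add: sum_distrib_left sum_distrib_right sum.distrib distrib_left mult_ac)
  then show ?thesis
    unfolding vector_deriv_def using *
    by (intro conjI poly_fun_mult exI[of _ "\<lambda>\<alpha> x. F x * g \<alpha> x + f \<alpha> x * G x"])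
      (auto intro: has_partial_mult)
qed

lemma vector_deriv_cong:
  "vector_deriv A w F G \<Longrightarrow> (\<And>x. G x = G' x) \<Longrightarrow> vector_deriv A w F G'"
  unfolding vector_deriv_def by simp

lemma vector_deriv_cmult:
  "vector_deriv A w F G \<Longrightarrow> vector_deriv A w (\<lambda>x. c * F x) (\<lambda>x. c * G x)"
  using vector_deriv_mult[OF vector_deriv_const, of A w F G c] by simp

lemma vector_deriv_diff:
  "vector_deriv A w F F' \<Longrightarrow> vector_deriv A w G G' \<Longrightarrow>
    vector_deriv A w (\<lambda>x. F x - G x) (\<lambda>x. F' x - G' x)"
  using vector_deriv_add[of A w F F' "\<lambda>x. - 1 * G x" "\<lambda>x. - 1 * G' x"] vector_deriv_cmult[of A w G G' "-1"]
  by simp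

lemma vector_deriv_sum:
  "(\<And>i. i \<in> S \<Longrightarrow> vector_deriv A w (F i) (G i)) \<Longrightarrow>
    vector_deriv A w (\<lambda>x. \<Sum>i\<in>S. F i x) (\<lambda>x. \<Sum>i\<in>S. G i x)"
  by (induction S rule: infinite_finite_induct) (auto intro: vector_deriv_const vector_deriv_add)

lemma vector_deriv_poly_fun: "vector_deriv A w F G \<Longrightarrow> poly_fun A F"
  unfolding vector_deriv_def by blast

lemma vector_deriv_poly_fun':
  assumes "vector_deriv A w F G" "\<And>\<alpha>. \<alpha> \<in> A \<Longrightarrow> poly_fun A (w \<alpha>)"
  shows "poly_fun A G"
proof -
  obtain g where *: "\<forall>\<alpha>\<in>A. has_partial A \<alpha> F (g \<alpha>)" "\<forall>x. G x = (\<Sum>\<alpha>\<in>A. w \<alpha> x * g \<alpha> x)"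
    using assms unfolding vector_deriv_def by blast
  then have "G = (\<lambda>x. \<Sum>\<alpha>\<in>A. w \<alpha> x * g \<alpha> x)" by auto
  then show ?thesis using * assms(2)
    by (auto intro!: poly_fun_sum poly_fun_mult simp: has_partial_def)
qed

text \<open>Stein's identity is applied to each \<open>w \<alpha> * F\<close> and summed; the sum of
  the \<open>w' \<alpha>\<close> is the divergence of the field.\<close>

lemma gauss_Stein_vector:
  assumes "finite A" and F: "vector_deriv A w F G"
    and w: "\<And>\<alpha>. \<alpha> \<in> A \<Longrightarrow> has_partial A \<alpha> (w \<alpha>) (w' \<alpha>)"
  shows "(LINT x|gauss A. (\<Sum>\<alpha>\<in>A. complex_of_real (x \<alpha>) * w \<alpha> x) * F x)
    = (LINT x|gauss A. (\<Sum>\<alpha>\<in>A. w' \<alpha> x) * F x + G x)"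
proof -
  obtain g where g: "\<forall>\<alpha>\<in>A. has_partial A \<alpha> F (g \<alpha>)" "\<forall>x. G x = (\<Sum>\<alpha>\<in>A. w \<alpha> x * g \<alpha> x)"
    using F unfolding vector_deriv_def by blast
  have hp: "has_partial A \<alpha> (\<lambda>x. w \<alpha> x * F x) (\<lambda>x. w \<alpha> x * g \<alpha> x + w' \<alpha> x * F x)" if "\<alpha> \<in> A" for \<alpha>
    using has_partial_mult[OF w[OF that], of F "g \<alpha>"] g that by auto
  have "(LINT x|gauss A. (\<Sum>\<alpha>\<in>A. complex_of_real (x \<alpha>) * w \<alpha> x) * F x)
    = (LINT x|gauss A. (\<Sum>\<alpha>\<in>A. complex_of_real (x \<alpha>) * (w \<alpha> x * F x)))"
    by (simp add: sum_distrib_right mult.assoc)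
  also have "\<dots> = (\<Sum>\<alpha>\<in>A. LINT x|gauss A. complex_of_real (x \<alpha>) * (w \<alpha> x * F x))"
    using hp by (intro Bochner_Integration.integral_sum poly_fun_integrable \<open>finite A\<close> poly_fun_mult[OF poly_fun_coord])
      (auto simp: has_partial_def)
  also have "\<dots> = (\<Sum>\<alpha>\<in>A. LINT x|gauss A. w \<alpha> x * g \<alpha> x + w' \<alpha> x * F x)"
    using hp by (intro sum.cong refl gauss_Stein \<open>finite A\<close>) (auto simp: has_partial_def)
  also have "\<dots> = (LINT x|gauss A. (\<Sum>\<alpha>\<in>A. w \<alpha> x * g \<alpha> x + w' \<alpha> x * F x))"
    using hp by (intro Bochner_Integration.integral_sum[symmetric] poly_fun_integrable \<open>finite A\<close>)
      (auto simp: has_partial_def)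
  also have "\<dots> = (LINT x|gauss A. (\<Sum>\<alpha>\<in>A. w' \<alpha> x) * F x + G x)"
    using g by (simp add: sum.distrib sum_distrib_right add.commute)
  finally show ?thesis .
qed

text \<open>Bookkeeping of the loop equations: the terms in which one of the traces is
  differentiated. A factor \<open>m = 0\<close> makes the truncated subtraction harmless.\<close>

fun merges :: "nat \<Rightarrow> nat list \<Rightarrow> (nat \<times> nat list) list" where
  "merges k [] = []"
| "merges k (m # ms) = (m, (k + m - 1) # ms) # map (\<lambda>(c, l). (c, m # l)) (merges k ms)"

text \<open>This yields termination of the recursion: relative to the list
  \<open>Suc k # ms\<close>, every merge with nonzero coefficient lowers the total degree by two. A
  positive \<open>c\<close> is the merged index itself, so the subtraction in
  \<open>k + m - 1\<close> is then not truncated.\<close>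

lemma merges_sum_list: "(c, l) \<in> set (merges k ms) \<Longrightarrow> c > 0 \<Longrightarrow> sum_list l + 1 = k + sum_list ms"
proof (induction ms arbitrary: c l)
  case (Cons m ms)
  then show ?case by (cases "(c, l) = (m, (k + m - 1) # ms)") (auto simp: image_iff split: prod.splits)
qed simp

text \<open>The derivation determined by sending \<open>t m\<close> to
  \<open>m * t (k + m - 1)\<close>, applied to the product of the \<open>t m\<close> over the
  list.\<close>

definition merge_term :: "(nat \<Rightarrow> 'a::comm_semiring_1) \<Rightarrow> nat \<Rightarrow> nat list \<Rightarrow> 'a" where
  "merge_term t k ms = (\<Sum>(c, l)\<leftarrow>merges k ms. of_nat c * prod_list (map t l))"

lemma merge_term_Nil [simp]: "merge_term t k [] = 0"
  by (simp add: merge_term_def)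

lemma merge_term_Cons [simp]:
  "merge_term t k (m # ms) = of_nat m * t (k + m - 1) * prod_list (map t ms) + t m * merge_term t k ms"
  unfolding merge_term_def
  by (simp add: mult.assoc sum_list_const_mult [symmetric] o_def case_prod_unfold mult.left_commute)

text \<open>Induction on total degree, then on the number of factors. A leading zero removes one
  factor at equal degree; a leading \<open>Suc k\<close> only produces terms whose degree is lower
  by two, apart from merges with coefficient zero.\<close>

lemma loop_equations_unique:
  fixes m m' :: "nat list \<Rightarrow> 'a::comm_semiring_1"
  assumes "m [] = m' []"
    and "\<And>ms. m (0 # ms) = N * m ms" "\<And>ms. m' (0 # ms) = N * m' ms"
    and "\<And>k ms. m (Suc k # ms) = (\<Sum>r<k. m (r # (k - 1 - r) # ms)) + (\<Sum>(c, l)\<leftarrow>merges k ms. of_nat c * m l)"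
    and "\<And>k ms. m' (Suc k # ms) = (\<Sum>r<k. m' (r # (k - 1 - r) # ms)) + (\<Sum>(c, l)\<leftarrow>merges k ms. of_nat c * m' l)"
  shows "m ms = m' ms"
proof (induction "(sum_list ms, length ms)" arbitrary: ms rule: wf_induct_rule[OF wf_lex_prod[OF wf_less_than wf_less_than]])
  case 1
  have IH: "m l = m' l" if "sum_list l < sum_list ms \<or> sum_list l = sum_list ms \<and> length l < length ms" for l
    by (rule 1) (use that in auto)
  show ?case
  proof (cases ms)
    case Nil
    then show ?thesis using assms(1) by simp
  next
    case (Cons j l)
    show ?thesis
    proof (cases j)
      case 0
      then show ?thesis using Cons assms(2,3) IH[of l] by simp
    next
      case (Suc k)
      have "(\<Sum>(c, l)\<leftarrow>merges k l. of_nat c * m l) = (\<Sum>(c, l)\<leftarrow>merges k l. of_nat c * m' l)"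
      proof (rule arg_cong[where f = sum_list], rule map_cong[OF refl], clarify)
        fix c l' assume "(c, l') \<in> set (merges k l)"
        then show "of_nat c * m l' = of_nat c * m' l'"
          using merges_sum_list[of c l' k l] IH[of l'] Cons Suc by (cases "c = 0") auto
      qed
      moreover have "(\<Sum>r<k. m (r # (k - 1 - r) # l)) = (\<Sum>r<k. m' (r # (k - 1 - r) # l))"
        using Cons Suc by (intro sum.cong refl IH) auto
      ultimately show ?thesis unfolding Cons Suc assms(4,5) by simp
    qed
  qed
qed

subsection \<open>Loop equations for the GUE\<close>

text \<open>An orthonormal basis, for the trace inner product, of the real space of Hermitian
  matrices: diagonal units, symmetric matrices at \<open>a < b\<close>, and imaginary antisymmetric
  ones at \<open>a > b\<close>. Independent standard Gaussian coordinates in this basis give the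
  GUE.\<close>

definition gue_basis :: "nat \<times> nat \<Rightarrow> nat \<Rightarrow> nat \<Rightarrow> complex" where
  "gue_basis = (\<lambda>(a, b) i j.
     if a = b then (if i = a \<and> j = a then 1 else 0)
     else if a < b then (if (i, j) = (a, b) \<or> (i, j) = (b, a) then 1 / sqrt 2 else 0)
     else (if (i, j) = (b, a) then \<i> / sqrt 2 else if (i, j) = (a, b) then - \<i> / sqrt 2 else 0))"

abbreviation gue_index :: "nat \<Rightarrow> (nat \<times> nat) set" where
  "gue_index n \<equiv> {..<n} \<times> {..<n}"

definition gue_entry :: "nat \<Rightarrow> nat \<Rightarrow> nat \<Rightarrow> (nat \<times> nat \<Rightarrow> real) \<Rightarrow> complex" where
  "gue_entry n i j x = (\<Sum>\<alpha>\<in>gue_index n. complex_of_real (x \<alpha>) * gue_basis \<alpha> i j)"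

lemma gue_basis_eq_0: "\<alpha> \<noteq> (i, j) \<Longrightarrow> \<alpha> \<noteq> (j, i) \<Longrightarrow> gue_basis \<alpha> i j = 0"
proof (cases \<alpha>)
  case (Pair a b)
  assume "\<alpha> \<noteq> (i, j)" "\<alpha> \<noteq> (j, i)"
  then have n: "(i, j) \<noteq> (a, b)" "(i, j) \<noteq> (b, a)" "\<not> (i = a \<and> j = a \<and> a = b)"
    unfolding Pair by blast+
  then show ?thesis unfolding Pair gue_basis_def prod.case
    by (cases "a = b") (simp_all only: n if_False if_True simp_thms if_cancel of_real_0)
qed

lemma gue_basis_sum:
  assumes "i < n" "j < n"
  shows "(\<Sum>\<alpha>\<in>gue_index n. f \<alpha> * gue_basis \<alpha> i j) =
    (if i = j then f (i, i) * gue_basis (i, i) i i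
     else f (i, j) * gue_basis (i, j) i j + f (j, i) * gue_basis (j, i) i j)"
proof -
  have "(\<Sum>\<alpha>\<in>gue_index n. f \<alpha> * gue_basis \<alpha> i j) = (\<Sum>\<alpha>\<in>{(i, j), (j, i)}. f \<alpha> * gue_basis \<alpha> i j)"
    using assms by (intro sum.mono_neutral_right) (auto simp: gue_basis_eq_0)
  then show ?thesis by auto
qed

text \<open>Wick's covariance \<open>E[H_ij H_kl] = \<delta>_il \<delta>_jk\<close>. Off the
  diagonal the symmetric and the imaginary contribution are each 1/2 in size: they add up when (k,
  l) = (j, i) and cancel when (k, l) = (i, j).\<close>

lemma gue_basis_covariance:
  assumes "i < n" "j < n"
  shows "(\<Sum>\<alpha>\<in>gue_index n. gue_basis \<alpha> i j * gue_basis \<alpha> k l) = (if i = l \<and> j = k then 1 else 0)"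
proof -
  have s: "complex_of_real (sqrt 2) * complex_of_real (sqrt 2) = 2"
    by (simp flip: of_real_mult)
  show ?thesis
    unfolding mult.commute[of "gue_basis _ i j"] gue_basis_sum[OF assms]
    by (auto simp: gue_basis_def field_simps s)
qed

lemma gue_entry_eq:
  assumes "i < n" "j < n"
  shows "gue_entry n i j x = (if i = j then complex_of_real (x (i, i))
    else if i < j then Complex (x (i, j) / sqrt 2) (x (j, i) / sqrt 2)
    else Complex (x (j, i) / sqrt 2) (- x (i, j) / sqrt 2))"
  unfolding gue_entry_def gue_basis_sum[OF assms]
  by (auto simp: gue_basis_def complex_eq_iff)

text \<open>Entries of matrix powers as scalar functions of the coordinates, the form in which they
  can be differentiated; \<open>pow_mat_gue_power\<close> links them to actual matrix
  powers.\<close>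

fun gue_power :: "nat \<Rightarrow> nat \<Rightarrow> nat \<Rightarrow> nat \<Rightarrow> (nat \<times> nat \<Rightarrow> real) \<Rightarrow> complex" where
  "gue_power n 0 i j x = (if i = j then 1 else 0)"
| "gue_power n (Suc k) i j x = (\<Sum>l<n. gue_power n k i l x * gue_entry n l j x)"

definition gue_trace :: "nat \<Rightarrow> nat \<Rightarrow> (nat \<times> nat \<Rightarrow> real) \<Rightarrow> complex" where
  "gue_trace n k x = (\<Sum>i<n. gue_power n k i i x)"

lemma gue_power_add:
  assumes "j < n"
  shows "(\<Sum>l<n. gue_power n r i l x * gue_power n s l j x) = gue_power n (r + s) i j x"
  using assms
proof (induction s arbitrary: j)
  case 0
  then show ?case by (simp add: if_distrib [of "\<lambda>z. _ * z"] sum.delta cong: if_cong)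
next
  case (Suc s)
  have "(\<Sum>l<n. gue_power n r i l x * gue_power n (Suc s) l j x)
    = (\<Sum>m<n. (\<Sum>l<n. gue_power n r i l x * gue_power n s l m x) * gue_entry n m j x)"
    by (simp add: sum_distrib_left sum_distrib_right mult.assoc) (rule sum.swap)
  also have "\<dots> = (\<Sum>m<n. gue_power n (r + s) i m x * gue_entry n m j x)"
    by (intro sum.cong refl) (simp add: Suc.IH)
  finally show ?case by simp
qed

text \<open>Formal differentiation by the entry \<open>H_ba\<close>, all entries being treated as
  independent variables. The transposed index pair comes from the covariance: integrating out a
  factor \<open>H_ab\<close> differentiates by \<open>H_ba\<close>.\<close>

definition gue_deriv :: "nat \<Rightarrow> nat \<Rightarrow> nat \<Rightarrow> ((nat \<times> nat \<Rightarrow> real) \<Rightarrow> complex) \<Rightarrow> ((nat \<times> nat \<Rightarrow> real) \<Rightarrow> complex) \<Rightarrow> bool" where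
  "gue_deriv n a b = vector_deriv (gue_index n) (\<lambda>\<alpha> _. gue_basis \<alpha> a b)"

text \<open>The field has constant coefficients, hence no divergence, and only the derivative of
  \<open>F\<close> survives.\<close>

lemma gue_Wick:
  assumes "gue_deriv n a b F G"
  shows "(LINT x|gauss (gue_index n). gue_entry n a b x * F x) = (LINT x|gauss (gue_index n). G x)"
  using gauss_Stein_vector[OF _ assms[unfolded gue_deriv_def] has_partial_const]
  by (simp add: gue_entry_def)

lemma gue_deriv_entry:
  assumes "a < n" "b < n" "i < n" "j < n"
  shows "gue_deriv n a b (gue_entry n i j) (\<lambda>_. if a = j \<and> b = i then 1 else 0)"
proof -
  have "gue_deriv n a b (\<lambda>x. \<Sum>\<alpha>\<in>gue_index n. gue_basis \<alpha> i j * complex_of_real (x \<alpha>))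
     (\<lambda>x. \<Sum>\<alpha>\<in>gue_index n. gue_basis \<alpha> i j * gue_basis \<alpha> a b)"
    unfolding gue_deriv_def
    by (intro vector_deriv_sum vector_deriv_cmult vector_deriv_coord) auto
  moreover have "(\<lambda>x. \<Sum>\<alpha>\<in>gue_index n. gue_basis \<alpha> i j * complex_of_real (x \<alpha>)) = gue_entry n i j"
    by (rule ext) (simp only: gue_entry_def mult.commute)
  moreover have "(if i = b \<and> j = a then 1 else 0) = (if a = j \<and> b = i then 1 else 0 :: complex)"
    by auto
  ultimately show ?thesis
    by (simp only: gue_basis_covariance[OF assms(3,4)])
qed

text \<open>The Leibniz rule: each of the \<open>k\<close> factors is removed in turn, leaving the
  power \<open>r\<close> to its left and \<open>k - 1 - r\<close> to its right. The induction peels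
  off the last factor.\<close>

lemma gue_deriv_power:
  assumes "a < n" "b < n" "i < n" "j < n"
  shows "gue_deriv n a b (gue_power n k i j) (\<lambda>x. \<Sum>r<k. gue_power n r i b x * gue_power n (k - 1 - r) a j x)"
  using assms
proof (induction k arbitrary: j)
  case 0
  then show ?case by (auto simp: gue_deriv_def vector_deriv_const fun_eq_iff)
next
  case (Suc k)
  let ?G = "\<lambda>x. \<Sum>l<n. gue_power n k i l x * (if a = j \<and> b = l then 1 else 0)
      + (\<Sum>r<k. gue_power n r i b x * gue_power n (k - 1 - r) a l x) * gue_entry n l j x"
  have "gue_deriv n a b (\<lambda>x. \<Sum>l<n. gue_power n k i l x * gue_entry n l j x) ?G"
    unfolding gue_deriv_def
    using Suc.IH gue_deriv_entry Suc.prems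
    by (intro vector_deriv_sum vector_deriv_mult) (auto simp: gue_deriv_def)
  moreover have "?G x = (\<Sum>r<Suc k. gue_power n r i b x * gue_power n (Suc k - 1 - r) a j x)" for x
  proof -
    have "(\<Sum>l<n. (\<Sum>r<k. gue_power n r i b x * gue_power n (k - 1 - r) a l x) * gue_entry n l j x)
      = (\<Sum>r<k. gue_power n r i b x * (\<Sum>l<n. gue_power n (k - 1 - r) a l x * gue_entry n l j x))"
      by (simp add: sum_distrib_left sum_distrib_right mult.assoc) (rule sum.swap)
    also have "\<dots> = (\<Sum>r<k. gue_power n r i b x * gue_power n (k - r) a j x)"
    proof (intro sum.cong refl)
      fix r assume "r \<in> {..<k}"
      then have "k - r = Suc (k - 1 - r)" by auto
      then show "gue_power n r i b x * (\<Sum>l<n. gue_power n (k - 1 - r) a l x * gue_entry n l j x)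
        = gue_power n r i b x * gue_power n (k - r) a j x" by simp
    qed
    moreover have "(\<Sum>l<n. gue_power n k i l x * (if a = j \<and> b = l then 1 else 0))
      = gue_power n k i b x * (if a = j then 1 else 0)"
      using \<open>b < n\<close> by (cases "a = j") (simp_all add: if_distrib [of "\<lambda>z. _ * z"] sum.delta' cong: if_cong)
    ultimately show ?thesis by (simp add: sum.distrib)
  qed
  ultimately show ?case
    unfolding gue_deriv_def gue_power.simps(2)[abs_def] by (rule vector_deriv_cong)
qed

text \<open>Closing up the trace joins the left and right powers, so all \<open>k\<close> Leibniz
  terms become equal.\<close>

lemma gue_deriv_trace:
  assumes "a < n" "b < n"
  shows "gue_deriv n a b (gue_trace n k) (\<lambda>x. of_nat k * gue_power n (k - 1) a b x)"
proof -
  have "gue_deriv n a b (\<lambda>x. \<Sum>i<n. gue_power n k i i x)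
     (\<lambda>x. \<Sum>i<n. \<Sum>r<k. gue_power n r i b x * gue_power n (k - 1 - r) a i x)"
    using gue_deriv_power assms unfolding gue_deriv_def by (intro vector_deriv_sum) auto
  moreover have "(\<Sum>i<n. \<Sum>r<k. gue_power n r i b x * gue_power n (k - 1 - r) a i x)
    = of_nat k * gue_power n (k - 1) a b x" for x
  proof -
    have "(\<Sum>i<n. \<Sum>r<k. gue_power n r i b x * gue_power n (k - 1 - r) a i x)
      = (\<Sum>r<k. \<Sum>i<n. gue_power n (k - 1 - r) a i x * gue_power n r i b x)"
      by (subst sum.swap) (simp add: mult.commute)
    also have "\<dots> = (\<Sum>r<k. gue_power n (k - 1 - r + r) a b x)"
      by (simp only: gue_power_add[OF assms(2)])
    also have "\<dots> = (\<Sum>r<k. gue_power n (k - 1) a b x)" by (intro sum.cong) auto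
    finally show ?thesis by simp
  qed
  ultimately show ?thesis
    unfolding gue_deriv_def gue_trace_def[abs_def] by (rule vector_deriv_cong)
qed

fun gue_deriv_traces :: "nat \<Rightarrow> nat \<Rightarrow> nat \<Rightarrow> nat list \<Rightarrow> (nat \<times> nat \<Rightarrow> real) \<Rightarrow> complex" where
  "gue_deriv_traces n a b [] x = 0"
| "gue_deriv_traces n a b (m # ms) x =
    gue_trace n m x * gue_deriv_traces n a b ms x
      + of_nat m * gue_power n (m - 1) a b x * (\<Prod>k\<leftarrow>ms. gue_trace n k x)"

lemma gue_deriv_prod_traces:
  assumes "a < n" "b < n"
  shows "gue_deriv n a b (\<lambda>x. \<Prod>k\<leftarrow>ms. gue_trace n k x) (gue_deriv_traces n a b ms)"
proof (induction ms)
  case Nil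
  show ?case using vector_deriv_const[of _ _ 1] by (simp add: gue_deriv_def)
next
  case (Cons m ms)
  then show ?case
    using vector_deriv_mult[OF gue_deriv_trace[OF assms, of m, unfolded gue_deriv_def], of _ "gue_deriv_traces n a b ms"]
    by (simp add: gue_deriv_def)
qed

text \<open>Differentiating a trace of order \<open>m\<close> leaves a matrix power of order
  \<open>m - 1\<close>; contracting it with the power \<open>k\<close> closes a new trace of order
  \<open>k + m - 1\<close>.\<close>

lemma gue_deriv_traces_merge:
  "(\<Sum>a<n. \<Sum>b<n. gue_power n k b a x * gue_deriv_traces n a b ms x) = merge_term (\<lambda>k. gue_trace n k x) k ms"
proof (induction ms)
  case (Cons m ms)
  have *: "(\<Sum>a<n. \<Sum>b<n. of_nat m * (gue_power n k b a x * gue_power n (m - 1) a b x)) = of_nat m * gue_trace n (k + m - 1) x"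
  proof (cases m)
    case (Suc m')
    have "(\<Sum>a<n. \<Sum>b<n. gue_power n k b a x * gue_power n m' a b x) = (\<Sum>b<n. \<Sum>a<n. gue_power n k b a x * gue_power n m' a b x)"
      by (rule sum.swap)
    also have "\<dots> = (\<Sum>b<n. gue_power n (k + m') b b x)"
      by (intro sum.cong refl gue_power_add) auto
    finally show ?thesis using Suc by (simp add: gue_trace_def sum_distrib_left [symmetric])
  qed simp
  have "(\<Sum>a<n. \<Sum>b<n. gue_power n k b a x * (of_nat m * gue_power n (m - 1) a b x * (\<Prod>k\<leftarrow>ms. gue_trace n k x)))
    = of_nat m * gue_trace n (k + m - 1) x * (\<Prod>k\<leftarrow>ms. gue_trace n k x)"
    unfolding * [symmetric] sum_distrib_right by (intro sum.cong refl) (simp add: mult_ac)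
  then have "(\<Sum>a<n. \<Sum>b<n. gue_power n k b a x * gue_deriv_traces n a b (m # ms) x)
     = gue_trace n m x * (\<Sum>a<n. \<Sum>b<n. gue_power n k b a x * gue_deriv_traces n a b ms x)
       + of_nat m * gue_trace n (k + m - 1) x * (\<Prod>k\<leftarrow>ms. gue_trace n k x)"
    by (simp add: distrib_left sum.distrib sum_distrib_left mult.left_commute)
  then show ?case by (simp add: Cons.IH add.commute)
qed simp

lemma poly_fun_gue_entry: "poly_fun (gue_index n) (gue_entry n i j)"
  unfolding gue_entry_def[abs_def]
  by (intro poly_fun_sum poly_fun_mult poly_fun_coord poly_fun_const)

lemma poly_fun_gue_power: "poly_fun (gue_index n) (gue_power n k i j)"
proof (induction k arbitrary: j)
  case 0
  show ?case by (cases "i = j") (simp_all add: poly_fun_const)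
next
  case (Suc k)
  then show ?case by (simp add: poly_fun_sum poly_fun_mult poly_fun_gue_entry)
qed

lemma poly_fun_gue_trace: "poly_fun (gue_index n) (gue_trace n k)"
  unfolding gue_trace_def[abs_def] by (intro poly_fun_sum poly_fun_gue_power)

lemma poly_fun_prod_list:
  "(\<And>k. k \<in> set ms \<Longrightarrow> poly_fun A (F k)) \<Longrightarrow> poly_fun A (\<lambda>x. \<Prod>k\<leftarrow>ms. F k x)"
  by (induction ms) (auto intro: poly_fun.intros)

text \<open>The weight \<open>W\<close> serves both models: it is 1 for the matrix and the squared
  Vandermonde for the gas.\<close>

lemma integral_merge_term:
  assumes "finite A" "\<And>k. poly_fun A (t k)" "poly_fun A W"
  shows "(LINT x|gauss A. W x * merge_term (\<lambda>k. t k x) k ms)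
     = (\<Sum>(c, l)\<leftarrow>merges k ms. of_nat c * (LINT x|gauss A. W x * (\<Prod>k\<leftarrow>l. t k x)))"
    and "poly_fun A (\<lambda>x. W x * merge_term (\<lambda>k. t k x) k ms)"
proof -
  have "poly_fun A (\<lambda>x. W x * (\<Sum>(c, l)\<leftarrow>xs. of_nat c * (\<Prod>k\<leftarrow>l. t k x))) \<and>
    (LINT x|gauss A. W x * (\<Sum>(c, l)\<leftarrow>xs. of_nat c * (\<Prod>k\<leftarrow>l. t k x)))
     = (\<Sum>(c, l)\<leftarrow>xs. of_nat c * (LINT x|gauss A. W x * (\<Prod>k\<leftarrow>l. t k x)))" for xs :: "(nat \<times> nat list) list"
  proof (induction xs)
    case Nil
    then show ?case by (simp add: poly_fun_const)
  next
    case (Cons y ys)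
    obtain c l where y: "y = (c, l)" by (cases y)
    have p: "poly_fun A (\<lambda>x. of_nat c * (W x * (\<Prod>k\<leftarrow>l. t k x)))"
      by (intro poly_fun_mult poly_fun_const assms poly_fun_prod_list)
    have e: "W x * (\<Sum>(c, l)\<leftarrow>y # ys. of_nat c * (\<Prod>k\<leftarrow>l. t k x))
      = of_nat c * (W x * (\<Prod>k\<leftarrow>l. t k x)) + W x * (\<Sum>(c, l)\<leftarrow>ys. of_nat c * (\<Prod>k\<leftarrow>l. t k x))" for x
      by (simp add: y algebra_simps)
    show ?case
      unfolding e
      using poly_fun_add[OF p conjunct1[OF Cons.IH]] conjunct2[OF Cons.IH]
      by (subst Bochner_Integration.integral_add)
        (auto intro!: poly_fun_integrable[OF _ \<open>finite A\<close>] p conjunct1[OF Cons.IH] simp: y)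
  qed
  then show "(LINT x|gauss A. W x * merge_term (\<lambda>k. t k x) k ms)
     = (\<Sum>(c, l)\<leftarrow>merges k ms. of_nat c * (LINT x|gauss A. W x * (\<Prod>k\<leftarrow>l. t k x)))"
    and "poly_fun A (\<lambda>x. W x * merge_term (\<lambda>k. t k x) k ms)"
    by (simp_all add: merge_term_def o_def)
qed

text \<open>One factor \<open>H_ab\<close> is split off the leading trace and integrated out. The
  derivative either hits the rest of the same power, cutting the trace in two, or another trace,
  which is merged with it.\<close>

lemma gue_loop_equation:
  "(LINT x|gauss (gue_index n). (\<Prod>k\<leftarrow>Suc k # ms. gue_trace n k x))
    = (\<Sum>r<k. LINT x|gauss (gue_index n). (\<Prod>k\<leftarrow>r # (k - 1 - r) # ms. gue_trace n k x))
      + (\<Sum>(c, l)\<leftarrow>merges k ms. of_nat c * (LINT x|gauss (gue_index n). (\<Prod>k\<leftarrow>l. gue_trace n k x)))"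
proof -
  let ?G = "gauss (gue_index n)"
  let ?P = "\<lambda>x. \<Prod>k\<leftarrow>ms. gue_trace n k x"
  have fin: "finite (gue_index n)" by simp
  have P: "poly_fun (gue_index n) ?P" by (intro poly_fun_prod_list poly_fun_gue_trace)
  \<comment> \<open>The first summand differentiates the other traces, the second the remaining
    power of the leading trace.\<close>
  let ?D = "\<lambda>a b x. gue_power n k b a x * gue_deriv_traces n a b ms x +
      (\<Sum>r<k. gue_power n r b b x * gue_power n (k - 1 - r) a a x) * ?P x"
  have d: "gue_deriv n a b (\<lambda>x. gue_power n k b a x * ?P x) (?D a b)" if "a < n" "b < n" for a b
    using vector_deriv_mult[OF gue_deriv_power[OF that that(2,1), unfolded gue_deriv_def]
        gue_deriv_prod_traces[OF that, unfolded gue_deriv_def]]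
    unfolding gue_deriv_def .
  have pD: "poly_fun (gue_index n) (?D a b)" if "a < n" "b < n" for a b
    using vector_deriv_poly_fun'[OF d[OF that, unfolded gue_deriv_def]] poly_fun_const by blast
  have "(LINT x|?G. (\<Prod>k\<leftarrow>Suc k # ms. gue_trace n k x))
    = (LINT x|?G. (\<Sum>b<n. \<Sum>a<n. gue_entry n a b x * (gue_power n k b a x * ?P x)))"
  proof (rule Bochner_Integration.integral_cong[OF refl])
    fix x
    have "(\<Prod>k\<leftarrow>Suc k # ms. gue_trace n k x) = (\<Sum>b<n. \<Sum>a<n. gue_power n k b a x * gue_entry n a b x) * ?P x"
      by (simp add: gue_trace_def)
    then show "(\<Prod>k\<leftarrow>Suc k # ms. gue_trace n k x)
      = (\<Sum>b<n. \<Sum>a<n. gue_entry n a b x * (gue_power n k b a x * ?P x))"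
      by (simp only: sum_distrib_right mult.assoc mult.left_commute)
  qed
  also have "\<dots> = (\<Sum>b<n. \<Sum>a<n. LINT x|?G. gue_entry n a b x * (gue_power n k b a x * ?P x))"
    by (subst Bochner_Integration.integral_sum,
        intro poly_fun_integrable fin poly_fun_sum poly_fun_mult P poly_fun_gue_entry poly_fun_gue_power,
        intro sum.cong refl Bochner_Integration.integral_sum,
        intro poly_fun_integrable fin poly_fun_sum poly_fun_mult P poly_fun_gue_entry poly_fun_gue_power)
  also have "\<dots> = (\<Sum>b<n. \<Sum>a<n. LINT x|?G. ?D a b x)"
    by (intro sum.cong refl gue_Wick d) auto
  also have "\<dots> = (LINT x|?G. (\<Sum>b<n. \<Sum>a<n. ?D a b x))"
    by (subst Bochner_Integration.integral_sum, intro poly_fun_integrable fin poly_fun_sum pD, simp, simp,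
        intro sum.cong refl Bochner_Integration.integral_sum[symmetric] poly_fun_integrable fin pD) auto
  also have "\<dots> = (LINT x|?G. (\<Sum>r<k. (\<Prod>k\<leftarrow>r # (k - 1 - r) # ms. gue_trace n k x)) + 1 * merge_term (\<lambda>k. gue_trace n k x) k ms)"
  proof (rule Bochner_Integration.integral_cong[OF refl])
    fix x
    have "(\<Sum>b<n. \<Sum>a<n. (\<Sum>r<k. gue_power n r b b x * gue_power n (k - 1 - r) a a x))
      = (\<Sum>r<k. \<Sum>b<n. \<Sum>a<n. gue_power n r b b x * gue_power n (k - 1 - r) a a x)"
      by (subst (2) sum.swap) (subst sum.swap, rule refl)
    also have "\<dots> = (\<Sum>r<k. gue_trace n r x * gue_trace n (k - 1 - r) x)"
      by (simp add: gue_trace_def sum_product)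
    finally have *: "(\<Sum>b<n. \<Sum>a<n. (\<Sum>r<k. gue_power n r b b x * gue_power n (k - 1 - r) a a x))
      = (\<Sum>r<k. gue_trace n r x * gue_trace n (k - 1 - r) x)" .
    have "(\<Sum>b<n. \<Sum>a<n. ?D a b x)
      = (\<Sum>b<n. \<Sum>a<n. gue_power n k b a x * gue_deriv_traces n a b ms x)
        + (\<Sum>b<n. \<Sum>a<n. (\<Sum>r<k. gue_power n r b b x * gue_power n (k - 1 - r) a a x)) * ?P x"
      by (simp add: sum.distrib sum_distrib_right)
    also have "(\<Sum>b<n. \<Sum>a<n. gue_power n k b a x * gue_deriv_traces n a b ms x) = merge_term (\<lambda>k. gue_trace n k x) k ms"
      by (subst sum.swap) (rule gue_deriv_traces_merge)
    finally show "(\<Sum>b<n. \<Sum>a<n. ?D a b x)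
      = (\<Sum>r<k. (\<Prod>k\<leftarrow>r # (k - 1 - r) # ms. gue_trace n k x)) + 1 * merge_term (\<lambda>k. gue_trace n k x) k ms"
      unfolding * by (simp add: sum_distrib_right mult.assoc)
  qed
  also have "\<dots> = (\<Sum>r<k. LINT x|?G. (\<Prod>k\<leftarrow>r # (k - 1 - r) # ms. gue_trace n k x))
      + (LINT x|?G. 1 * merge_term (\<lambda>k. gue_trace n k x) k ms)"
    by (subst Bochner_Integration.integral_add,
        intro poly_fun_integrable fin poly_fun_sum poly_fun_prod_list poly_fun_gue_trace,
        intro poly_fun_integrable fin integral_merge_term poly_fun_gue_trace poly_fun_const,
        subst Bochner_Integration.integral_sum,
        intro poly_fun_integrable fin poly_fun_prod_list poly_fun_gue_trace, rule refl)
  also have "(LINT x|?G. 1 * merge_term (\<lambda>k. gue_trace n k x) k ms)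
    = (\<Sum>(c, l)\<leftarrow>merges k ms. of_nat c * (LINT x|?G. (\<Prod>k\<leftarrow>l. gue_trace n k x)))"
    using integral_merge_term(1)[OF fin poly_fun_gue_trace poly_fun_const[of _ 1]] by simp
  finally show ?thesis .
qed

subsection \<open>Loop equations for the Coulomb gas\<close>

text \<open>Complex-valued, although its values are real, so that it is a \<open>poly_fun\<close>
  and can be multiplied with the other integrands.\<close>

definition sq_vandermonde :: "nat \<Rightarrow> (nat \<Rightarrow> real) \<Rightarrow> complex" where
  "sq_vandermonde n x = (\<Prod>j<n. \<Prod>i<j. (complex_of_real (x j) - complex_of_real (x i))\<^sup>2)"

definition power_sum :: "nat \<Rightarrow> nat \<Rightarrow> (nat \<Rightarrow> real) \<Rightarrow> complex" where
  "power_sum n k x = (\<Sum>i<n. complex_of_real (x i) ^ k)"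

lemma has_partial_power:
  assumes "i \<in> A"
  shows "has_partial A i (\<lambda>x. complex_of_real (x i) ^ k) (\<lambda>x. of_nat k * complex_of_real (x i) ^ (k - 1))"
proof (induction k)
  case 0
  then show ?case using has_partial_const[of A i 1] by simp
next
  case (Suc k)
  have "(\<lambda>x. complex_of_real (x i) * (of_nat k * complex_of_real (x i) ^ (k - 1)) + 1 * complex_of_real (x i) ^ k)
    = (\<lambda>x. of_nat (Suc k) * complex_of_real (x i) ^ (Suc k - 1))"
    by (cases k) (simp_all add: algebra_simps)
  then show ?case
    using has_partial_mult[OF has_partial_coord[OF assms, of i] Suc] by simp
qed

text \<open>These fields satisfy the commutation relations of the Witt algebra; the identities they
  give for matrix integrals are known as Virasoro constraints.\<close>

abbreviation virasoro_deriv :: "nat \<Rightarrow> nat \<Rightarrow> ((nat \<Rightarrow> real) \<Rightarrow> complex) \<Rightarrow> ((nat \<Rightarrow> real) \<Rightarrow> complex) \<Rightarrow> bool" where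
  "virasoro_deriv n k \<equiv> vector_deriv {..<n} (\<lambda>i x. complex_of_real (x i) ^ k)"

lemma virasoro_deriv_power:
  assumes "i < n"
  shows "virasoro_deriv n k (\<lambda>x. complex_of_real (x i) ^ m) (\<lambda>x. of_nat m * complex_of_real (x i) ^ (k + m - 1))"
proof (induction m)
  case 0
  then show ?case using vector_deriv_const[of _ _ 1] by simp
next
  case (Suc m)
  have "(\<lambda>x. complex_of_real (x i) * (of_nat m * complex_of_real (x i) ^ (k + m - 1)) + complex_of_real (x i) ^ k * complex_of_real (x i) ^ m)
    = (\<lambda>x. of_nat (Suc m) * complex_of_real (x i) ^ (k + Suc m - 1))"
    by (cases m) (simp_all add: algebra_simps power_add)
  then show ?case
    using vector_deriv_mult[OF vector_deriv_coord[of i "{..<n}" "\<lambda>i x. complex_of_real (x i) ^ k"] Suc] assms by simp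
qed

lemma virasoro_deriv_power_sum:
  "virasoro_deriv n k (power_sum n m) (\<lambda>x. of_nat m * power_sum n (k + m - 1) x)"
  using vector_deriv_sum[of "{..<n}" _ _ "\<lambda>i x. complex_of_real (x i) ^ m", OF virasoro_deriv_power]
  by (simp add: power_sum_def[abs_def] sum_distrib_left)

lemma virasoro_deriv_prod_power_sums:
  "virasoro_deriv n k (\<lambda>x. \<Prod>m\<leftarrow>ms. power_sum n m x) (\<lambda>x. merge_term (\<lambda>m. power_sum n m x) k ms)"
proof (induction ms)
  case Nil
  then show ?case using vector_deriv_const[of _ _ 1] by simp
next
  case (Cons m ms)
  show ?case
    using vector_deriv_mult[OF virasoro_deriv_power_sum[of n k m] Cons] by (simp add: add.commute)
qed

text \<open>Logarithmic derivatives add. The rule is phrased with \<open>F i x * h i x\<close>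
  instead of a quotient because the Vandermonde factors have zeros.\<close>

lemma vector_deriv_log_prod:
  assumes "\<And>i. i \<in> S \<Longrightarrow> vector_deriv A w (F i) (\<lambda>x. F i x * h i x)"
  shows "vector_deriv A w (\<lambda>x. \<Prod>i\<in>S. F i x) (\<lambda>x. (\<Prod>i\<in>S. F i x) * (\<Sum>i\<in>S. h i x))"
  using assms
proof (induction S rule: infinite_finite_induct)
  case (insert i S)
  then have "vector_deriv A w (\<lambda>x. F i x * (\<Prod>i\<in>S. F i x))
     (\<lambda>x. F i x * ((\<Prod>i\<in>S. F i x) * (\<Sum>i\<in>S. h i x)) + F i x * h i x * (\<Prod>i\<in>S. F i x))"
    by (intro vector_deriv_mult) auto
  then show ?case using insert(1,2) by (elim vector_deriv_cong[rotated] | simp add: algebra_simps)+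
qed (use vector_deriv_const[of A w 1] in simp_all)

lemma sum_symmetric_split:
  fixes h :: "nat \<Rightarrow> nat \<Rightarrow> 'a::comm_semiring_1"
  assumes "\<And>i j. h i j = h j i"
  shows "(\<Sum>j<n. \<Sum>i<n. h j i) = 2 * (\<Sum>j<n. \<Sum>i<j. h j i) + (\<Sum>j<n. h j j)"
proof (induction n)
  case (Suc n)
  have "(\<Sum>j<n. h j n) = (\<Sum>j<n. h n j)" using assms by simp
  with Suc show ?case by (simp add: sum.distrib mult_2 algebra_simps)
qed simp

text \<open>The field differentiates \<open>x_j - x_i\<close> to \<open>x_j^k - x_i^k\<close>, a
  multiple of it, so each squared factor has the polynomial logarithmic derivative
  \<open>2 h j i\<close>. Doubling turns the sum over \<open>i < j\<close> into the sum over all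
  pairs, a product of power sums, minus the diagonal.\<close>

lemma virasoro_deriv_sq_vandermonde:
  "virasoro_deriv n k (sq_vandermonde n)
    (\<lambda>x. sq_vandermonde n x * ((\<Sum>r<k. power_sum n r x * power_sum n (k - 1 - r) x) - of_nat k * power_sum n (k - 1) x))"
proof -
  \<comment> \<open>The quotient of \<open>x_j^k - x_i^k\<close> by \<open>x_j - x_i\<close>,
    symmetric in the two points and extended to the diagonal.\<close>
  define h where "h j i x = (\<Sum>r<k. complex_of_real (x j) ^ r * complex_of_real (x i) ^ (k - 1 - r))" for j i and x :: "nat \<Rightarrow> real"
  have fac: "virasoro_deriv n k (\<lambda>x. (complex_of_real (x j) - complex_of_real (x i))\<^sup>2)
     (\<lambda>x. (complex_of_real (x j) - complex_of_real (x i))\<^sup>2 * (2 * h j i x))" if "j < n" "i < j" for i j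
  proof -
    have d: "virasoro_deriv n k (\<lambda>x. complex_of_real (x j) - complex_of_real (x i))
     (\<lambda>x. complex_of_real (x j) ^ k - complex_of_real (x i) ^ k)"
      using that by (intro vector_deriv_diff vector_deriv_coord) auto
    have e: "complex_of_real (x j) ^ k - complex_of_real (x i) ^ k = (complex_of_real (x j) - complex_of_real (x i)) * h j i x" for x
      unfolding h_def power_diff_sumr2 by (simp add: mult.commute)
    show ?thesis
      using vector_deriv_mult[OF d d] unfolding power2_eq_square
      by (rule vector_deriv_cong) (simp only: e, simp add: algebra_simps)
  qed
  have "virasoro_deriv n k (\<lambda>x. \<Prod>j<n. \<Prod>i<j. (complex_of_real (x j) - complex_of_real (x i))\<^sup>2)
     (\<lambda>x. (\<Prod>j<n. \<Prod>i<j. (complex_of_real (x j) - complex_of_real (x i))\<^sup>2) * (\<Sum>j<n. \<Sum>i<j. 2 * h j i x))"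
    using fac by (intro vector_deriv_log_prod) auto
  moreover have "(\<Sum>j<n. \<Sum>i<j. 2 * h j i x)
    = (\<Sum>r<k. power_sum n r x * power_sum n (k - 1 - r) x) - of_nat k * power_sum n (k - 1) x" for x
  proof -
    have sym: "h i j x = h j i x" for i j
      unfolding h_def
      by (rule sum.reindex_bij_witness[of _ "\<lambda>r. k - 1 - r" "\<lambda>r. k - 1 - r"]) auto
    have "(\<Sum>j<n. \<Sum>i<n. h j i x) = (\<Sum>j<n. \<Sum>r<k. \<Sum>i<n. complex_of_real (x j) ^ r * complex_of_real (x i) ^ (k - 1 - r))"
      unfolding h_def by (intro sum.cong refl sum.swap)
    also have "\<dots> = (\<Sum>r<k. \<Sum>j<n. \<Sum>i<n. complex_of_real (x j) ^ r * complex_of_real (x i) ^ (k - 1 - r))"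
      by (rule sum.swap)
    also have "\<dots> = (\<Sum>r<k. power_sum n r x * power_sum n (k - 1 - r) x)"
      by (simp add: power_sum_def sum_product)
    finally have all: "(\<Sum>j<n. \<Sum>i<n. h j i x) = (\<Sum>r<k. power_sum n r x * power_sum n (k - 1 - r) x)" .
    have "h j j x = of_nat k * complex_of_real (x j) ^ (k - 1)" for j
    proof -
      have "h j j x = (\<Sum>r<k. complex_of_real (x j) ^ (k - 1))"
        unfolding h_def by (intro sum.cong refl) (simp add: power_add [symmetric])
      then show ?thesis by simp
    qed
    then have diag: "(\<Sum>j<n. h j j x) = of_nat k * power_sum n (k - 1) x"
      by (simp add: power_sum_def sum_distrib_left)
    have "(\<Sum>j<n. \<Sum>i<j. 2 * h j i x) = 2 * (\<Sum>j<n. \<Sum>i<j. h j i x)"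
      by (simp add: sum_distrib_left)
    then show ?thesis
      using sum_symmetric_split[of "\<lambda>j i. h j i x" n, OF sym] unfolding all diag by (simp add: algebra_simps)
  qed
  ultimately show ?thesis unfolding sq_vandermonde_def[abs_def] by simp
qed

lemma poly_fun_power_sum: "poly_fun {..<n} (power_sum n k)"
  using vector_deriv_poly_fun[OF virasoro_deriv_power_sum] .

lemma poly_fun_sq_vandermonde: "poly_fun {..<n} (sq_vandermonde n)"
  using vector_deriv_poly_fun[OF virasoro_deriv_sq_vandermonde] .

text \<open>Integration by parts along the field produces its divergence \<open>k p_(k-1)\<close>,
  which is exactly the diagonal term subtracted in
  \<open>virasoro_deriv_sq_vandermonde\<close>.\<close>

lemma coulomb_loop_equation:
  "(LINT x|gauss {..<n}. sq_vandermonde n x * (\<Prod>m\<leftarrow>Suc k # ms. power_sum n m x))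
    = (\<Sum>r<k. LINT x|gauss {..<n}. sq_vandermonde n x * (\<Prod>m\<leftarrow>r # (k - 1 - r) # ms. power_sum n m x))
      + (\<Sum>(c, l)\<leftarrow>merges k ms. of_nat c * (LINT x|gauss {..<n}. sq_vandermonde n x * (\<Prod>m\<leftarrow>l. power_sum n m x)))"
proof -
  let ?G = "gauss {..<n}"
  let ?P = "\<lambda>x. \<Prod>m\<leftarrow>ms. power_sum n m x"
  let ?F = "\<lambda>x. sq_vandermonde n x * ?P x"
  let ?D = "\<lambda>x. sq_vandermonde n x * merge_term (\<lambda>m. power_sum n m x) k ms + 
    sq_vandermonde n x * ((\<Sum>r<k. power_sum n r x * power_sum n (k - 1 - r) x) - of_nat k * power_sum n (k - 1) x) * ?P x"
  have fin: "finite {..<n}" by simp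
  \<comment> \<open>The cancellation in isolation: \<open>q\<close> is the divergence,
    \<open>v\<close> the weight, \<open>p\<close> the product of power sums, \<open>m\<close> the
    merge term and \<open>s\<close> the sum over all pairs.\<close>
  have gen: "q * (v * p) + (v * m + v * (s - q) * p) = v * s * p + v * m" for q v p m s :: complex
    by (simp add: algebra_simps)
  have d: "virasoro_deriv n k ?F ?D"
    by (rule vector_deriv_mult[OF virasoro_deriv_sq_vandermonde virasoro_deriv_prod_power_sums])
  have "(LINT x|?G. sq_vandermonde n x * (\<Prod>m\<leftarrow>Suc k # ms. power_sum n m x))
    = (LINT x|?G. (\<Sum>i<n. complex_of_real (x i) * complex_of_real (x i) ^ k) * ?F x)"
    by (simp add: power_sum_def mult_ac)
  also have "\<dots> = (LINT x|?G. (\<Sum>i<n. of_nat k * complex_of_real (x i) ^ (k - 1)) * ?F x + ?D x)"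
    by (rule gauss_Stein_vector[OF fin d has_partial_power])
  also have "\<dots> = (LINT x|?G. (\<Sum>r<k. sq_vandermonde n x * (\<Prod>m\<leftarrow>r # (k - 1 - r) # ms. power_sum n m x))
     + sq_vandermonde n x * merge_term (\<lambda>m. power_sum n m x) k ms)"
  proof (rule Bochner_Integration.integral_cong[OF refl])
    fix x
    have "(\<Sum>i<n. of_nat k * complex_of_real (x i) ^ (k - 1)) = of_nat k * power_sum n (k - 1) x"
      by (simp add: power_sum_def sum_distrib_left)
    moreover have "(\<Sum>r<k. sq_vandermonde n x * (\<Prod>m\<leftarrow>r # (k - 1 - r) # ms. power_sum n m x))
      = sq_vandermonde n x * (\<Sum>r<k. power_sum n r x * power_sum n (k - 1 - r) x) * ?P x"
      by (simp add: sum_distrib_left sum_distrib_right mult.assoc)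
    ultimately show "(\<Sum>i<n. of_nat k * complex_of_real (x i) ^ (k - 1)) * ?F x + ?D x =
      (\<Sum>r<k. sq_vandermonde n x * (\<Prod>m\<leftarrow>r # (k - 1 - r) # ms. power_sum n m x))
     + sq_vandermonde n x * merge_term (\<lambda>m. power_sum n m x) k ms"
      by (simp only: gen)
  qed
  also have "\<dots> = (\<Sum>r<k. LINT x|?G. sq_vandermonde n x * (\<Prod>m\<leftarrow>r # (k - 1 - r) # ms. power_sum n m x))
      + (LINT x|?G. sq_vandermonde n x * merge_term (\<lambda>m. power_sum n m x) k ms)"
    by (subst Bochner_Integration.integral_add,
        intro poly_fun_integrable fin poly_fun_sum poly_fun_mult poly_fun_sq_vandermonde poly_fun_prod_list poly_fun_power_sum,
        intro poly_fun_integrable fin integral_merge_term poly_fun_power_sum poly_fun_sq_vandermonde,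
        subst Bochner_Integration.integral_sum,
        intro poly_fun_integrable fin poly_fun_mult poly_fun_sq_vandermonde poly_fun_prod_list poly_fun_power_sum, rule refl)
  also have "(LINT x|?G. sq_vandermonde n x * merge_term (\<lambda>m. power_sum n m x) k ms)
    = (\<Sum>(c, l)\<leftarrow>merges k ms. of_nat c * (LINT x|?G. sq_vandermonde n x * (\<Prod>m\<leftarrow>l. power_sum n m x)))"
    by (rule integral_merge_term(1)[OF fin poly_fun_power_sum poly_fun_sq_vandermonde])
  finally show ?thesis .
qed

lemma sum_list_case_prod_cmult:
  "(\<Sum>(c, l)\<leftarrow>xs. of_nat c * (z * f l)) = z * (\<Sum>(c, l)\<leftarrow>xs. of_nat c * f l :: 'a::comm_semiring_1)"
  by (induction xs) (auto simp: algebra_simps)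

text \<open>The recursion is linear, so the unnormalised gas is compared with the matrix moments
  multiplied by the total mass, which matches the two at the empty list. Index zero contributes the
  factor \<open>n\<close> in both models.\<close>

lemma coulomb_moments_eq_gue_moments:
  "(LINT x|gauss {..<n}. sq_vandermonde n x * (\<Prod>k\<leftarrow>ms. power_sum n k x))
    = (LINT x|gauss {..<n}. sq_vandermonde n x) * (LINT x|gauss (gue_index n). (\<Prod>k\<leftarrow>ms. gue_trace n k x))"
proof -
  let ?Z = "LINT x|gauss {..<n}. sq_vandermonde n x"
  show ?thesis
  proof (rule loop_equations_unique[where N = "of_nat n"
      and m = "\<lambda>ms. LINT x|gauss {..<n}. sq_vandermonde n x * (\<Prod>k\<leftarrow>ms. power_sum n k x)"
      and m' = "\<lambda>ms. ?Z * (LINT x|gauss (gue_index n). (\<Prod>k\<leftarrow>ms. gue_trace n k x))"])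
    interpret prob_space "gauss (gue_index n)" by (rule prob_space_gauss)
    show "(LINT x|gauss {..<n}. sq_vandermonde n x * (\<Prod>k\<leftarrow>[]. power_sum n k x))
      = ?Z * (LINT x|gauss (gue_index n). (\<Prod>k\<leftarrow>[]. gue_trace n k x))"
      by (simp add: prob_space)
  next
    fix ms
    show "(LINT x|gauss {..<n}. sq_vandermonde n x * (\<Prod>k\<leftarrow>0 # ms. power_sum n k x))
      = of_nat n * (LINT x|gauss {..<n}. sq_vandermonde n x * (\<Prod>k\<leftarrow>ms. power_sum n k x))"
      by (simp add: power_sum_def mult.left_commute)
    show "?Z * (LINT x|gauss (gue_index n). (\<Prod>k\<leftarrow>0 # ms. gue_trace n k x))
      = of_nat n * (?Z * (LINT x|gauss (gue_index n). (\<Prod>k\<leftarrow>ms. gue_trace n k x)))"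
      by (simp add: gue_trace_def mult.left_commute)
  next
    fix k ms
    show "(LINT x|gauss {..<n}. sq_vandermonde n x * (\<Prod>m\<leftarrow>Suc k # ms. power_sum n m x))
    = (\<Sum>r<k. LINT x|gauss {..<n}. sq_vandermonde n x * (\<Prod>m\<leftarrow>r # (k - 1 - r) # ms. power_sum n m x))
      + (\<Sum>(c, l)\<leftarrow>merges k ms. of_nat c * (LINT x|gauss {..<n}. sq_vandermonde n x * (\<Prod>m\<leftarrow>l. power_sum n m x)))"
      by (rule coulomb_loop_equation)
    show "?Z * (LINT x|gauss (gue_index n). (\<Prod>k\<leftarrow>Suc k # ms. gue_trace n k x))
      = (\<Sum>r<k. ?Z * (LINT x|gauss (gue_index n). (\<Prod>k\<leftarrow>r # (k - 1 - r) # ms. gue_trace n k x)))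
      + (\<Sum>(c, l)\<leftarrow>merges k ms. of_nat c * (?Z * (LINT x|gauss (gue_index n). (\<Prod>k\<leftarrow>l. gue_trace n k x))))"
      unfolding gue_loop_equation sum_list_case_prod_cmult by (simp only: distrib_left sum_distrib_left)
  qed
qed

lemma abs_poly_le:
  fixes p :: "real poly"
  assumes "\<bar>y\<bar> \<le> K" "1 \<le> K"
  shows "\<bar>poly p y\<bar> \<le> (\<Sum>j\<le>degree p. \<bar>coeff p j\<bar>) * K ^ degree p"
proof -
  have "\<bar>poly p y\<bar> \<le> (\<Sum>j\<le>degree p. \<bar>coeff p j\<bar> * \<bar>y\<bar> ^ j)"
    unfolding poly_altdef by (rule order_trans[OF sum_abs]) (simp add: abs_mult power_abs)
  also have "\<dots> \<le> (\<Sum>j\<le>degree p. \<bar>coeff p j\<bar> * K ^ degree p)"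
  proof (intro sum_mono mult_left_mono)
    fix j assume "j \<in> {..degree p}"
    then have "K ^ j \<le> K ^ degree p" using assms(2) by (intro power_increasing) auto
    moreover have "\<bar>y\<bar> ^ j \<le> K ^ j" using assms(1) by (intro power_mono) auto
    ultimately show "\<bar>y\<bar> ^ j \<le> K ^ degree p" by linarith
  qed auto
  finally show ?thesis by (simp add: sum_distrib_right)
qed

subsection \<open>Linear statistics of random point configurations\<close>

definition lin_stat :: "nat \<Rightarrow> ('a \<Rightarrow> nat \<Rightarrow> real) \<Rightarrow> (real \<Rightarrow> real) \<Rightarrow> 'a \<Rightarrow> real" where
  "lin_stat n l f \<omega> = (\<Sum>i<n. f (l \<omega> i))"

text \<open>Only the power sums of the points \<open>l \<omega> i\<close> are required to be measurable, not the points
  themselves, because the eigenvalues of a random matrix come without a measurable enumeration.\<close>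

locale point_config =
  fixes M :: "'a measure" and w :: "'a \<Rightarrow> real" and n :: nat and l :: "'a \<Rightarrow> nat \<Rightarrow> real" and b :: "'a \<Rightarrow> real"
  assumes w_measurable [measurable]: "w \<in> borel_measurable M"
    and b_measurable [measurable]: "b \<in> borel_measurable M"
    and b_nonneg: "\<And>\<omega>. \<omega> \<in> space M \<Longrightarrow> 0 \<le> b \<omega>"
    and l_bound: "\<And>\<omega> i. \<omega> \<in> space M \<Longrightarrow> i < n \<Longrightarrow> \<bar>l \<omega> i\<bar> \<le> b \<omega>"
    and integrable_exp: "\<And>R. integrable M (\<lambda>\<omega>. w \<omega> * exp (R * b \<omega>))"
    and power_sum_measurable: "\<And>k. lin_stat n l (\<lambda>x. x ^ k) \<in> borel_measurable M"
begin

text \<open>The locale provides integrability of \<open>w\<close> against every exponential of the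
  envelope \<open>b\<close>, so domination by such an exponential is the working notion; it is
  stable under products because rates add.\<close>

definition exp_growth :: "('a \<Rightarrow> real) \<Rightarrow> bool" where
  "exp_growth F \<longleftrightarrow> F \<in> borel_measurable M \<and> (\<exists>C\<ge>0. \<exists>R\<ge>0. \<forall>\<omega>\<in>space M. \<bar>F \<omega>\<bar> \<le> C * exp (R * b \<omega>))"

abbreviation moment :: "(real \<Rightarrow> real) \<Rightarrow> nat \<Rightarrow> real" where
  "moment f m \<equiv> (LINT \<omega>|M. w \<omega> * lin_stat n l f \<omega> ^ m)"

lemma exp_growth_integrable:
  assumes "exp_growth F"
  shows "integrable M (\<lambda>\<omega>. w \<omega> * F \<omega>)"
proof -
  obtain C R where F [measurable]: "F \<in> borel_measurable M" and *: "C \<ge> 0" "\<forall>\<omega>\<in>space M. \<bar>F \<omega>\<bar> \<le> C * exp (R * b \<omega>)"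
    using assms unfolding exp_growth_def by blast
  have "integrable M (\<lambda>\<omega>. C * (w \<omega> * exp (R * b \<omega>)))"
    by (intro integrable_mult_right integrable_exp)
  then show ?thesis
  proof (rule Bochner_Integration.integrable_bound)
    show "AE \<omega> in M. norm (w \<omega> * F \<omega>) \<le> norm (C * (w \<omega> * exp (R * b \<omega>)))"
    proof (rule AE_I2)
      fix \<omega> assume "\<omega> \<in> space M"
      then have "\<bar>w \<omega>\<bar> * \<bar>F \<omega>\<bar> \<le> \<bar>w \<omega>\<bar> * (C * exp (R * b \<omega>))"
        using * by (intro mult_left_mono) auto
      then show "norm (w \<omega> * F \<omega>) \<le> norm (C * (w \<omega> * exp (R * b \<omega>)))"
        using * by (simp add: abs_mult mult_ac)
    qed
  qed measurable
qed

lemma exp_growth_const: "exp_growth (\<lambda>_. c)"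
  unfolding exp_growth_def by (intro conjI exI[of _ "\<bar>c\<bar>"] exI[of _ 0]) auto

lemma exp_growth_mult:
  assumes "exp_growth F" "exp_growth G"
  shows "exp_growth (\<lambda>\<omega>. F \<omega> * G \<omega>)"
proof -
  obtain C R C' R' where *: "F \<in> borel_measurable M" "G \<in> borel_measurable M"
    "C \<ge> 0" "R \<ge> 0" "C' \<ge> 0" "R' \<ge> 0"
    "\<forall>\<omega>\<in>space M. \<bar>F \<omega>\<bar> \<le> C * exp (R * b \<omega>)" "\<forall>\<omega>\<in>space M. \<bar>G \<omega>\<bar> \<le> C' * exp (R' * b \<omega>)"
    using assms unfolding exp_growth_def by blast
  have "\<bar>F \<omega> * G \<omega>\<bar> \<le> (C * C') * exp ((R + R') * b \<omega>)" if "\<omega> \<in> space M" for \<omega>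
  proof -
    have "\<bar>F \<omega>\<bar> * \<bar>G \<omega>\<bar> \<le> (C * exp (R * b \<omega>)) * (C' * exp (R' * b \<omega>))"
      using * that by (intro mult_mono) auto
    moreover have "exp ((R + R') * b \<omega>) = exp (R * b \<omega>) * exp (R' * b \<omega>)"
      by (simp add: distrib_right exp_add)
    ultimately show ?thesis by (simp add: abs_mult mult_ac)
  qed
  then show ?thesis
    unfolding exp_growth_def using *
    by (intro conjI borel_measurable_times exI[of _ "C * C'"] exI[of _ "R + R'"]) auto
qed

lemma exp_growth_lin_stat:
  assumes "lin_stat n l f \<in> borel_measurable M" "C \<ge> 0" "R \<ge> 0" "\<And>x. \<bar>f x\<bar> \<le> C * exp (R * \<bar>x\<bar>)"
  shows "exp_growth (lin_stat n l f)"
    and "\<omega> \<in> space M \<Longrightarrow> \<bar>lin_stat n l f \<omega>\<bar> \<le> real n * C * exp (R * b \<omega>)"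
proof -
  have *: "\<bar>lin_stat n l f \<omega>\<bar> \<le> real n * C * exp (R * b \<omega>)" if "\<omega> \<in> space M" for \<omega>
  proof -
    have "\<bar>lin_stat n l f \<omega>\<bar> \<le> (\<Sum>i<n. \<bar>f (l \<omega> i)\<bar>)" unfolding lin_stat_def by (rule sum_abs)
    also have "\<dots> \<le> (\<Sum>i<n. C * exp (R * b \<omega>))"
    proof (rule sum_mono)
      fix i assume "i \<in> {..<n}"
      then have "C * exp (R * \<bar>l \<omega> i\<bar>) \<le> C * exp (R * b \<omega>)"
        using assms l_bound[OF that] by (intro mult_left_mono) (auto intro: mult_left_mono)
      then show "\<bar>f (l \<omega> i)\<bar> \<le> C * exp (R * b \<omega>)" using assms(4)[of "l \<omega> i"] by linarith
    qed
    finally show ?thesis by (simp add: mult.assoc)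
  qed
  then show "exp_growth (lin_stat n l f)"
    unfolding exp_growth_def using assms by (intro conjI exI[of _ "real n * C"] exI[of _ R]) auto
  show "\<omega> \<in> space M \<Longrightarrow> \<bar>lin_stat n l f \<omega>\<bar> \<le> real n * C * exp (R * b \<omega>)" using * .
qed

lemma exp_growth_power: "exp_growth F \<Longrightarrow> exp_growth (\<lambda>\<omega>. F \<omega> ^ m)"
  by (induction m) (auto intro: exp_growth_mult exp_growth_const)

lemma exp_growth_prod_list:
  "(\<And>k. k \<in> set ks \<Longrightarrow> exp_growth (F k)) \<Longrightarrow> exp_growth (\<lambda>\<omega>. \<Prod>k\<leftarrow>ks. F k \<omega>)"
  by (induction ks) (auto intro: exp_growth_mult exp_growth_const)

lemma exp_growth_power_sum: "exp_growth (lin_stat n l (\<lambda>x. x ^ k))"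
proof (rule exp_growth_lin_stat(1)[OF power_sum_measurable, of 1 "real k"])
  fix x :: real
  have "\<bar>x\<bar> \<le> exp \<bar>x\<bar>" using exp_ge_add_one_self[of "\<bar>x\<bar>"] by linarith
  then have "\<bar>x\<bar> ^ k \<le> exp \<bar>x\<bar> ^ k" by (intro power_mono) auto
  then show "\<bar>x ^ k\<bar> \<le> 1 * exp (real k * \<bar>x\<bar>)" by (simp add: power_abs exp_of_nat_mult)
qed auto

text \<open>Dominated convergence: the common bound on the test functions bounds every statistic by
  \<open>n * C * exp (R * b)\<close>, whose powers are integrable against \<open>w\<close>.
  Measurability of the limit statistic comes from pointwise convergence, not from the
  points.\<close>

lemma lin_stat_limit:
  assumes "\<And>r. lin_stat n l (f r) \<in> borel_measurable M" "C \<ge> 0" "R \<ge> 0"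
    and bound: "\<And>r x. \<bar>f r x\<bar> \<le> C * exp (R * \<bar>x\<bar>)" and lim: "\<And>x. (\<lambda>r. f r x) \<longlonglongrightarrow> g x"
  shows "lin_stat n l g \<in> borel_measurable M"
    and "(\<lambda>r. moment (f r) m) \<longlonglongrightarrow> moment g m"
proof -
  have c: "(\<lambda>r. lin_stat n l (f r) \<omega>) \<longlonglongrightarrow> lin_stat n l g \<omega>" for \<omega>
    unfolding lin_stat_def by (intro tendsto_sum lim)
  show g: "lin_stat n l g \<in> borel_measurable M"
    by (rule borel_measurable_LIMSEQ_real[OF c assms(1)])
  have "exp_growth (\<lambda>\<omega>. (real n * C * exp (R * b \<omega>)) ^ m)"
    unfolding exp_growth_def[of "\<lambda>\<omega>. exp (R * b \<omega>)"]
    by (intro exp_growth_power exp_growth_mult exp_growth_const)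
      (use assms in \<open>simp add: exp_growth_def, intro exI[of _ 1] exI[of _ R] conjI, auto\<close>)
  then have dom: "integrable M (\<lambda>\<omega>. norm (w \<omega> * (real n * C * exp (R * b \<omega>)) ^ m))"
    by (intro integrable_norm exp_growth_integrable)
  show "(\<lambda>r. moment (f r) m) \<longlonglongrightarrow> moment g m"
  proof (rule integral_dominated_convergence[OF _ _ dom])
    show "(\<lambda>\<omega>. w \<omega> * lin_stat n l g \<omega> ^ m) \<in> borel_measurable M"
      using g by measurable
    show "(\<lambda>\<omega>. w \<omega> * lin_stat n l (f r) \<omega> ^ m) \<in> borel_measurable M" for r
      using assms(1)[of r] by measurable
    show "AE \<omega> in M. (\<lambda>r. w \<omega> * lin_stat n l (f r) \<omega> ^ m) \<longlonglongrightarrow> w \<omega> * lin_stat n l g \<omega> ^ m"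
      by (intro AE_I2 tendsto_intros c)
    show "AE \<omega> in M. norm (w \<omega> * lin_stat n l (f r) \<omega> ^ m) \<le> norm (w \<omega> * (real n * C * exp (R * b \<omega>)) ^ m)" for r
    proof (rule AE_I2)
      fix \<omega> assume "\<omega> \<in> space M"
      then have "\<bar>lin_stat n l (f r) \<omega>\<bar> \<le> real n * C * exp (R * b \<omega>)"
        using exp_growth_lin_stat(2)[OF assms(1) assms(2,3) bound] by blast
      then have "\<bar>lin_stat n l (f r) \<omega>\<bar> ^ m \<le> \<bar>real n * C * exp (R * b \<omega>)\<bar> ^ m"
        by (intro power_mono) auto
      then show "norm (w \<omega> * lin_stat n l (f r) \<omega> ^ m) \<le> norm (w \<omega> * (real n * C * exp (R * b \<omega>)) ^ m)"
        by (simp add: abs_mult power_abs mult_left_mono del: power_mult_distrib)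
    qed
  qed
qed

end

text \<open>Joint moments of several power sums are assumed equal, because powers of the statistic
  of a polynomial expand into products of different power sums.\<close>

locale moment_matching =
  P: point_config M w n l b + Q: point_config M' w' n l' b'
  for M :: "'a measure" and w n l b and M' :: "'b measure" and w' l' b' +
  assumes moments: "\<And>ks. (LINT \<omega>|M. w \<omega> * (\<Prod>k\<leftarrow>ks. lin_stat n l (\<lambda>x. x ^ k) \<omega>))
    = (LINT \<omega>|M'. w' \<omega> * (\<Prod>k\<leftarrow>ks. lin_stat n l' (\<lambda>x. x ^ k) \<omega>))"
begin

text \<open>Equality of all moments of a single statistic. This is not visibly preserved by sums of
  test functions, which would involve mixed moments, so the class is enlarged by limits only:
  polynomials, polynomials of a sine, bounded continuous functions, indicators of intervals.\<close>

definition agree :: "(real \<Rightarrow> real) \<Rightarrow> bool" where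
  "agree f \<longleftrightarrow> lin_stat n l f \<in> borel_measurable M \<and> lin_stat n l' f \<in> borel_measurable M' \<and>
     (\<forall>m. P.moment f m = Q.moment f m)"

lemma agree_limit:
  assumes f: "\<And>r. agree (f r)" and C: "C \<ge> 0" and R: "R \<ge> 0"
    and bound: "\<And>r x. \<bar>f r x\<bar> \<le> C * exp (R * \<bar>x\<bar>)" and lim: "\<And>x. (\<lambda>r. f r x) \<longlonglongrightarrow> g x"
  shows "agree g"
proof -
  have m: "\<And>r. lin_stat n l (f r) \<in> borel_measurable M" "\<And>r. lin_stat n l' (f r) \<in> borel_measurable M'"
    using f unfolding agree_def by auto
  note P = P.lin_stat_limit[OF m(1) C R bound lim] and Q = Q.lin_stat_limit[OF m(2) C R bound lim]
  have "P.moment g m = Q.moment g m" for m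
  proof (rule LIMSEQ_unique[OF P(2)])
    have "P.moment (f r) m = Q.moment (f r) m" for r
      using f unfolding agree_def by blast
    then show "(\<lambda>r. P.moment (f r) m) \<longlonglongrightarrow> Q.moment g m"
      using Q(2) by simp
  qed
  then show ?thesis unfolding agree_def using P(1) Q(1) by blast
qed

lemma lin_stat_poly:
  "lin_stat n l'' (poly p) \<omega> = (\<Sum>j\<le>degree p. coeff p j * lin_stat n l'' (\<lambda>x. x ^ j) \<omega>)"
  unfolding lin_stat_def poly_altdef by (simp add: sum_distrib_left) (rule sum.swap)

text \<open>The \<open>m\<close>-th power is expanded one factor at a time. The induction on
  \<open>m\<close> carries a list \<open>ks\<close> of additional power sums, which collects the
  monomials already expanded.\<close>

lemma agree_poly: "agree (poly p)"
proof -
  have meas: "lin_stat n l (poly p) \<in> borel_measurable M" "lin_stat n l' (poly p) \<in> borel_measurable M'"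
    unfolding lin_stat_poly[abs_def] using P.power_sum_measurable Q.power_sum_measurable by measurable
  define A where "A m ks \<omega> = lin_stat n l (poly p) \<omega> ^ m * (\<Prod>k\<leftarrow>ks. lin_stat n l (\<lambda>x. x ^ k) \<omega>)" for m ks \<omega>
  define B where "B m ks \<omega> = lin_stat n l' (poly p) \<omega> ^ m * (\<Prod>k\<leftarrow>ks. lin_stat n l' (\<lambda>x. x ^ k) \<omega>)" for m ks \<omega>
  have recA: "A (Suc m) ks \<omega> = (\<Sum>j\<le>degree p. coeff p j * A m (j # ks) \<omega>)" for m ks \<omega>
    unfolding A_def by (simp add: lin_stat_poly[of l] sum_distrib_left sum_distrib_right mult_ac del: sum.atMost_Suc)
  have recB: "B (Suc m) ks \<omega> = (\<Sum>j\<le>degree p. coeff p j * B m (j # ks) \<omega>)" for m ks \<omega>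
    unfolding B_def by (simp add: lin_stat_poly[of l'] sum_distrib_left sum_distrib_right mult_ac del: sum.atMost_Suc)
  have poly_bound: "\<exists>C\<ge>0. \<exists>R\<ge>0. \<forall>x. \<bar>poly p x\<bar> \<le> C * exp (R * \<bar>x\<bar>)"
  proof (intro exI conjI allI)
    fix x :: real
    have "\<bar>x\<bar> \<le> exp \<bar>x\<bar>" using exp_ge_add_one_self[of "\<bar>x\<bar>"] by linarith
    from abs_poly_le[OF this, of p]
    show "\<bar>poly p x\<bar> \<le> (\<Sum>j\<le>degree p. \<bar>coeff p j\<bar>) * exp (real (degree p) * \<bar>x\<bar>)"
      by (simp add: exp_of_nat_mult)
  qed (auto intro: sum_nonneg)
  obtain C R where CR: "C \<ge> 0" "R \<ge> 0" "\<And>x. \<bar>poly p x\<bar> \<le> C * exp (R * \<bar>x\<bar>)"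
    using poly_bound by blast
  have gA: "P.exp_growth (A m ks)" for m ks
    unfolding A_def[abs_def]
    by (intro P.exp_growth_mult P.exp_growth_power P.exp_growth_lin_stat(1)[OF meas(1) CR] P.exp_growth_prod_list P.exp_growth_power_sum)
  have gB: "Q.exp_growth (B m ks)" for m ks
    unfolding B_def[abs_def]
    by (intro Q.exp_growth_mult Q.exp_growth_power Q.exp_growth_lin_stat(1)[OF meas(2) CR] Q.exp_growth_prod_list Q.exp_growth_power_sum)
  have eq: "(LINT \<omega>|M. w \<omega> * A m ks \<omega>) = (LINT \<omega>|M'. w' \<omega> * B m ks \<omega>)" for m ks
  proof (induction m arbitrary: ks)
    case 0
    then show ?case using moments[of ks] by (simp add: A_def B_def)
  next
    case (Suc m)
    have "(LINT \<omega>|M. w \<omega> * A (Suc m) ks \<omega>) = (LINT \<omega>|M. (\<Sum>j\<le>degree p. coeff p j * (w \<omega> * A m (j # ks) \<omega>)))"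
      unfolding recA by (simp add: sum_distrib_left mult.left_commute)
    also have "\<dots> = (\<Sum>j\<le>degree p. coeff p j * (LINT \<omega>|M. w \<omega> * A m (j # ks) \<omega>))"
      using P.exp_growth_integrable[OF gA] by (subst Bochner_Integration.integral_sum) auto
    also have "\<dots> = (\<Sum>j\<le>degree p. coeff p j * (LINT \<omega>|M'. w' \<omega> * B m (j # ks) \<omega>))"
      unfolding Suc ..
    also have "\<dots> = (LINT \<omega>|M'. (\<Sum>j\<le>degree p. coeff p j * (w' \<omega> * B m (j # ks) \<omega>)))"
      using Q.exp_growth_integrable[OF gB] by (subst Bochner_Integration.integral_sum) auto
    also have "\<dots> = (LINT \<omega>|M'. w' \<omega> * B (Suc m) ks \<omega>)"
      unfolding recB by (simp add: sum_distrib_left mult.left_commute)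
    finally show ?case .
  qed
  from eq[of _ "[]"] show ?thesis
    unfolding agree_def using meas by (simp add: A_def B_def)
qed

text \<open>Composing with a sine keeps polynomials bounded on the whole line, while the Taylor
  polynomials of the composition have a common exponential bound.\<close>

lemma agree_poly_sin: 
  assumes "L > 0"
  shows "agree (\<lambda>x. poly p (sin (x / L)))"
proof -
  \<comment> \<open>The Taylor partial sums of \<open>sin (x / L)\<close>, as polynomials in
    \<open>x\<close>.\<close>
  define T where "T K = (\<Sum>k<K. monom (sin_coeff k / L ^ k) k)" for K
  have T: "poly (T K) x = (\<Sum>k<K. sin_coeff k * (x / L) ^ k)" for K x
    unfolding T_def by (simp add: poly_sum poly_monom power_divide)
  have T_bound: "\<bar>poly (T K) x\<bar> \<le> exp (\<bar>x\<bar> / L)" for K x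
  proof -
    have sc: "\<bar>sin_coeff k\<bar> \<le> inverse (fact k)" for k
      unfolding sin_coeff_def by (auto simp: abs_mult power_abs divide_inverse)
    have "\<bar>poly (T K) x\<bar> \<le> (\<Sum>k<K. \<bar>sin_coeff k * (x / L) ^ k\<bar>)" unfolding T by (rule sum_abs)
    also have "\<dots> \<le> (\<Sum>k<K. inverse (fact k) * (\<bar>x\<bar> / L) ^ k)"
      using assms sc by (intro sum_mono) (auto simp: abs_mult power_abs abs_divide intro!: mult_right_mono)
    also have "\<dots> \<le> (\<Sum>k. inverse (fact k) * (\<bar>x\<bar> / L) ^ k)"
      using assms by (intro sum_le_suminf summable_exp) auto
    finally show ?thesis by (simp add: exp_def)
  qed
  let ?C = "\<Sum>j\<le>degree p. \<bar>coeff p j\<bar>"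
  show ?thesis
  proof (rule agree_limit[where f = "\<lambda>K. poly (pcompose p (T K))" and C = ?C and R = "real (degree p) / L"])
    show "agree (poly (p \<circ>\<^sub>p T K))" for K by (rule agree_poly)
    \<comment> \<open>The partial sums are dominated by the exponential series of
      \<open>\<bar>x\<bar> / L\<close>, uniformly in \<open>K\<close>; composing with
      \<open>p\<close> multiplies the rate by at most its degree.\<close>
    show "\<bar>poly (p \<circ>\<^sub>p T K) x\<bar> \<le> ?C * exp (real (degree p) / L * \<bar>x\<bar>)" for K x
    proof -
      have "1 \<le> exp (\<bar>x\<bar> / L)" using assms by simp
      from abs_poly_le[OF T_bound this, of p] show ?thesis
        by (simp add: poly_pcompose exp_of_nat_mult [symmetric])
    qed
    show "(\<lambda>K. poly (p \<circ>\<^sub>p T K) x) \<longlonglongrightarrow> poly p (sin (x / L))" for x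
    proof -
      have "(\<lambda>K. poly (T K) x) \<longlonglongrightarrow> sin (x / L)"
        using sin_converges[of "x / L"] unfolding T sums_def by simp
      then show ?thesis unfolding poly_pcompose by (intro tendsto_intros)
    qed
  qed (use assms in \<open>auto intro: sum_nonneg\<close>)
qed

text \<open>With \<open>u = sin (x / L)\<close> and \<open>L = Suc r\<close>, the Weierstrass
  theorem on [-1, 1] approximates \<open>f (L * arcsin u)\<close> by a polynomial in
  \<open>u\<close>. The resulting function of \<open>x\<close> stays within \<open>K + 1\<close> on
  the whole line, and it is close to \<open>f x\<close> on a range of \<open>x\<close> growing with
  \<open>r\<close>.\<close>

lemma agree_continuous:
  assumes cont: "continuous_on UNIV f" and bounded: "\<And>x. \<bar>f x\<bar> \<le> K"
  shows "agree f"
proof -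
  have "\<exists>p. \<forall>u\<in>{-1..1}. \<bar>f (real (Suc r) * arcsin u) - poly p u\<bar> < 1 / real (Suc r)" for r
  proof -
    have "continuous_on {-1..1} (\<lambda>u. f (real (Suc r) * arcsin u))"
      by (intro continuous_on_compose2[OF cont] continuous_intros continuous_on_arcsin') auto
    from Stone_Weierstrass_real_polynomial_function[OF compact_Icc this, of "1 / real (Suc r)"]
    obtain g where g: "real_polynomial_function g"
      "\<And>u. u \<in> {-1..1} \<Longrightarrow> \<bar>f (real (Suc r) * arcsin u) - g u\<bar> < 1 / real (Suc r)" by auto
    obtain a N where "g = (\<lambda>x. \<Sum>i\<le>N. a i * x ^ i)"
      using real_polynomial_function_imp_sum[OF g(1)] by blast
    then have "g u = poly (\<Sum>i\<le>N. monom (a i) i) u" for u by (simp add: poly_sum poly_monom)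
    then show ?thesis using g(2) by metis
  qed
  then obtain p where p: "\<And>r u. u \<in> {-1..1} \<Longrightarrow> \<bar>f (real (Suc r) * arcsin u) - poly (p r) u\<bar> < 1 / real (Suc r)"
    by metis
  show ?thesis
  proof (rule agree_limit[where f = "\<lambda>r x. poly (p r) (sin (x / real (Suc r)))" and C = "K + 1" and R = 0])
    show "agree (\<lambda>x. poly (p r) (sin (x / real (Suc r))))" for r by (rule agree_poly_sin) simp
    show "\<bar>poly (p r) (sin (x / real (Suc r)))\<bar> \<le> (K + 1) * exp (0 * \<bar>x\<bar>)" for r x
    proof -
      have "1 / real (Suc r) \<le> 1" by simp
      moreover have "\<bar>f (real (Suc r) * arcsin (sin (x / real (Suc r)))) - poly (p r) (sin (x / real (Suc r)))\<bar> < 1 / real (Suc r)"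
        by (rule p) simp
      ultimately show ?thesis
        unfolding mult_zero_left exp_zero mult_1_right
        using bounded[of "real (Suc r) * arcsin (sin (x / real (Suc r)))"] by linarith
    qed
    show "(\<lambda>r. poly (p r) (sin (x / real (Suc r)))) \<longlonglongrightarrow> f x" for x
    proof (rule LIM_zero_cancel, rule Lim_null_comparison)
      have "\<forall>\<^sub>F r in sequentially. real (Suc r) \<ge> \<bar>x\<bar>" 
        by (rule eventually_sequentiallyI[of "nat \<lceil>\<bar>x\<bar>\<rceil>"]) linarith
      then show "\<forall>\<^sub>F r in sequentially. norm (poly (p r) (sin (x / real (Suc r))) - f x) \<le> 1 / real (Suc r)"
      proof eventually_elim
        case (elim r)
        \<comment> \<open>On this range the argument lies in [-1, 1], inside [-pi/2, pi/2], where
          \<open>arcsin\<close> inverts \<open>sin\<close>.\<close>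
        have "\<bar>x / real (Suc r)\<bar> \<le> 1" using elim by (simp add: abs_divide)
        moreover have "1 \<le> pi / 2" using pi_ge_two by simp
        ultimately have "arcsin (sin (x / real (Suc r))) = x / real (Suc r)"
          by (intro arcsin_sin) linarith+
        then show ?case using p[of "sin (x / real (Suc r))" r] by (simp add: abs_minus_commute)
      qed
      show "(\<lambda>r. 1 / real (Suc r)) \<longlonglongrightarrow> 0" using LIMSEQ_inverse_real_of_nat by (simp add: inverse_eq_divide)
    qed
  qed (use bounded[of 0] in auto)
qed

text \<open>Trapezoidal functions of slope \<open>r\<close>: the inner maximum is the distance to
  the interval if \<open>c \<le> d\<close>. If \<open>c > d\<close> it is still positive everywhere,
  so the argument also covers the empty set.\<close>

lemma agree_indicator_Icc: "agree (indicat_real {c..d})"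
proof (rule agree_limit[where f = "\<lambda>r x. max 0 (1 - real r * max 0 (max (c - x) (x - d)))" and C = 1 and R = 0])
  show "agree (\<lambda>x. max 0 (1 - real r * max 0 (max (c - x) (x - d))))" for r
    by (rule agree_continuous[where K = 1]) (auto intro!: continuous_intros simp: mult_nonneg_nonneg)
  show "\<bar>max 0 (1 - real r * max 0 (max (c - x) (x - d)))\<bar> \<le> 1 * exp (0 * \<bar>x\<bar>)" for r x
    by (auto simp: mult_nonneg_nonneg)
  show "(\<lambda>r. max 0 (1 - real r * max 0 (max (c - x) (x - d)))) \<longlonglongrightarrow> indicat_real {c..d} x" for x
  proof (cases "x \<in> {c..d}")
    case True
    then show ?thesis by simp
  next
    case False
    let ?d = "max 0 (max (c - x) (x - d))"
    have "?d > 0" using False by auto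
    have "\<forall>\<^sub>F r in sequentially. real r \<ge> e" for e
      by (rule eventually_sequentiallyI[of "nat \<lceil>e\<rceil>"]) linarith
    from this[of "1 / ?d"]
    have "\<forall>\<^sub>F r in sequentially. max 0 (1 - real r * ?d) = indicat_real {c..d} x"
    proof eventually_elim
      case (elim r)
      then have "1 \<le> real r * ?d" using \<open>?d > 0\<close> by (simp add: divide_le_eq)
      then show ?case using False by simp
    qed
    then show ?thesis by (rule tendsto_eventually)
  qed
qed auto

lemma agree_indicator_limit:
  assumes "\<And>x. \<forall>\<^sub>F r in sequentially. x \<in> {c r..d r} \<longleftrightarrow> x \<in> J"
  shows "agree (indicat_real J)"
proof (rule agree_limit[where f = "\<lambda>r. indicat_real {c r..d r}" and C = 1 and R = 0])
  show "(\<lambda>r. indicat_real {c r..d r} x) \<longlonglongrightarrow> indicat_real J x" for x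
    by (rule tendsto_eventually, use assms[of x] in eventually_elim) (simp add: indicator_def)
qed (auto intro: agree_indicator_Icc simp: indicator_def)

text \<open>Every interval is a pointwise eventual limit of closed bounded ones. The two ends are
  treated separately by \<open>low\<close> and \<open>upp\<close>: endpoints going to infinity for
  an unbounded end, constant ones for a closed end, and a shift inwards by \<open>1 / Suc r\<close>
  for an open end.\<close>

lemma agree_indicator_interval:
  assumes "is_interval J"
  shows "agree (indicat_real J)"
proof -
  define low where "low c P \<longleftrightarrow> (\<forall>x. \<forall>\<^sub>F r in sequentially. (c r \<le> x) = P x)"
    for c :: "nat \<Rightarrow> real" and P
  define upp where "upp d P \<longleftrightarrow> (\<forall>x. \<forall>\<^sub>F r in sequentially. (x \<le> d r) = P x)"
    for d :: "nat \<Rightarrow> real" and P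
  have ag: "agree (indicat_real {x. P x \<and> Q x})" if "low c P" "upp d Q" for c d P Q
  proof (rule agree_indicator_limit[where c = c and d = d])
    fix x
    show "\<forall>\<^sub>F r in sequentially. x \<in> {c r..d r} \<longleftrightarrow> x \<in> {x. P x \<and> Q x}"
      using that(1)[unfolded low_def, rule_format, of x] that(2)[unfolded upp_def, rule_format, of x]
      by eventually_elim simp
  qed
  have ev: "\<forall>\<^sub>F r in sequentially. 1 / real (Suc r) < e" if "e > 0" for e
    using LIMSEQ_inverse_real_of_nat[unfolded inverse_eq_divide] that by (rule order_tendstoD)
  have ev': "\<forall>\<^sub>F r in sequentially. e \<le> real r" for e
    by (rule eventually_sequentiallyI[of "nat \<lceil>e\<rceil>"]) linarith
  have low: "low (\<lambda>r. - real r) (\<lambda>_. True)" "\<And>c. low (\<lambda>_. c) (\<lambda>x. c \<le> x)" "\<And>c. low (\<lambda>r. c + 1 / real (Suc r)) (\<lambda>x. c < x)"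
  proof -
    show "low (\<lambda>r. - real r) (\<lambda>_. True)" unfolding low_def
    proof
      fix x show "\<forall>\<^sub>F r in sequentially. (- real r \<le> x) = True"
        using ev'[of "-x"] by eventually_elim simp
    qed
    show "low (\<lambda>_. c) (\<lambda>x. c \<le> x)" for c unfolding low_def by simp
    show "low (\<lambda>r. c + 1 / real (Suc r)) (\<lambda>x. c < x)" for c unfolding low_def
    proof
      fix x show "\<forall>\<^sub>F r in sequentially. (c + 1 / real (Suc r) \<le> x) = (c < x)"
      proof (cases "c < x")
        case True
        then have "x - c > 0" by simp
        from ev[OF this] show ?thesis by eventually_elim (use True in simp)
      next
        case False
        then have "\<not> c + 1 / real (Suc r) \<le> x" for r
          using zero_less_divide_1_iff[of "real (Suc r)"] by linarith
        then show ?thesis using False by simp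
      qed
    qed
  qed
  have upp: "upp (\<lambda>r. real r) (\<lambda>_. True)" "\<And>c. upp (\<lambda>_. c) (\<lambda>x. x \<le> c)" "\<And>c. upp (\<lambda>r. c - 1 / real (Suc r)) (\<lambda>x. x < c)"
  proof -
    show "upp (\<lambda>r. real r) (\<lambda>_. True)" unfolding upp_def
    proof
      fix x show "\<forall>\<^sub>F r in sequentially. (x \<le> real r) = True"
        using ev'[of x] by eventually_elim simp
    qed
    show "upp (\<lambda>_. c) (\<lambda>x. x \<le> c)" for c unfolding upp_def by simp
    show "upp (\<lambda>r. c - 1 / real (Suc r)) (\<lambda>x. x < c)" for c unfolding upp_def
    proof
      fix x show "\<forall>\<^sub>F r in sequentially. (x \<le> c - 1 / real (Suc r)) = (x < c)"
      proof (cases "x < c")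
        case True
        then have "c - x > 0" by simp
        from ev[OF this] show ?thesis by eventually_elim (use True in simp)
      next
        case False
        then have "\<not> x \<le> c - 1 / real (Suc r)" for r
          using zero_less_divide_1_iff[of "real (Suc r)"] by linarith
        then show ?thesis using False by simp
      qed
    qed
  qed
  have empty: "agree (indicat_real {})" using agree_indicator_Icc[of 1 0] by simp
  obtain c d where "J = {} \<or> J = UNIV \<or> J = {..<d} \<or> J = {..d} \<or> J = {c<..} \<or> J = {c..} \<or> J = {c<..<d} \<or> J = {c<..d} \<or> J = {c..<d} \<or> J = {c..d}"
    using interval_cases[of J] assms[unfolded is_interval_1] by metis
  then show ?thesis
    using empty ag[OF low(1) upp(1)] ag[OF low(1) upp(3)[of d]] ag[OF low(1) upp(2)[of d]]
      ag[OF low(3)[of c] upp(1)] ag[OF low(2)[of c] upp(1)] ag[OF low(3)[of c] upp(3)[of d]]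
      ag[OF low(3)[of c] upp(2)[of d]] ag[OF low(2)[of c] upp(3)[of d]] ag[OF low(2)[of c] upp(2)[of d]]
    by (elim disjE)
       (simp_all add: greaterThanLessThan_def lessThan_def atMost_def greaterThan_def atLeast_def
          greaterThanAtMost_def atLeastLessThan_def atLeastAtMost_def Int_def)
qed

end

text \<open>Lagrange interpolation, used because a count takes its values in {0..n}: any function of
  it is a polynomial in it, so its moments determine its law.\<close>

lemma nat_interpolation:
  fixes h :: "nat \<Rightarrow> 'a::field_char_0"
  shows "\<exists>p. \<forall>k\<le>n. poly p (of_nat k) = h k"
proof (induction n)
  case 0
  show ?case by (rule exI[of _ "[:h 0:]"]) simp
next
  case (Suc n)
  then obtain p where p: "\<forall>k\<le>n. poly p (of_nat k) = h k" by blast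
  define q where "q = (\<Prod>k\<le>n. [:- of_nat k, 1 :: 'a:])"
  have q0: "poly q (of_nat k) = 0" if "k \<le> n" for k
    unfolding q_def poly_prod using that by (intro prod_zero) auto
  have q1: "poly q (of_nat (Suc n)) \<noteq> 0"
    unfolding q_def poly_prod prod_zero_iff[OF finite_atMost]
  proof
    assume "\<exists>k\<in>{..n}. poly [:- of_nat k, 1 :: 'a:] (of_nat (Suc n)) = 0"
    then obtain k where "k \<le> n" "of_nat (Suc n) = (of_nat k :: 'a)" by auto
    then show False unfolding of_nat_eq_iff by simp
  qed
  show ?case
  proof (intro exI allI impI)
    fix k assume "k \<le> Suc n"
    then show "poly (p + Polynomial.smult ((h (Suc n) - poly p (of_nat (Suc n))) / poly q (of_nat (Suc n))) q) (of_nat k) = h k"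
      using p q0 q1 by (cases "k = Suc n") (auto simp del: of_nat_Suc)
  qed
qed

text \<open>The count is the linear statistic of an indicator, and \<open>h\<close> of it is a
  polynomial in it, so the expectation is a combination of matched moments.\<close>

lemma (in moment_matching) count_distribution:
  assumes "is_interval J"
  shows "(LINT \<omega>|M. w \<omega> * h (card {i. i < n \<and> l \<omega> i \<in> J})) = (LINT \<omega>|M'. w' \<omega> * h (card {i. i < n \<and> l' \<omega> i \<in> J}))"
    and "(\<lambda>\<omega>. real (card {i. i < n \<and> l \<omega> i \<in> J})) \<in> borel_measurable M"
proof -
  have c: "real (card {i. i < n \<and> l'' \<omega> i \<in> J}) = lin_stat n l'' (indicat_real J) \<omega>" for l'' :: "'c \<Rightarrow> nat \<Rightarrow> real" and \<omega>
  proof -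
    have "{i. i < n \<and> l'' \<omega> i \<in> J} = {i \<in> {..<n}. l'' \<omega> i \<in> J}" by auto
    then show ?thesis unfolding lin_stat_def indicator_def
      by (simp add: sum.If_cases Int_def)
  qed
  have le: "card {i. i < n \<and> l'' i \<in> J} \<le> n" for l'' :: "nat \<Rightarrow> real"
    using card_mono[of "{..<n}" "{i. i < n \<and> l'' i \<in> J}"] by auto
  have ag: "agree (indicat_real J)" by (rule agree_indicator_interval[OF assms])
  then show "(\<lambda>\<omega>. real (card {i. i < n \<and> l \<omega> i \<in> J})) \<in> borel_measurable M"
    unfolding c agree_def by simp
  obtain p where "\<forall>k\<le>n. poly p (of_nat k) = h k" using nat_interpolation[of n h] by blast
  then have h: "h (card {i. i < n \<and> l'' i \<in> J}) = poly p (real (card {i. i < n \<and> l'' i \<in> J}))" for l'' :: "nat \<Rightarrow> real"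
    using le by metis
  have ind: "\<bar>indicat_real J x\<bar> \<le> 1 * exp (0 * \<bar>x\<bar>)" for x by (simp add: indicator_def)
  have gP: "P.exp_growth (\<lambda>\<omega>. lin_stat n l (indicat_real J) \<omega> ^ m)"
    and gQ: "Q.exp_growth (\<lambda>\<omega>. lin_stat n l' (indicat_real J) \<omega> ^ m)" for m
    using ag ind unfolding agree_def
    by (auto intro!: P.exp_growth_power Q.exp_growth_power P.exp_growth_lin_stat(1)[of _ 1 0] Q.exp_growth_lin_stat(1)[of _ 1 0])
  have "(LINT \<omega>|M. w \<omega> * h (card {i. i < n \<and> l \<omega> i \<in> J}))
    = (LINT \<omega>|M. (\<Sum>j\<le>degree p. coeff p j * (w \<omega> * lin_stat n l (indicat_real J) \<omega> ^ j)))"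
    unfolding h c poly_altdef by (simp add: sum_distrib_left mult.left_commute)
  also have "\<dots> = (\<Sum>j\<le>degree p. coeff p j * P.moment (indicat_real J) j)"
    using P.exp_growth_integrable[OF gP] by (subst Bochner_Integration.integral_sum) auto
  also have "\<dots> = (\<Sum>j\<le>degree p. coeff p j * Q.moment (indicat_real J) j)"
    using ag unfolding agree_def by simp
  also have "\<dots> = (LINT \<omega>|M'. (\<Sum>j\<le>degree p. coeff p j * (w' \<omega> * lin_stat n l' (indicat_real J) \<omega> ^ j)))"
    using Q.exp_growth_integrable[OF gQ] by (subst Bochner_Integration.integral_sum) auto
  also have "\<dots> = (LINT \<omega>|M'. w' \<omega> * h (card {i. i < n \<and> l' \<omega> i \<in> J}))"
    unfolding h c poly_altdef by (simp add: sum_distrib_left mult.left_commute)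
  finally show "(LINT \<omega>|M. w \<omega> * h (card {i. i < n \<and> l \<omega> i \<in> J})) = (LINT \<omega>|M'. w' \<omega> * h (card {i. i < n \<and> l' \<omega> i \<in> J}))" .
qed

subsection \<open>Cumulants of Bernoulli sums\<close>

text \<open>A Taylor expansion whose third derivative is
  \<open>\<theta> (1 - \<theta>) (1 - 2 \<theta>)\<close>. The point is a remainder proportional to
  \<open>p (1 - p)\<close> and not merely bounded: the variance of the tilted variable exceeds the
  original one by a factor of at most \<open>exp 1\<close> for tilts in [-1, 1].\<close>

lemma bernoulli_log_mgf:
  fixes p s :: real
  assumes p: "0 \<le> p" "p \<le> 1" and s: "\<bar>s\<bar> \<le> 1"
  shows "\<bar>ln (1 - p + p * exp s) - p * s - p * (1 - p) * s\<^sup>2 / 2\<bar> \<le> exp 1 * (p * (1 - p)) * \<bar>s\<bar> ^ 3"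
proof -
  define D where "D t = 1 - p + p * exp t" for t :: real
  \<comment> \<open>The success probability after tilting by \<open>t\<close>; it is also the first
    derivative of \<open>ln (D t)\<close>.\<close>
  define \<theta> where "\<theta> t = p * exp t / D t" for t
  have D: "D t > 0" for t
  proof (cases "p = 1")
    case False
    then have "1 - p > 0" "p * exp t \<ge> 0" using p by auto
    then show ?thesis unfolding D_def by linarith
  qed (simp add: D_def)
  have dD: "(D has_real_derivative p * exp t) (at t)" for t
    unfolding D_def by (auto intro!: derivative_eq_intros)
  have d\<theta>: "(\<theta> has_real_derivative \<theta> t * (1 - \<theta> t)) (at t)" for t
  proof -
    have "(\<theta> has_real_derivative (p * exp t * D t - p * exp t * (p * exp t)) / (D t * D t)) (at t)"
      unfolding \<theta>_def using D[of t] by (auto intro!: derivative_eq_intros dD)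
    moreover have "(p * exp t * D t - p * exp t * (p * exp t)) / (D t * D t) = \<theta> t * (1 - \<theta> t)"
      unfolding \<theta>_def using D[of t] by (simp add: field_simps)
    ultimately show ?thesis by simp
  qed
  define diff where "diff m t = (if m = 0 then ln (D t) else if m = 1 then \<theta> t else if m = 2 then \<theta> t * (1 - \<theta> t)
     else \<theta> t * (1 - \<theta> t) * (1 - 2 * \<theta> t))" for m :: nat and t
  have "\<exists>t. \<bar>t\<bar> \<le> \<bar>s\<bar> \<and> ln (D s) = (\<Sum>m<3. diff m 0 / fact m * s ^ m) + diff 3 t / fact 3 * s ^ 3"
  proof (rule Maclaurin_bi_le)
    show "diff 0 = (\<lambda>s. ln (D s))" by (auto simp: diff_def)
    show "\<forall>m t. m < 3 \<and> \<bar>t\<bar> \<le> \<bar>s\<bar> \<longrightarrow> DERIV (diff m) t :> diff (Suc m) t"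
    proof (intro allI impI)
      fix m :: nat and t :: real assume "m < 3 \<and> \<bar>t\<bar> \<le> \<bar>s\<bar>"
      then consider "m = 0" | "m = 1" | "m = 2" by linarith
      then show "DERIV (diff m) t :> diff (Suc m) t"
      proof cases
        case 1
        have "((\<lambda>t. ln (D t)) has_real_derivative p * exp t / D t) (at t)"
          using DERIV_ln_divide[OF D[of t]] dD[of t] by (auto intro!: derivative_eq_intros dD D)
        then show ?thesis using 1 by (simp add: diff_def[abs_def] \<theta>_def)
      next
        case 2
        then show ?thesis using d\<theta>[of t] by (simp add: diff_def[abs_def])
      next
        case 3
        have "((\<lambda>t. \<theta> t * (1 - \<theta> t)) has_real_derivative \<theta> t * (1 - \<theta> t) * (1 - 2 * \<theta> t)) (at t)"
          by (auto intro!: derivative_eq_intros d\<theta> simp: algebra_simps)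
        then show ?thesis using 3 by (simp add: diff_def[abs_def])
      qed
    qed
  qed
  then obtain t where t: "\<bar>t\<bar> \<le> \<bar>s\<bar>" and
    eq: "ln (D s) = (\<Sum>m<3. diff m 0 / fact m * s ^ m) + diff 3 t / fact 3 * s ^ 3" by blast
  have D0: "D 0 = 1" and \<theta>0: "\<theta> 0 = p" by (auto simp: D_def \<theta>_def)
  have err: "ln (D s) - p * s - p * (1 - p) * s\<^sup>2 / 2 = diff 3 t / 6 * s ^ 3"
    unfolding eq by (simp add: eval_nat_numeral diff_def D0 \<theta>0)
  have "\<bar>diff 3 t\<bar> \<le> exp 1 * (p * (1 - p))"
  proof -
    have \<theta>: "0 \<le> \<theta> t" "\<theta> t \<le> 1"
      using p D[of t] by (auto simp: \<theta>_def D_def divide_le_eq)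
    have "\<theta> t * (1 - \<theta> t) = p * (1 - p) * (exp t / (D t)\<^sup>2)"
      unfolding \<theta>_def using D[of t] by (simp add: field_simps power2_eq_square D_def)
    moreover have "exp t / (D t)\<^sup>2 \<le> exp 1"
    proof -
      have t1: "\<bar>t\<bar> \<le> 1" using t s by linarith
      \<comment> \<open>For nonnegative \<open>t\<close> the denominator is at least 1; for negative
        \<open>t\<close> it is at least \<open>exp t\<close>, and the quotient is at most
        \<open>exp (- t)\<close>.\<close>
      have "exp t \<le> exp 1 * (D t)\<^sup>2"
      proof (cases "t \<ge> 0")
        case True
        then have "D t \<ge> 1" using p mult_left_mono[of 1 "exp t" p] by (simp add: D_def)
        then have "(D t)\<^sup>2 \<ge> 1" by (simp add: one_le_power)
        then have "exp 1 * 1 \<le> exp 1 * (D t)\<^sup>2" by (intro mult_left_mono) auto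
        moreover have "exp t \<le> exp 1 * 1" using t1 by simp
        ultimately show ?thesis by (rule order_trans[rotated])
      next
        case False
        have "(1 - p) * exp t \<le> (1 - p) * 1" using False p by (intro mult_left_mono) auto
        then have "D t \<ge> exp t" by (simp add: D_def algebra_simps)
        then have "(D t)\<^sup>2 \<ge> (exp t)\<^sup>2" by (intro power_mono) auto
        then have "exp 1 * (D t)\<^sup>2 \<ge> exp 1 * (exp t * exp t)" by (simp add: power2_eq_square)
        moreover have "exp 1 * (exp t * exp t) = exp (1 + t) * exp t" by (simp add: exp_add)
        moreover have "exp (1 + t) * exp t \<ge> 1 * exp t" using t1 by (intro mult_right_mono) auto
        ultimately show ?thesis by linarith
      qed
      then show ?thesis using D[of t] by (simp add: divide_le_eq)
    qed
    moreover have "p * (1 - p) \<ge> 0" using p by simp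
    ultimately have le: "\<theta> t * (1 - \<theta> t) \<le> exp 1 * (p * (1 - p))"
      using mult_left_mono[of "exp t / (D t)\<^sup>2" "exp 1" "p * (1 - p)"] by (simp add: mult.commute)
    have "\<bar>diff 3 t\<bar> = \<theta> t * (1 - \<theta> t) * \<bar>1 - 2 * \<theta> t\<bar>"
      using \<theta> by (simp add: diff_def abs_mult)
    also have "\<dots> \<le> \<theta> t * (1 - \<theta> t) * 1"
      using \<theta> by (intro mult_left_mono) auto
    finally show ?thesis using le by simp
  qed
  have "\<bar>ln (D s) - p * s - p * (1 - p) * s\<^sup>2 / 2\<bar> = \<bar>diff 3 t\<bar> / 6 * \<bar>s\<bar> ^ 3"
    unfolding err by (simp add: abs_mult power_abs)
  also have "\<dots> \<le> exp 1 * (p * (1 - p)) * \<bar>s\<bar> ^ 3"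
    using \<open>\<bar>diff 3 t\<bar> \<le> exp 1 * (p * (1 - p))\<close> abs_ge_zero[of "diff 3 t"]
    by (intro mult_right_mono) auto
  finally show ?thesis unfolding D_def .
qed

text \<open>Derivatives of a generating function at 1 are factorial moments, so these are the total
  mass, the mean and \<open>E[K (K - 1)]\<close>.\<close>

lemma bernoulli_pgf_derivs:
  fixes p :: "nat \<Rightarrow> real"
  defines "q \<equiv> \<lambda>n. \<Prod>i<n. [:1 - p i, p i:]"
  shows "poly (q n) 1 = 1" "poly (pderiv (q n)) 1 = (\<Sum>i<n. p i)"
    "poly (pderiv (pderiv (q n))) 1 = (\<Sum>i<n. p i)\<^sup>2 - (\<Sum>i<n. (p i)\<^sup>2)"
proof -
  have Suc: "q (Suc n) = q n * [:1 - p n, p n:]" for n unfolding q_def by simp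
  have "poly (q n) 1 = 1 \<and> poly (pderiv (q n)) 1 = (\<Sum>i<n. p i) \<and>
    poly (pderiv (pderiv (q n))) 1 = (\<Sum>i<n. p i)\<^sup>2 - (\<Sum>i<n. (p i)\<^sup>2)"
  proof (induction n)
    case 0
    then show ?case by (simp add: q_def)
  next
    case (Suc n)
    then show ?case
      unfolding \<open>q (Suc n) = _\<close>
      by (simp add: pderiv_mult pderiv_add pderiv_pCons pderiv_smult power2_eq_square algebra_simps)
  qed
  then show "poly (q n) 1 = 1" "poly (pderiv (q n)) 1 = (\<Sum>i<n. p i)"
    "poly (pderiv (pderiv (q n))) 1 = (\<Sum>i<n. p i)\<^sup>2 - (\<Sum>i<n. (p i)\<^sup>2)" by auto
qed

text \<open>Independent Bernoulli variables are never constructed: the factorised generating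
  function determines the mean, the variance and the Laplace transform, and the single-variable
  bounds add up to a multiple of the sum of the \<open>p i * (1 - p i)\<close>, which is the
  variance.\<close>

lemma (in prob_space) bernoulli_sum_cumulants:
  fixes k :: "'a \<Rightarrow> nat" and p :: "nat \<Rightarrow> real"
  assumes meas: "(\<lambda>\<omega>. real (k \<omega>)) \<in> borel_measurable M" and le: "\<And>\<omega>. \<omega> \<in> space M \<Longrightarrow> k \<omega> \<le> n"
    and p: "\<And>i. i < d \<Longrightarrow> 0 \<le> p i \<and> p i \<le> 1"
    and pgf: "\<And>z :: real. expectation (\<lambda>\<omega>. z ^ k \<omega>) = (\<Prod>i<d. 1 - p i + p i * z)"
    and s: "\<bar>s\<bar> \<le> 1"
  shows "\<bar>ln (expectation (\<lambda>\<omega>. exp (s * (real (k \<omega>) - expectation (\<lambda>\<omega>. real (k \<omega>))))))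
      - s\<^sup>2 / 2 * variance (\<lambda>\<omega>. real (k \<omega>))\<bar> \<le> exp 1 * \<bar>s\<bar> ^ 3 * variance (\<lambda>\<omega>. real (k \<omega>))"
proof -
  have int: "integrable M (\<lambda>\<omega>. f (real (k \<omega>)))" if "f \<in> borel_measurable borel" for f :: "real \<Rightarrow> real"
  proof (rule integrable_const_bound[where B = "\<Sum>j\<le>n. \<bar>f (real j)\<bar>"])
    show "AE \<omega> in M. norm (f (real (k \<omega>))) \<le> (\<Sum>j\<le>n. \<bar>f (real j)\<bar>)"
      using le by (intro AE_I2) (auto intro!: member_le_sum[of _ "{..n}" "\<lambda>j. \<bar>f (real j)\<bar>"])
    show "(\<lambda>\<omega>. f (real (k \<omega>))) \<in> borel_measurable M"
      by (rule measurable_compose[OF meas that])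
  qed
  define a where "a j = prob {\<omega> \<in> space M. real (k \<omega>) = real j}" for j
  have ex: "expectation (\<lambda>\<omega>. f (real (k \<omega>))) = (\<Sum>j\<le>n. f (real j) * a j)" if "f \<in> borel_measurable borel" for f :: "real \<Rightarrow> real"
  proof -
    have S: "{\<omega> \<in> space M. real (k \<omega>) = real j} \<in> sets M" for j using meas by measurable
    have "expectation (\<lambda>\<omega>. f (real (k \<omega>)))
      = expectation (\<lambda>\<omega>. \<Sum>j\<le>n. f (real j) * indicat_real {\<omega> \<in> space M. real (k \<omega>) = real j} \<omega>)"
    proof (rule Bochner_Integration.integral_cong[OF refl])
      fix \<omega> assume \<omega>: "\<omega> \<in> space M"
      have "(\<Sum>j\<le>n. f (real j) * indicat_real {\<omega> \<in> space M. real (k \<omega>) = real j} \<omega>)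
        = (\<Sum>j\<le>n. if j = k \<omega> then f (real j) else 0)"
        using \<omega> by (intro sum.cong refl) (auto simp: indicator_def)
      then show "f (real (k \<omega>)) = (\<Sum>j\<le>n. f (real j) * indicat_real {\<omega> \<in> space M. real (k \<omega>) = real j} \<omega>)"
        using le[OF \<omega>] by simp
    qed
    also have "\<dots> = (\<Sum>j\<le>n. f (real j) * a j)"
    proof (subst Bochner_Integration.integral_sum)
      show "integrable M (\<lambda>\<omega>. f (real j) * indicat_real {\<omega> \<in> space M. real (k \<omega>) = real j} \<omega>)" for j
        by (intro integrable_mult_right integrable_real_indicator S) (simp add: emeasure_eq_measure)
    qed (use S in \<open>simp add: a_def\<close>)
    finally show ?thesis .
  qed
  define A where "A = (\<Sum>j\<le>n. monom (a j) j)"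
  define q where "q = (\<Prod>i<d. [:1 - p i, p i:])"
  have "poly A z = poly q z" for z
  proof -
    have "(\<Sum>j\<le>n. z ^ j * a j) = expectation (\<lambda>\<omega>. z ^ k \<omega>)"
    proof (cases "z = 0")
      case True
      have "expectation (\<lambda>\<omega>. if real (k \<omega>) = 0 then 1 else 0 :: real) = (\<Sum>j\<le>n. (if real j = 0 then 1 else 0) * a j)"
        by (rule ex) measurable
      moreover have "(if real m = 0 then 1 else 0 :: real) = z ^ m" for m
        using True by (cases m) auto
      ultimately show ?thesis by simp
    next
      case False
      define g where "g x = (\<Sum>j\<le>n. z ^ j * (if x = real j then 1 else 0))" for x
      have "expectation (\<lambda>\<omega>. g (real (k \<omega>))) = (\<Sum>j\<le>n. g (real j) * a j)"
        unfolding g_def by (rule ex) measurable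
      moreover have g: "g (real m) = z ^ m" if "m \<le> n" for m
      proof -
        have "g (real m) = (\<Sum>j\<le>n. if j = m then z ^ j else 0)"
          unfolding g_def by (intro sum.cong) auto
        then show ?thesis using that by simp
      qed
      moreover have "expectation (\<lambda>\<omega>. g (real (k \<omega>))) = expectation (\<lambda>\<omega>. z ^ k \<omega>)"
        using g le by (intro Bochner_Integration.integral_cong) auto
      ultimately show ?thesis by simp
    qed
    then show ?thesis using pgf[of z] unfolding A_def q_def
      by (simp add: poly_sum poly_monom poly_prod mult.commute)
  qed
  \<comment> \<open>Agreement at all real \<open>z\<close> identifies the polynomials themselves, so
    that derivatives at 1 may be compared.\<close>
  then have Aq: "A = q" by (simp add: poly_eq_poly_eq_iff[symmetric] fun_eq_iff)
  have pderiv_sum: "pderiv (\<Sum>j\<in>S. f j) = (\<Sum>j\<in>S. pderiv (f j))" for S :: "nat set" and f :: "nat \<Rightarrow> real poly"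
    by (induction S rule: infinite_finite_induct) (simp_all add: pderiv_add)
  have dA: "poly (pderiv A) 1 = (\<Sum>j\<le>n. real j * a j)"
    unfolding A_def pderiv_sum by (simp add: poly_sum pderiv_monom poly_monom)
  have ddA: "poly (pderiv (pderiv A)) 1 = (\<Sum>j\<le>n. (real j * (real j - 1)) * a j)"
  proof -
    have "poly (pderiv (pderiv (monom (a j) j))) 1 = real j * (real j - 1) * a j" for j
      by (cases j) (simp_all add: pderiv_monom poly_monom algebra_simps)
    then show ?thesis
      unfolding A_def pderiv_sum poly_sum by simp
  qed
  have E: "expectation (\<lambda>\<omega>. real (k \<omega>)) = (\<Sum>i<d. p i)"
    using ex[of "\<lambda>x. x"] dA bernoulli_pgf_derivs(2)[where p = p and n = d] unfolding Aq q_def by simp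
  \<comment> \<open>The square is split as \<open>K (K - 1) + K\<close> to use the factorial
    moments.\<close>
  have E2: "expectation (\<lambda>\<omega>. (real (k \<omega>))\<^sup>2) = (\<Sum>i<d. p i)\<^sup>2 - (\<Sum>i<d. (p i)\<^sup>2) + (\<Sum>i<d. p i)"
  proof -
    have "expectation (\<lambda>\<omega>. (real (k \<omega>))\<^sup>2) = (\<Sum>j\<le>n. (real j)\<^sup>2 * a j)" by (rule ex) measurable
    also have "\<dots> = (\<Sum>j\<le>n. (real j * (real j - 1)) * a j) + (\<Sum>j\<le>n. real j * a j)"
      unfolding sum.distrib [symmetric] by (intro sum.cong) (auto simp: power2_eq_square algebra_simps)
    finally show ?thesis
      using bernoulli_pgf_derivs(2,3)[where p = p and n = d] unfolding dA[symmetric] ddA[symmetric] Aq q_def by simp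
  qed
  have V: "variance (\<lambda>\<omega>. real (k \<omega>)) = (\<Sum>i<d. p i * (1 - p i))"
  proof -
    have "variance (\<lambda>\<omega>. real (k \<omega>)) = expectation (\<lambda>\<omega>. (real (k \<omega>))\<^sup>2) - (expectation (\<lambda>\<omega>. real (k \<omega>)))\<^sup>2"
      by (rule variance_eq) (use int[of "\<lambda>x. x"] int[of "\<lambda>x. x\<^sup>2"] in auto)
    then show ?thesis unfolding E E2 by (simp add: power2_eq_square right_diff_distrib sum_subtractf)
  qed
  have pos: "1 - p i + p i * exp s > 0" if "i < d" for i
  proof (cases "p i = 1")
    case False
    then have "1 - p i > 0" "p i * exp s \<ge> 0" using p[OF that] by auto
    then show ?thesis by linarith
  qed simp
  have "expectation (\<lambda>\<omega>. exp (s * (real (k \<omega>) - (\<Sum>i<d. p i)))) = expectation (\<lambda>\<omega>. exp (- s * (\<Sum>i<d. p i)) * exp s ^ k \<omega>)"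
    by (intro Bochner_Integration.integral_cong refl)
      (simp add: exp_of_nat_mult [symmetric] exp_add [symmetric] algebra_simps)
  also have "\<dots> = exp (- s * (\<Sum>i<d. p i)) * (\<Prod>i<d. 1 - p i + p i * exp s)"
    by (simp only: integral_mult_right_zero pgf)
  finally have mgf: "expectation (\<lambda>\<omega>. exp (s * (real (k \<omega>) - (\<Sum>i<d. p i)))) = exp (- s * (\<Sum>i<d. p i)) * (\<Prod>i<d. 1 - p i + p i * exp s)" .
  have pp: "(\<Prod>i<d. 1 - p i + p i * exp s) > 0" using pos by (intro prod_pos) auto
  have lm: "ln (expectation (\<lambda>\<omega>. exp (s * (real (k \<omega>) - (\<Sum>i<d. p i))))) = - s * (\<Sum>i<d. p i) + ln (\<Prod>i<d. 1 - p i + p i * exp s)"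
    unfolding mgf using pp by (simp add: ln_mult_pos)
  have lp: "ln (\<Prod>i<d. 1 - p i + p i * exp s) = (\<Sum>i<d. ln (1 - p i + p i * exp s))"
    by (rule ln_prod) (auto dest!: pos)
  have err: "ln (expectation (\<lambda>\<omega>. exp (s * (real (k \<omega>) - (\<Sum>i<d. p i))))) - s\<^sup>2 / 2 * (\<Sum>i<d. p i * (1 - p i))
    = (\<Sum>i<d. ln (1 - p i + p i * exp s) - p i * s - p i * (1 - p i) * s\<^sup>2 / 2)"
    unfolding lm lp by (simp add: sum_subtractf sum_distrib_left sum_negf mult_ac)
  have "\<bar>\<Sum>i<d. ln (1 - p i + p i * exp s) - p i * s - p i * (1 - p i) * s\<^sup>2 / 2\<bar> \<le> (\<Sum>i<d. exp 1 * (p i * (1 - p i)) * \<bar>s\<bar> ^ 3)"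
    by (rule order_trans[OF sum_abs]) (use p s in \<open>auto intro!: sum_mono bernoulli_log_mgf\<close>)
  also have "\<dots> = exp 1 * \<bar>s\<bar> ^ 3 * (\<Sum>i<d. p i * (1 - p i))"
    by (simp add: sum_distrib_left mult_ac)
  finally show ?thesis unfolding V unfolding E err .
qed

subsection \<open>The Gaertner-Ellis theorem with quadratic limit\<close>

lemma elog_le: "p \<le> exp c \<Longrightarrow> elog p \<le> ereal c"
  unfolding elog_def using ln_le_cancel_iff[of p "exp c"] by auto

lemma elog_ge: "exp c \<le> p \<Longrightarrow> ereal c \<le> elog p"
  unfolding elog_def using exp_gt_zero[of c] ln_ge_iff[of p c] by (auto simp del: exp_gt_zero)

text \<open>The bound \<open>B n\<close> may grow with \<open>n\<close>; it makes every exponential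
  moment finite and strictly positive, so that \<open>ln\<close> can be inverted. The rate of a set
  depends only on its points' distances to the origin, so two Chernoff bounds handle closed sets,
  while open sets are localised around one point.\<close>

lemma satisfies_MDP_quadratic:
  fixes M :: "nat \<Rightarrow> 'a measure" and Z :: "nat \<Rightarrow> 'a \<Rightarrow> real" and s B :: "nat \<Rightarrow> real"
  assumes prob: "\<And>n. prob_space (M n)" and meas: "\<And>n. Z n \<in> borel_measurable (M n)"
    and bounded: "\<And>n \<omega>. \<omega> \<in> space (M n) \<Longrightarrow> \<bar>Z n \<omega>\<bar> \<le> B n"
    and s: "filterlim s at_top sequentially"
    and mgf: "\<And>t. (\<lambda>n. ln (LINT \<omega>|M n. exp (t * s n * Z n \<omega>)) / s n) \<longlonglongrightarrow> t\<^sup>2 / 2"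
  shows "satisfies_MDP M Z s (\<lambda>x. x\<^sup>2 / 2)"
proof -
  let ?rate = "\<lambda>n S. ereal (1 / s n) * elog (measure (M n) {\<omega> \<in> space (M n). Z n \<omega> \<in> S})"
  define L where "L t n = ln (LINT \<omega>|M n. exp (t * s n * Z n \<omega>)) / s n" for t n
  have L: "(\<lambda>n. L t n) \<longlonglongrightarrow> t\<^sup>2 / 2" for t unfolding L_def by (rule mgf)
  have s_pos: "\<forall>\<^sub>F n in sequentially. s n > 0" using s by (simp add: filterlim_at_top_dense)
  have int: "integrable (M n) (\<lambda>\<omega>. exp (c * Z n \<omega>))" for n c
  proof -
    interpret prob_space "M n" by (rule prob)
    note [measurable] = meas[of n]
    show ?thesis
    proof (rule integrable_const_bound[where B = "exp (\<bar>c\<bar> * B n)"])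
      show "AE \<omega> in M n. norm (exp (c * Z n \<omega>)) \<le> exp (\<bar>c\<bar> * B n)"
      proof (rule AE_I2)
        fix \<omega> assume "\<omega> \<in> space (M n)"
        then have "\<bar>c\<bar> * \<bar>Z n \<omega>\<bar> \<le> \<bar>c\<bar> * B n" using bounded by (intro mult_left_mono) auto
        moreover have "c * Z n \<omega> \<le> \<bar>c\<bar> * \<bar>Z n \<omega>\<bar>" by (metis abs_ge_self abs_mult)
        ultimately show "norm (exp (c * Z n \<omega>)) \<le> exp (\<bar>c\<bar> * B n)" by simp
      qed
    qed measurable
  qed
  have expL: "(LINT \<omega>|M n. exp (t * s n * Z n \<omega>)) = exp (s n * L t n)" if "s n > 0" for n t
  proof -
    interpret prob_space "M n" by (rule prob)
    have "(LINT \<omega>|M n. exp (t * s n * Z n \<omega>)) > 0"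
    proof (rule less_le_trans)
      show "0 < exp (- (\<bar>t * s n\<bar> * B n))" by simp
      show "exp (- (\<bar>t * s n\<bar> * B n)) \<le> (LINT \<omega>|M n. exp (t * s n * Z n \<omega>))"
      proof (rule integral_ge_const[OF int], rule AE_I2)
        fix \<omega> assume "\<omega> \<in> space (M n)"
        then have "\<bar>t * s n\<bar> * \<bar>Z n \<omega>\<bar> \<le> \<bar>t * s n\<bar> * B n" using bounded by (intro mult_left_mono) auto
        moreover have "- (t * s n * Z n \<omega>) \<le> \<bar>t * s n\<bar> * \<bar>Z n \<omega>\<bar>" by (metis abs_ge_minus_self abs_mult)
        ultimately show "exp (- (\<bar>t * s n\<bar> * B n)) \<le> exp (t * s n * Z n \<omega>)" by simp
      qed
    qed
    then show ?thesis using that by (simp add: L_def)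
  qed
  \<comment> \<open>A closed set enters only through a lower bound \<open>r\<close> for the absolute
    values of its points. The tilts \<open>r\<close> and \<open>- r\<close> cover both half-lines;
    adding the two exponentials costs \<open>ln 2 / s n\<close>, which vanishes.\<close>
  have upper: "limsup (\<lambda>n. ?rate n F) \<le> ereal (- (r\<^sup>2 / 2))"
    if F: "\<And>x. x \<in> F \<Longrightarrow> \<bar>x\<bar> \<ge> r" and r: "r \<ge> 0" and closed: "closed F" for F r
  proof -
    let ?c = "\<lambda>n. ln 2 / s n + max (L r n) (L (- r) n) - r\<^sup>2"
    have "\<forall>\<^sub>F n in sequentially. ?rate n F \<le> ereal (?c n)"
      using s_pos
    proof eventually_elim
      case (elim n)
      interpret prob_space "M n" by (rule prob)
      note [measurable] = meas[of n]
      let ?A = "{\<omega> \<in> space (M n). Z n \<omega> \<in> F}"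
      have A: "?A \<in> sets (M n)" using measurable_sets[OF meas[of n], of F] closed
        by (auto simp: vimage_def Int_def conj_commute)
      have "prob ?A = expectation (indicat_real ?A)" using A by simp
      also have "\<dots> \<le> expectation (\<lambda>\<omega>. exp (- s n * r\<^sup>2) * (exp (r * s n * Z n \<omega>) + exp (- r * s n * Z n \<omega>)))"
      proof (rule integral_mono)
        fix \<omega> assume "\<omega> \<in> space (M n)"
        show "indicat_real ?A \<omega> \<le> exp (- s n * r\<^sup>2) * (exp (r * s n * Z n \<omega>) + exp (- r * s n * Z n \<omega>))"
        proof (cases "\<omega> \<in> ?A")
          case True
          then have "\<bar>Z n \<omega>\<bar> \<ge> r" using F by blast
          then have "r * \<bar>Z n \<omega>\<bar> \<ge> r * r" using r by (intro mult_left_mono) auto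
          then have "s n * (r * r) \<le> s n * (r * \<bar>Z n \<omega>\<bar>)"
            by (rule mult_left_mono) (use elim in simp)
          moreover have "- s n * r\<^sup>2 + r * s n * \<bar>Z n \<omega>\<bar> = s n * (r * \<bar>Z n \<omega>\<bar>) - s n * (r * r)"
            by (simp add: power2_eq_square algebra_simps)
          ultimately have "1 \<le> exp (- s n * r\<^sup>2) * exp (r * s n * \<bar>Z n \<omega>\<bar>)"
            unfolding exp_add [symmetric] one_le_exp_iff by linarith
          also have "exp (r * s n * \<bar>Z n \<omega>\<bar>) \<le> exp (r * s n * Z n \<omega>) + exp (- r * s n * Z n \<omega>)"
            by (cases "Z n \<omega> \<ge> 0") (auto simp: less_imp_le)
          finally show ?thesis using True by simp
        qed (simp add: add_nonneg_nonneg)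
      qed (intro integrable_mult_right Bochner_Integration.integrable_add int integrable_real_indicator A;
          simp add: emeasure_eq_measure)+
      also have "\<dots> = exp (- s n * r\<^sup>2) * (exp (s n * L r n) + exp (s n * L (- r) n))"
        unfolding integral_mult_right_zero
          Bochner_Integration.integral_add[OF int[of n "r * s n"] int[of n "- r * s n"]] expL[OF elim] ..
      also have "\<dots> \<le> exp (- s n * r\<^sup>2) * (2 * exp (s n * max (L r n) (L (- r) n)))"
        using elim by (intro mult_left_mono) (auto simp: max_def)
      also have "\<dots> = exp (s n * ?c n)"
      proof -
        have "s n * ?c n = - s n * r\<^sup>2 + (ln 2 + s n * max (L r n) (L (- r) n))"
          using elim by (simp add: field_simps)
        then show ?thesis by (simp only: exp_add) simp
      qed
      finally have "elog (prob ?A) \<le> ereal (s n * ?c n)" by (rule elog_le)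
      then have "ereal (1 / s n) * elog (prob ?A) \<le> ereal (1 / s n) * ereal (s n * ?c n)"
        using elim by (intro ereal_mult_left_mono) auto
      then show ?case using elim by simp
    qed
    then have "limsup (\<lambda>n. ?rate n F) \<le> limsup (\<lambda>n. ereal (?c n))"
      by (rule Limsup_mono)
    also have "limsup (\<lambda>n. ereal (?c n)) = ereal (- (r\<^sup>2 / 2))"
    proof (rule lim_imp_Limsup)
      have "?c \<longlonglongrightarrow> 0 + max (r\<^sup>2 / 2) ((- r)\<^sup>2 / 2) - r\<^sup>2"
        by (intro tendsto_intros L real_tendsto_divide_at_top[OF tendsto_const s])
      then show "(\<lambda>n. ereal (?c n)) \<longlonglongrightarrow> ereal (- (r\<^sup>2 / 2))" by simp
    qed simp
    finally show ?thesis .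
  qed
  \<comment> \<open>The mass \<open>exp (s n * L x n)\<close> tilted towards \<open>x\<close> is
    split into a part near \<open>x\<close> and two parts at distance at least
    \<open>\<delta>\<close>. An additional tilt by \<open>\<delta>\<close> outwards shows that the
    latter are negligible, so the former forces a lower bound on the probability.\<close>
  have lower: "ereal (- (x\<^sup>2 / 2)) \<le> liminf (\<lambda>n. ?rate n U)"
    if "open U" "x \<in> U" for U x
  proof (rule ereal_le_epsilon2)
    fix \<epsilon> :: real assume \<epsilon>: "0 < \<epsilon>"
    obtain \<delta>0 where \<delta>0: "\<delta>0 > 0" "ball x \<delta>0 \<subseteq> U" using \<open>open U\<close> \<open>x \<in> U\<close> openE by blast
    \<comment> \<open>Small enough for \<open>\<bar>x\<bar> * \<delta> \<le> \<epsilon>\<close>; the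
      added 1 covers \<open>x = 0\<close>.\<close>
    define \<delta> where "\<delta> = min \<delta>0 (\<epsilon> / (\<bar>x\<bar> + 1))"
    have \<delta>: "\<delta> > 0" "\<delta> \<le> \<delta>0" unfolding \<delta>_def using \<delta>0 \<epsilon> by auto
    have "\<bar>x\<bar> * \<delta> \<le> (\<bar>x\<bar> + 1) * (\<epsilon> / (\<bar>x\<bar> + 1))"
      unfolding \<delta>_def using \<epsilon> \<delta>0(1) by (intro mult_mono) auto
    also have "\<dots> = \<epsilon>" using abs_ge_zero[of x] by simp
    finally have x\<delta>: "\<bar>x\<bar> * \<delta> \<le> \<epsilon>" .
    \<comment> \<open>Near \<open>x\<close> the tilting factor is at most
      \<open>exp (s n * (x^2 + \<bar>x\<bar> * \<delta>))\<close>, and half of the tilted mass lies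
      there. In the limit \<open>L x n - x^2\<close> becomes \<open>- (x^2 / 2)\<close>.\<close>
    let ?c = "\<lambda>n. L x n - x\<^sup>2 - \<bar>x\<bar> * \<delta> - ln 2 / s n"
    \<comment> \<open>The limit is \<open>- (\<delta>^2 / 2)\<close>; half of this gap is kept as a
      bound for large \<open>n\<close>.\<close>
    have ev1: "\<forall>\<^sub>F n in sequentially. L (x + \<delta>) n - \<delta> * (x + \<delta>) - L x n < - (\<delta>\<^sup>2 / 4)"
    proof (rule order_tendstoD(2))
      show "(\<lambda>n. L (x + \<delta>) n - \<delta> * (x + \<delta>) - L x n) \<longlonglongrightarrow> (x + \<delta>)\<^sup>2 / 2 - \<delta> * (x + \<delta>) - x\<^sup>2 / 2"
        by (intro tendsto_intros L)
      have "(x + \<delta>)\<^sup>2 / 2 - \<delta> * (x + \<delta>) - x\<^sup>2 / 2 = - (\<delta>\<^sup>2 / 2)" by (simp add: power2_eq_square field_simps)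
      then show "(x + \<delta>)\<^sup>2 / 2 - \<delta> * (x + \<delta>) - x\<^sup>2 / 2 < - (\<delta>\<^sup>2 / 4)" using \<delta> by simp
    qed
    have ev2: "\<forall>\<^sub>F n in sequentially. L (x - \<delta>) n + \<delta> * (x - \<delta>) - L x n < - (\<delta>\<^sup>2 / 4)"
    proof (rule order_tendstoD(2))
      show "(\<lambda>n. L (x - \<delta>) n + \<delta> * (x - \<delta>) - L x n) \<longlonglongrightarrow> (x - \<delta>)\<^sup>2 / 2 + \<delta> * (x - \<delta>) - x\<^sup>2 / 2"
        by (intro tendsto_intros L)
      have "(x - \<delta>)\<^sup>2 / 2 + \<delta> * (x - \<delta>) - x\<^sup>2 / 2 = - (\<delta>\<^sup>2 / 2)" by (simp add: power2_eq_square field_simps)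
      then show "(x - \<delta>)\<^sup>2 / 2 + \<delta> * (x - \<delta>) - x\<^sup>2 / 2 < - (\<delta>\<^sup>2 / 4)" using \<delta> by simp
    qed
    \<comment> \<open>This makes \<open>exp (- s n * \<delta>^2 / 4)\<close> at most 1/4, so the two
      outer parts together carry at most half of the tilted mass.\<close>
    have ev3: "\<forall>\<^sub>F n in sequentially. s n > ln 4 * 4 / \<delta>\<^sup>2" using s by (simp add: filterlim_at_top_dense)
    have "\<forall>\<^sub>F n in sequentially. ereal (?c n) \<le> ?rate n U"
      using s_pos ev1 ev2 ev3
    proof eventually_elim
      case (elim n)
      interpret prob_space "M n" by (rule prob)
      note [measurable] = meas[of n]
      let ?A = "{\<omega> \<in> space (M n). Z n \<omega> \<in> U}"
      have A: "?A \<in> sets (M n)" using measurable_sets[OF meas[of n], of U] \<open>open U\<close>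
        by (auto simp: vimage_def Int_def conj_commute)
      let ?b = "exp (s n * (x\<^sup>2 + \<bar>x\<bar> * \<delta>))"
      let ?l = "exp (- s n * (\<delta> * (x + \<delta>)))" and ?r = "exp (s n * (\<delta> * (x - \<delta>)))"
      have "exp (s n * L x n) = expectation (\<lambda>\<omega>. exp (x * s n * Z n \<omega>))" using expL[OF elim(1)] by simp
      also have "\<dots> \<le> expectation (\<lambda>\<omega>. ?b * indicat_real ?A \<omega>
          + (?l * exp ((x + \<delta>) * s n * Z n \<omega>)
          + ?r * exp ((x - \<delta>) * s n * Z n \<omega>)))"
      proof (rule integral_mono)
        fix \<omega> assume \<omega>: "\<omega> \<in> space (M n)"
        let ?z = "Z n \<omega>"
        \<comment> \<open>The bound is pointwise: in each of the three regions a single summand on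
          the right already dominates.\<close>
        consider "\<bar>?z - x\<bar> < \<delta>" | "?z \<ge> x + \<delta>" | "?z \<le> x - \<delta>" by linarith
        then show "exp (x * s n * ?z) \<le> ?b * indicat_real ?A \<omega>
          + (?l * exp ((x + \<delta>) * s n * ?z)
          + ?r * exp ((x - \<delta>) * s n * ?z))"
        proof cases
          case 1
          then have "\<omega> \<in> ?A" using \<omega> \<delta> \<delta>0 by (auto simp: dist_real_def)
          have "x * (?z - x) \<le> \<bar>x\<bar> * \<delta>"
            using 1 by (metis abs_ge_self abs_ge_zero abs_mult less_imp_le mult_left_mono order_trans)
          then have "x * ?z \<le> x\<^sup>2 + \<bar>x\<bar> * \<delta>" by (simp add: power2_eq_square algebra_simps)
          then have "s n * (x * ?z) \<le> s n * (x\<^sup>2 + \<bar>x\<bar> * \<delta>)" using elim by (intro mult_left_mono) auto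
          then have "exp (x * s n * ?z) \<le> ?b" by (simp add: mult_ac)
          moreover have "0 \<le> ?l * exp ((x + \<delta>) * s n * ?z)
            + ?r * exp ((x - \<delta>) * s n * ?z)" by (simp add: add_nonneg_nonneg)
          moreover have one: "indicat_real ?A \<omega> = 1" using \<open>\<omega> \<in> ?A\<close> by simp
          ultimately show ?thesis unfolding one mult_1_right by linarith
        next
          case 2
          then have "0 \<le> s n * (\<delta> * (?z - (x + \<delta>)))" using elim \<delta> by (intro mult_nonneg_nonneg) auto
          then have "x * s n * ?z \<le> - s n * (\<delta> * (x + \<delta>)) + (x + \<delta>) * s n * ?z" by (simp add: algebra_simps)
          then have "exp (x * s n * ?z) \<le> ?l * exp ((x + \<delta>) * s n * ?z)"
            by (simp only: exp_add [symmetric] exp_le_cancel_iff)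
          moreover have "0 \<le> ?b * indicat_real ?A \<omega>" by simp
          moreover have "0 \<le> ?r * exp ((x - \<delta>) * s n * ?z)" by simp
          ultimately show ?thesis by linarith
        next
          case 3
          then have "0 \<le> s n * (\<delta> * ((x - \<delta>) - ?z))" using elim \<delta> by (intro mult_nonneg_nonneg) auto
          then have "x * s n * ?z \<le> s n * (\<delta> * (x - \<delta>)) + (x - \<delta>) * s n * ?z" by (simp add: algebra_simps)
          then have "exp (x * s n * ?z) \<le> ?r * exp ((x - \<delta>) * s n * ?z)"
            by (simp only: exp_add [symmetric] exp_le_cancel_iff)
          moreover have "0 \<le> ?b * indicat_real ?A \<omega>" by simp
          moreover have "0 \<le> ?l * exp ((x + \<delta>) * s n * ?z)" by simp
          ultimately show ?thesis by linarith
        qed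
      qed (use A int in \<open>auto simp: emeasure_eq_measure intro!: Bochner_Integration.integrable_add integrable_mult_right\<close>)
      also have "\<dots> = ?b * prob ?A
          + (?l * exp (s n * L (x + \<delta>) n)
          + ?r * exp (s n * L (x - \<delta>) n))"
      proof -
        have i: "integrable (M n) (indicat_real ?A)"
          by (intro integrable_real_indicator A) (simp add: emeasure_eq_measure)
        note i' = integrable_mult_right[OF int[of n "(x + \<delta>) * s n"], of ?l]
          integrable_mult_right[OF int[of n "(x - \<delta>) * s n"], of ?r]
        have "expectation (indicat_real ?A) = prob ?A" using A by simp
        then show ?thesis
          unfolding Bochner_Integration.integral_add[OF integrable_mult_right[OF i] Bochner_Integration.integrable_add[OF i']]
            Bochner_Integration.integral_add[OF i'] integral_mult_right_zero expL[OF elim(1)] by (simp only:)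
      qed
      finally have main: "exp (s n * L x n) \<le> ?b * prob ?A
          + (?l * exp (s n * L (x + \<delta>) n)
          + ?r * exp (s n * L (x - \<delta>) n))" .
      have small: "exp (s n * y) \<le> exp (s n * L x n) / 4" if "y - L x n < - (\<delta>\<^sup>2 / 4)" for y
      proof -
        have "ln 4 < s n * (\<delta>\<^sup>2 / 4)" using elim(4) \<delta> by (simp add: field_simps)
        moreover have "s n * (\<delta>\<^sup>2 / 4) \<le> s n * (L x n - y)" using that elim(1) by (intro mult_left_mono) auto
        ultimately have "s n * y \<le> s n * L x n - ln 4" by (simp add: algebra_simps)
        then have "exp (s n * y) \<le> exp (s n * L x n - ln 4)" by simp
        then show ?thesis by (simp add: exp_diff)
      qed
      have "?l * exp (s n * L (x + \<delta>) n) \<le> exp (s n * L x n) / 4"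
        using small[of "L (x + \<delta>) n - \<delta> * (x + \<delta>)"] elim(2) by (simp add: exp_add [symmetric] algebra_simps)
      moreover have "?r * exp (s n * L (x - \<delta>) n) \<le> exp (s n * L x n) / 4"
        using small[of "L (x - \<delta>) n + \<delta> * (x - \<delta>)"] elim(3) by (simp add: exp_add [symmetric] algebra_simps)
      ultimately have "exp (s n * L x n) / 2 \<le> ?b * prob ?A" using main by linarith
      then have "exp (s n * L x n) / (2 * ?b) \<le> prob ?A"
        by (simp add: field_simps)
      also have "exp (s n * L x n) / (2 * ?b) = exp (s n * ?c n)"
      proof -
        have "s n * ?c n = s n * L x n - (ln 2 + s n * (x\<^sup>2 + \<bar>x\<bar> * \<delta>))" using elim(1) by (simp add: field_simps)
        then show ?thesis by (simp only: exp_diff exp_add exp_ln zero_less_numeral)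
      qed
      finally have "ereal (s n * ?c n) \<le> elog (prob ?A)" by (rule elog_ge)
      then have "ereal (1 / s n) * ereal (s n * ?c n) \<le> ereal (1 / s n) * elog (prob ?A)"
        using elim by (intro ereal_mult_left_mono) auto
      then show ?case using elim(1) by simp
    qed
    then have "liminf (\<lambda>n. ereal (?c n)) \<le> liminf (\<lambda>n. ?rate n U)"
      by (rule Liminf_mono)
    moreover have "liminf (\<lambda>n. ereal (?c n)) = ereal (- (x\<^sup>2 / 2) - \<bar>x\<bar> * \<delta>)"
    proof (rule lim_imp_Liminf)
      have "?c \<longlonglongrightarrow> x\<^sup>2 / 2 - x\<^sup>2 - \<bar>x\<bar> * \<delta> - 0"
        by (intro tendsto_intros L real_tendsto_divide_at_top[OF tendsto_const s])
      then show "(\<lambda>n. ereal (?c n)) \<longlonglongrightarrow> ereal (- (x\<^sup>2 / 2) - \<bar>x\<bar> * \<delta>)" by simp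
    qed simp
    ultimately have "ereal (- (x\<^sup>2 / 2) - \<bar>x\<bar> * \<delta>) \<le> liminf (\<lambda>n. ?rate n U)"
      by simp
    then have "ereal (- (x\<^sup>2 / 2) - \<bar>x\<bar> * \<delta>) + ereal \<epsilon> \<le> liminf (\<lambda>n. ?rate n U) + ereal \<epsilon>"
      by (rule add_right_mono)
    moreover have "ereal (- (x\<^sup>2 / 2)) \<le> ereal (- (x\<^sup>2 / 2) - \<bar>x\<bar> * \<delta>) + ereal \<epsilon>" using x\<delta> by simp
    ultimately show "ereal (- (x\<^sup>2 / 2)) \<le> liminf (\<lambda>n. ?rate n U) + ereal \<epsilon>"
      by (rule order_trans[rotated])
  qed
  show ?thesis
    unfolding satisfies_MDP_def
  proof (intro conjI allI impI)
    show "prob_space (M n)" "Z n \<in> borel_measurable (M n)" for n using prob meas by auto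
    show "filterlim s at_top sequentially" by fact
    show "0 \<le> x\<^sup>2 / 2" for x :: real by simp
    show "compact {x::real. x\<^sup>2 / 2 \<le> c}" if "0 \<le> c" for c
    proof -
      have "{x::real. x\<^sup>2 / 2 \<le> c} = {- sqrt (2 * c)..sqrt (2 * c)}"
      proof (rule Set.set_eqI)
        fix x :: real
        have "x \<in> {- sqrt (2 * c)..sqrt (2 * c)} \<longleftrightarrow> sqrt (x\<^sup>2) \<le> sqrt (2 * c)"
          unfolding real_sqrt_abs atLeastAtMost_iff by linarith
        then show "x \<in> {x. x\<^sup>2 / 2 \<le> c} \<longleftrightarrow> x \<in> {- sqrt (2 * c)..sqrt (2 * c)}"
          unfolding real_sqrt_le_iff mem_Collect_eq by linarith
      qed
      then show ?thesis by simp
    qed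
    show "limsup (\<lambda>n. ?rate n F) \<le> - (INF x\<in>F. ereal (x\<^sup>2 / 2))"
      if F: "closed F" for F
    proof (cases "F = {}")
      case True
      \<comment> \<open>The empty set satisfies the distance condition for every \<open>r\<close>;
        this choice makes \<open>r^2 / 2\<close> equal to \<open>\<bar>K\<bar>\<close>.\<close>
      have "limsup (\<lambda>n. ?rate n F) \<le> ereal K" for K
      proof -
        have "limsup (\<lambda>n. ?rate n F) \<le> ereal (- ((sqrt (2 * \<bar>K\<bar>))\<^sup>2 / 2))"
          by (rule upper) (use True in auto)
        also have "\<dots> \<le> ereal K" by simp
        finally show ?thesis .
      qed
      then have "limsup (\<lambda>n. ?rate n F) = - \<infinity>"
        by (rule ereal_bot)
      then show ?thesis by simp
    next
      case False
      \<comment> \<open>A nonempty closed set has a point nearest to the origin, and there the bound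
        is the value of the rate at a point of the set.\<close>
      obtain y where y: "y \<in> F" "\<And>x. x \<in> F \<Longrightarrow> dist 0 y \<le> dist 0 x"
        using distance_attains_inf[OF F False] by metis
      have "limsup (\<lambda>n. ?rate n F) \<le> ereal (- (\<bar>y\<bar>\<^sup>2 / 2))"
        by (rule upper) (use y F in \<open>auto simp: dist_real_def\<close>)
      also have "\<dots> = - ereal (y\<^sup>2 / 2)" by simp
      also have "\<dots> \<le> - (INF x\<in>F. ereal (x\<^sup>2 / 2))"
        unfolding ereal_minus_le_minus by (rule INF_lower[OF y(1)])
      finally show ?thesis .
    qed
    show "- (INF x\<in>U. ereal (x\<^sup>2 / 2)) \<le> liminf (\<lambda>n. ?rate n U)"
      if U: "open U" for U
    proof -
      have "- liminf (\<lambda>n. ?rate n U) \<le> (INF x\<in>U. ereal (x\<^sup>2 / 2))"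
      proof (rule INF_greatest)
        fix x assume "x \<in> U"
        from lower[OF U this] show "- liminf (\<lambda>n. ?rate n U) \<le> ereal (x\<^sup>2 / 2)"
          by (subst ereal_uminus_le_reorder) simp
      qed
      then show ?thesis by (subst ereal_uminus_le_reorder)
    qed
  qed
qed

subsection \<open>Vandermonde and Andreief\<close>

text \<open>The last column is replaced by the values of the monic polynomial \<open>q\<close> with
  roots \<open>x 0, ..., x (n - 1)\<close>. This leaves the determinant unchanged and makes all
  entries of that column vanish except the last, which is the new product of differences.\<close>

lemma vandermonde_det:
  fixes x :: "nat \<Rightarrow> 'a::idom"
  shows "det (mat n n (\<lambda>(i, j). x i ^ j)) = (\<Prod>j<n. \<Prod>i<j. x j - x i)"
proof (induction n)
  case 0
  show ?case by simp
next
  case (Suc n)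
  define q where "q = (\<Prod>k<n. [:- x k, 1:])"
  have deg: "degree q = n" unfolding q_def by (subst degree_prod_eq_sum_degree) auto
  have "lead_coeff q = 1" unfolding q_def lead_coeff_prod by simp
  then have mon: "coeff q n = 1" unfolding deg .
  let ?V = "mat (Suc n) (Suc n) (\<lambda>(i, j). x i ^ j)"
  \<comment> \<open>The column operation as a matrix: the identity with last column the coefficients
    of \<open>q\<close>, hence unit upper triangular.\<close>
  let ?U = "mat (Suc n) (Suc n) (\<lambda>(i, j). if j < n then (if i = j then 1 else 0) else coeff q i)"
  let ?B = "mat (Suc n) (Suc n) (\<lambda>(i, j). if j < n then x i ^ j else poly q (x i))"
  have VU: "?V * ?U = ?B"
  proof (rule eq_matI)
    fix i j assume "i < dim_row ?B" "j < dim_col ?B"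
    then have ij: "i < Suc n" "j < Suc n" by auto
    have "(?V * ?U) $$ (i, j) = (\<Sum>k<Suc n. x i ^ k * (if j < n then (if k = j then 1 else 0) else coeff q k))"
      using ij by (simp add: scalar_prod_def atLeast0LessThan del: sum.lessThan_Suc)
    also have "\<dots> = ?B $$ (i, j)"
    proof (cases "j < n")
      case True
      then show ?thesis using ij by (simp add: if_distrib[of "\<lambda>z. _ * z"] sum.delta cong: if_cong del: sum.lessThan_Suc)
    next
      case False
      then show ?thesis using ij by (simp add: poly_altdef deg lessThan_Suc_atMost mult.commute del: sum.lessThan_Suc)
    qed
    finally show "(?V * ?U) $$ (i, j) = ?B $$ (i, j)" .
  qed auto
  have "upper_triangular ?U"
    unfolding upper_triangular_def by auto
  then have "det ?U = prod_list (diag_mat ?U)" by (rule det_upper_triangular[OF _ mat_carrier])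
  also have "\<dots> = (\<Prod>i = 0..<Suc n. if i < n then 1 else coeff q i)"
    unfolding prod_list_diag_prod by (intro prod.cong) auto
  also have "\<dots> = 1" using mon by (intro prod.neutral) (auto simp: less_Suc_eq)
  finally have "det ?U = 1" .
  then have "det ?V = det ?B"
    using det_mult[of ?V "Suc n" ?U] VU by simp
  also have "\<dots> = (\<Sum>i<Suc n. ?B $$ (i, n) * cofactor ?B i n)"
    by (rule laplace_expansion_column) auto
  also have "\<dots> = ?B $$ (n, n) * cofactor ?B n n"
  proof -
    have "?B $$ (i, n) = 0" if "i < n" for i
      using that by (auto simp: q_def poly_prod)
    then show ?thesis by simp
  qed
  also have "mat_delete ?B n n = mat n n (\<lambda>(i, j). x i ^ j)"
    by (rule eq_matI) (auto simp: mat_delete_def)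
  then have "cofactor ?B n n = det (mat n n (\<lambda>(i, j). x i ^ j))"
    by (simp add: cofactor_def)
  also have "?B $$ (n, n) = (\<Prod>i<n. x n - x i)"
    by (simp add: q_def poly_prod)
  finally show ?case using Suc.IH by (simp add: mult.commute)
qed

lemma sq_vandermonde_det:
  "sq_vandermonde n x = (det (mat n n (\<lambda>(i, j). complex_of_real (x i) ^ j)))\<^sup>2"
  unfolding vandermonde_det sq_vandermonde_def by (simp add: prod_power_distrib)

text \<open>Both Vandermonde determinants are expanded over permutations, so the integral factorises
  over coordinates. For fixed \<open>\<sigma>\<close> the sum over \<open>\<tau>\<close> is the
  Hankel determinant with rows permuted by \<open>\<sigma>\<close>; the two signs cancel, and each
  of the \<open>n!\<close> permutations contributes the same value.\<close>

lemma andreief: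
  fixes g :: "real \<Rightarrow> complex"
  assumes int: "\<And>k. integrable std_gauss (\<lambda>t. complex_of_real t ^ k * g t)"
  shows "(LINT x|gauss {..<n}. sq_vandermonde n x * (\<Prod>i<n. g (x i)))
    = fact n * det (mat n n (\<lambda>(i, j). LINT t|std_gauss. complex_of_real t ^ (i + j) * g t))"
proof -
  let ?S = "{\<sigma>. \<sigma> permutes {0..<n}}"
  let ?H = "mat n n (\<lambda>(i, j). LINT t|std_gauss. complex_of_real t ^ (i + j) * g t)"
  have fin: "finite ?S" by (rule finite_permutations) simp
  have perm_less: "\<sigma> i < n" if "\<sigma> \<in> ?S" "i < n" for \<sigma> i
    using permutes_in_image[of \<sigma> "{0..<n}" i] that by auto
  have detV: "det (mat n n (\<lambda>(i, j). complex_of_real (x i) ^ j)) = (\<Sum>\<sigma>\<in>?S. signof \<sigma> * (\<Prod>i<n. complex_of_real (x i) ^ \<sigma> i))" for x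
    by (subst det_def'[of _ n]) (auto simp: atLeast0LessThan perm_less intro!: sum.cong prod.cong)
  have e: "sq_vandermonde n x * (\<Prod>i<n. g (x i))
    = (\<Sum>\<sigma>\<in>?S. \<Sum>\<tau>\<in>?S. (signof \<sigma> * signof \<tau>) * (\<Prod>i<n. complex_of_real (x i) ^ (\<sigma> i + \<tau> i) * g (x i)))" for x
    unfolding sq_vandermonde_det detV power2_eq_square sum_product
    unfolding sum_distrib_right
    by (intro sum.cong refl) (simp add: prod.distrib power_add mult_ac)
  have int': "integrable (gauss {..<n}) (\<lambda>x. \<Prod>i<n. complex_of_real (x i) ^ (\<sigma> i + \<tau> i) * g (x i))" for \<sigma> \<tau>
    unfolding gauss_def using int by (intro std_gauss_product.product_integrable_prod) auto
  have "(LINT x|gauss {..<n}. sq_vandermonde n x * (\<Prod>i<n. g (x i)))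
    = (\<Sum>\<sigma>\<in>?S. \<Sum>\<tau>\<in>?S. (signof \<sigma> * signof \<tau>) * (LINT x|gauss {..<n}. (\<Prod>i<n. complex_of_real (x i) ^ (\<sigma> i + \<tau> i) * g (x i))))"
    unfolding e using int' by (simp add: Bochner_Integration.integral_sum)
  also have "\<dots> = (\<Sum>\<sigma>\<in>?S. \<Sum>\<tau>\<in>?S. (signof \<sigma> * signof \<tau>) * (\<Prod>i<n. LINT t|std_gauss. complex_of_real t ^ (\<sigma> i + \<tau> i) * g t))"
    unfolding gauss_def using int by (subst std_gauss_product.product_integral_prod) auto
  also have "\<dots> = (\<Sum>\<sigma>\<in>?S. signof \<sigma> * det (mat n n (\<lambda>(i, j). ?H $$ (\<sigma> i, j))))"
    by (intro sum.cong refl, subst det_def'[of _ n])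
      (auto simp: atLeast0LessThan perm_less sum_distrib_left mult.assoc intro!: sum.cong prod.cong)
  also have "\<dots> = (\<Sum>\<sigma>\<in>?S. signof \<sigma> * (signof \<sigma> * det ?H))"
  proof (rule sum.cong[OF refl])
    fix \<sigma> assume "\<sigma> \<in> ?S"
    then have "det (mat n n (\<lambda>(i, j). ?H $$ (\<sigma> i, j))) = signof \<sigma> * det ?H"
      by (intro det_permute_rows) auto
    then show "signof \<sigma> * det (mat n n (\<lambda>(i, j). ?H $$ (\<sigma> i, j))) = signof \<sigma> * (signof \<sigma> * det ?H)" by simp
  qed
  also have "\<dots> = (\<Sum>\<sigma>\<in>?S. det ?H)"
    by (intro sum.cong refl) (simp add: sign_def)
  also have "\<dots> = fact n * det ?H"
    using card_permutations[of "{0..<n}" n] by simp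
  finally show ?thesis .
qed

text \<open>A vanishing integral would force \<open>P\<close> to vanish almost everywhere, since the
  Gaussian density is positive, whereas its zero set is finite.\<close>

lemma integral_std_gauss_norm_poly_pos:
  assumes "P \<noteq> 0"
  shows "(LINT t|std_gauss. (cmod (poly P (complex_of_real t)))\<^sup>2) > 0"
proof -
  let ?f = "\<lambda>t. (cmod (poly P (complex_of_real t)))\<^sup>2"
  \<comment> \<open>On the real line the squared modulus is itself a polynomial, which gives
    integrability.\<close>
  have e: "?f t = Re (poly (P * map_poly cnj P) (complex_of_real t))" for t
  proof -
    have "poly (map_poly cnj P) (complex_of_real t) = cnj (poly P (complex_of_real t))"
      by (metis complex_cnj_complex_of_real complex_cnj_cnj poly_cnj)
    then show ?thesis by (simp add: complex_norm_square[symmetric])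
  qed
  have int: "integrable std_gauss ?f"
    unfolding e by (intro integrable_Re integrable_std_gauss_poly)
  have "(LINT t|std_gauss. ?f t) \<noteq> 0"
  proof
    assume "(LINT t|std_gauss. ?f t) = 0"
    then have "AE t in std_gauss. ?f t = 0"
      using int by (subst (asm) integral_nonneg_eq_0_iff_AE) auto
    then have "AE t in lborel. poly P (complex_of_real t) = 0"
      unfolding std_gauss_def by (subst (asm) AE_density) (auto simp: normal_density_pos)
    moreover have "finite {t :: real. poly P (complex_of_real t) = 0}"
      using finite_vimageI[OF poly_roots_finite[OF assms], of complex_of_real]
      by (simp add: vimage_def inj_on_def)
    then have "AE t in lborel. t \<notin> {t :: real. poly P (complex_of_real t) = 0}"
      by (intro AE_not_in finite_imp_null_set_lborel)
    ultimately have "AE t in (lborel :: real measure). False" by eventually_elim auto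
    then have "emeasure lborel (UNIV :: real set) = 0"
      by (subst (asm) AE_iff_measurable[OF _ refl]) auto
    then show False by simp
  qed
  moreover have "(LINT t|std_gauss. ?f t) \<ge> 0" by (rule integral_nonneg_AE) simp
  ultimately show ?thesis by linarith
qed

text \<open>A kernel vector \<open>v\<close> is read as the coefficients of a polynomial
  \<open>P\<close>. The quadratic form at \<open>v\<close> integrates \<open>|P|^2\<close> with
  weight \<open>w\<close> on \<open>B\<close> and 1 elsewhere, so \<open>a + w * b = 0\<close> with
  \<open>a\<close> and \<open>b\<close> nonnegative and not both zero; hence
  \<open>w = - a / b\<close>.\<close>

lemma hankel_roots:
  assumes B: "B \<in> sets borel"
    and det: "det (mat n n (\<lambda>(i, j). LINT t|std_gauss. complex_of_real t ^ (i + j) * (if t \<in> B then w else 1))) = 0"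
  shows "Im w = 0 \<and> Re w \<le> 0"
proof -
  let ?h = "\<lambda>i j. LINT t|std_gauss. complex_of_real t ^ (i + j) * (if t \<in> B then w else 1)"
  let ?g = "\<lambda>t. if t \<in> B then w else 1"
  have g [measurable]: "?g \<in> borel_measurable borel" using B by measurable
  have int: "integrable std_gauss (\<lambda>t. poly p (complex_of_real t) * ?g t)" for p
  proof (rule Bochner_Integration.integrable_bound)
    show "integrable std_gauss (\<lambda>t. (cmod w + 1) * cmod (poly p (complex_of_real t)))"
      by (intro integrable_mult_right integrable_norm integrable_std_gauss_poly)
    show "AE t in std_gauss. cmod (poly p (complex_of_real t) * ?g t) \<le> norm ((cmod w + 1) * cmod (poly p (complex_of_real t)))"
      by (rule AE_I2) (auto simp: norm_mult algebra_simps)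
    show "(\<lambda>t. poly p (complex_of_real t) * ?g t) \<in> borel_measurable std_gauss"
      using borel_measurable_integrable[OF integrable_std_gauss_poly[of p]] by measurable
  qed
  have intk: "integrable std_gauss (\<lambda>t. complex_of_real t ^ k * ?g t)" for k
    using int[of "monom 1 k"] by (simp add: poly_monom)
  obtain v where v: "v \<in> carrier_vec n" "v \<noteq> 0\<^sub>v n" "mat n n (\<lambda>(i, j). ?h i j) *\<^sub>v v = 0\<^sub>v n"
    using det det_0_iff_vec_prod_zero[of "mat n n (\<lambda>(i, j). ?h i j)" n] by auto
  define P where "P = (\<Sum>j<n. monom (v $ j) j)"
  have coeffP: "coeff P j = v $ j" if "j < n" for j
    unfolding P_def coeff_sum using that by (simp add: sum.delta)
  have "P \<noteq> 0"
  proof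
    assume "P = 0"
    then have "v = 0\<^sub>v n" using coeffP v(1) by (intro eq_vecI) auto
    then show False using v(2) by simp
  qed
  have row: "(\<Sum>j<n. ?h i j * v $ j) = 0" if "i < n" for i
  proof -
    have "(mat n n (\<lambda>(i, j). ?h i j) *\<^sub>v v) $ i = (\<Sum>j<n. ?h i j * v $ j)"
      using that v(1) by (simp add: scalar_prod_def atLeast0LessThan)
    then show ?thesis using v(3) that by simp
  qed
  have "0 = (\<Sum>i<n. cnj (v $ i) * (\<Sum>j<n. ?h i j * v $ j))" using row by simp
  also have "\<dots> = (\<Sum>i<n. \<Sum>j<n. LINT t|std_gauss. (cnj (v $ i) * v $ j) * (complex_of_real t ^ (i + j) * ?g t))"
    by (simp only: sum_distrib_left integral_mult_right_zero mult_ac)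
  also have "\<dots> = (LINT t|std_gauss. (\<Sum>i<n. \<Sum>j<n. (cnj (v $ i) * v $ j) * (complex_of_real t ^ (i + j) * ?g t)))"
    using intk by (simp add: Bochner_Integration.integral_sum)
  also have "\<dots> = (LINT t|std_gauss. complex_of_real ((cmod (poly P (complex_of_real t)))\<^sup>2) * ?g t)"
  proof (rule Bochner_Integration.integral_cong[OF refl])
    fix t
    have "complex_of_real ((cmod (poly P (complex_of_real t)))\<^sup>2) = cnj (poly P (complex_of_real t)) * poly P (complex_of_real t)"
      by (subst complex_norm_square) (rule mult.commute)
    also have "\<dots> = (\<Sum>i<n. \<Sum>j<n. (cnj (v $ i) * v $ j) * complex_of_real t ^ (i + j))"
    proof -
      have "poly P (complex_of_real t) = (\<Sum>j<n. v $ j * complex_of_real t ^ j)"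
        and "cnj (poly P (complex_of_real t)) = (\<Sum>j<n. cnj (v $ j) * complex_of_real t ^ j)"
        unfolding P_def by (simp_all add: poly_sum poly_monom)
      then have "cnj (poly P (complex_of_real t)) * poly P (complex_of_real t)
        = (\<Sum>i<n. \<Sum>j<n. (cnj (v $ i) * complex_of_real t ^ i) * (v $ j * complex_of_real t ^ j))"
        by (simp only: sum_product)
      then show ?thesis by (simp only: power_add mult_ac)
    qed
    finally show "(\<Sum>i<n. \<Sum>j<n. (cnj (v $ i) * v $ j) * (complex_of_real t ^ (i + j) * ?g t))
      = complex_of_real ((cmod (poly P (complex_of_real t)))\<^sup>2) * ?g t"
      by (simp only: sum_distrib_right mult.assoc)
  qed
  finally have zero: "(LINT t|std_gauss. complex_of_real ((cmod (poly P (complex_of_real t)))\<^sup>2) * ?g t) = 0" ..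
  let ?f = "\<lambda>t. (cmod (poly P (complex_of_real t)))\<^sup>2"
  \<comment> \<open>The Bochner integral of a non-integrable function is zero by convention, so a
    nonzero value implies integrability.\<close>
  have intf: "integrable std_gauss ?f"
  proof -
    have "(LINT t|std_gauss. ?f t) \<noteq> 0" using integral_std_gauss_norm_poly_pos[OF \<open>P \<noteq> 0\<close>] by simp
    then show ?thesis using not_integrable_integral_eq by blast
  qed
  define b where "b = (LINT t|std_gauss. ?f t * indicat_real B t)"
  define a where "a = (LINT t|std_gauss. ?f t * indicat_real (- B) t)"
  have ib: "integrable std_gauss (\<lambda>t. ?f t * indicat_real B t)" "integrable std_gauss (\<lambda>t. ?f t * indicat_real (- B) t)"
    using B by (auto intro!: integrable_real_mult_indicator intf simp: borel_comp)
  have ab: "a \<ge> 0" "b \<ge> 0" unfolding a_def b_def by (auto intro!: integral_nonneg_AE)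
  have "a + b = (LINT t|std_gauss. ?f t)"
    unfolding a_def b_def Bochner_Integration.integral_add[OF ib(2,1), symmetric]
    by (intro Bochner_Integration.integral_cong) (auto simp: indicator_def)
  then have pos: "a + b > 0" using integral_std_gauss_norm_poly_pos[OF \<open>P \<noteq> 0\<close>] by simp
  have "(LINT t|std_gauss. complex_of_real (?f t) * ?g t)
    = (LINT t|std_gauss. complex_of_real (?f t * indicat_real (- B) t) + w * complex_of_real (?f t * indicat_real B t))"
    by (intro Bochner_Integration.integral_cong) (auto simp: indicator_def)
  also have "\<dots> = complex_of_real a + w * complex_of_real b"
    unfolding a_def b_def
      Bochner_Integration.integral_add[OF integrable_of_real[OF ib(2)] integrable_mult_right[OF integrable_of_real[OF ib(1)]]]
    by (simp only: integral_mult_right_zero integral_complex_of_real)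
  finally have eq: "complex_of_real a + w * complex_of_real b = 0" using zero by simp
  have re: "a + Re w * b = 0" and im: "Im w * b = 0"
    using arg_cong[OF eq, of Re] arg_cong[OF eq, of Im] by auto
  \<comment> \<open>If \<open>b\<close> were zero, the equation would give \<open>a = 0\<close> as
    well, against \<open>a + b > 0\<close>.\<close>
  have "b > 0" using re ab pos by (cases "b = 0") auto
  have "\<not> Re w > 0"
  proof
    assume "Re w > 0"
    then have "Re w * b > 0" using \<open>b > 0\<close> by simp
    then show False using re ab by linarith
  qed
  then show ?thesis using im \<open>b > 0\<close> by auto
qed

text \<open>Andreief's identity with \<open>g\<close> equal to \<open>w\<close> on \<open>B\<close>
  and 1 off \<open>B\<close> turns the generating function into a Hankel determinant
  \<open>Q\<close>. Its roots are real and nonpositive; in particular 1 is not a root, so the total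
  mass is nonzero, and every linear factor can be rescaled to a Bernoulli generating
  function.\<close>

lemma coulomb_count_pgf:
  assumes B: "B \<in> sets borel"
  shows "(LINT x|gauss {..<n}. sq_vandermonde n x) \<noteq> 0 \<and>
    (\<exists>(d :: nat) (p :: nat \<Rightarrow> real). (\<forall>i<d. 0 \<le> p i \<and> p i \<le> 1) \<and>
      (\<forall>z :: real. (LINT x|gauss {..<n}. sq_vandermonde n x * complex_of_real z ^ card {i. i < n \<and> x i \<in> B})
        = (LINT x|gauss {..<n}. sq_vandermonde n x) * complex_of_real (\<Prod>i<d. 1 - p i + p i * z)))"
proof -
  let ?Z = "LINT x|gauss {..<n}. sq_vandermonde n x"
  let ?H = "\<lambda>w. mat n n (\<lambda>(i, j). LINT t|std_gauss. complex_of_real t ^ (i + j) * (if t \<in> B then w else 1))"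
  let ?m = "\<lambda>k. LINT t|std_gauss. complex_of_real t ^ k"
  let ?mB = "\<lambda>k. LINT t|std_gauss. complex_of_real t ^ k * indicator B t"
  have intk: "integrable std_gauss (\<lambda>t. complex_of_real t ^ k)" for k
    using integrable_std_gauss_poly[of "monom 1 k"] by (simp add: poly_monom)
  have intB: "integrable std_gauss (\<lambda>t. complex_of_real t ^ k * indicator B t)" for k
  proof -
    have "(\<lambda>t. indicat_real B t *\<^sub>R complex_of_real t ^ k) = (\<lambda>t. complex_of_real t ^ k * indicator B t)"
      by (auto simp: indicator_def fun_eq_iff)
    then show ?thesis using integrable_mult_indicator[OF _ intk[of k], of B] B by simp
  qed
  have split: "complex_of_real t ^ k * (if t \<in> B then w else 1) = complex_of_real t ^ k + (w - 1) * (complex_of_real t ^ k * indicator B t)" for t k w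
    by (auto simp: indicator_def algebra_simps)
  have int: "integrable std_gauss (\<lambda>t. complex_of_real t ^ k * (if t \<in> B then w else 1))" for k w
    unfolding split by (intro Bochner_Integration.integrable_add integrable_mult_right intk intB)
  have Hlin: "(LINT t|std_gauss. complex_of_real t ^ k * (if t \<in> B then w else 1)) = ?m k + (w - 1) * ?mB k" for k w
    unfolding split using intk intB by (subst Bochner_Integration.integral_add) auto
  \<comment> \<open>The matrix entries are affine in \<open>w\<close>, so the determinant is taken
    over polynomials, and evaluation at \<open>w\<close> commutes with it.\<close>
  define Q where "Q = det (mat n n (\<lambda>(i, j). [:?m (i + j) - ?mB (i + j), ?mB (i + j):]))"
  have Q: "poly Q w = det (?H w)" for w
  proof -
    have hom: "comm_ring_hom (\<lambda>p :: complex poly. poly p w)" by unfold_locales auto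
    have "map_mat (\<lambda>p. poly p w) (mat n n (\<lambda>(i, j). [:?m (i + j) - ?mB (i + j), ?mB (i + j):])) = ?H w"
    proof (rule eq_matI)
      fix i j assume "i < dim_row (?H w)" "j < dim_col (?H w)"
      moreover have "?m (i + j) - ?mB (i + j) + w * ?mB (i + j) = ?m (i + j) + (w - 1) * ?mB (i + j)"
        by (simp add: left_diff_distrib)
      ultimately show "map_mat (\<lambda>p. poly p w) (mat n n (\<lambda>(i, j). [:?m (i + j) - ?mB (i + j), ?mB (i + j):])) $$ (i, j) = ?H w $$ (i, j)"
        by (simp only: Hlin index_map_mat index_mat dim_row_mat dim_col_mat prod.case poly_pCons poly_0 mult_zero_right add_0_right)
    qed auto
    then show ?thesis unfolding Q_def comm_ring_hom.hom_det[OF hom, symmetric] by simp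
  qed
  have pgf: "(LINT x|gauss {..<n}. sq_vandermonde n x * w ^ card {i. i < n \<and> x i \<in> B}) = fact n * poly Q w" for w :: complex
  proof -
    have "w ^ card {i. i < n \<and> x i \<in> B} = (\<Prod>i<n. if x i \<in> B then w else 1)" for x
    proof -
      have "{i. i < n \<and> x i \<in> B} = {i \<in> {..<n}. x i \<in> B}" by auto
      then show ?thesis by (simp add: prod.If_cases Int_def)
    qed
    then show ?thesis using andreief[OF int, of n w] unfolding Q by simp
  qed
  have Z: "?Z = fact n * poly Q 1" using pgf[of 1] by simp
  have roots: "Im w = 0 \<and> Re w \<le> 0" if "poly Q w = 0" for w
    using hankel_roots[OF B] that unfolding Q by blast
  have Q1: "poly Q 1 \<noteq> 0" using roots[of 1] by auto
  obtain as where as: "Polynomial.smult (coeff Q (degree Q)) (\<Prod>a\<leftarrow>as. [:- a, 1:]) = Q"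
    using fundamental_theorem_algebra_factorized[of Q] by blast
  let ?c = "coeff Q (degree Q)"
  have eval: "poly Q w = ?c * (\<Prod>a\<leftarrow>as. w - a)" for w
  proof -
    have "poly Q w = ?c * poly (\<Prod>a\<leftarrow>as. [:- a, 1:]) w" by (subst as[symmetric]) simp
    also have "poly (\<Prod>a\<leftarrow>as. [:- a, 1:]) w = (\<Prod>a\<leftarrow>as. w - a)"
      by (induction as) (simp_all add: algebra_simps)
    finally show ?thesis .
  qed
  have as_real: "Im a = 0 \<and> Re a \<le> 0" if "a \<in> set as" for a
  proof (rule roots)
    have "(\<Prod>b\<leftarrow>as. a - b) = 0" using that by (auto simp: prod_list_zero_iff)
    then show "poly Q a = 0" unfolding eval by simp
  qed
  \<comment> \<open>For a root \<open>a \<le> 0\<close> one has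
    \<open>z - a = (1 - a) * (1 - p + p * z)\<close> with \<open>p = 1 / (1 - a)\<close>, which lies
    between 0 and 1.\<close>
  define p where "p i = 1 / (1 - Re (as ! i))" for i
  let ?d = "length as"
  have p: "\<forall>i<?d. 0 \<le> p i \<and> p i \<le> 1"
  proof (intro allI impI)
    fix i assume "i < ?d"
    then have "Re (as ! i) \<le> 0" using as_real[OF nth_mem] by blast
    then show "0 \<le> p i \<and> p i \<le> 1" by (simp add: p_def)
  qed
  have prod: "(\<Prod>a\<leftarrow>as. complex_of_real z - a) = (\<Prod>a\<leftarrow>as. 1 - a) * complex_of_real (\<Prod>i<?d. 1 - p i + p i * z)" for z
  proof -
    have f: "complex_of_real z - as ! i = (1 - as ! i) * complex_of_real (1 - p i + p i * z)" if "i < ?d" for i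
    proof -
      have r: "as ! i = complex_of_real (Re (as ! i))" "Re (as ! i) \<le> 0"
        using as_real[OF nth_mem[OF that]] by (auto simp: complex_eq_iff)
      have "z - Re (as ! i) = (1 - Re (as ! i)) * (1 - p i + p i * z)"
      proof -
        have one: "(1 - Re (as ! i)) * p i = 1" using r(2) by (simp add: p_def)
        have "(1 - Re (as ! i)) * (1 - p i + p i * z)
          = (1 - Re (as ! i)) - (1 - Re (as ! i)) * p i + (1 - Re (as ! i)) * p i * z"
          by (simp only: distrib_left right_diff_distrib mult_1_right mult.assoc)
        then show ?thesis unfolding one by simp
      qed
      then have "complex_of_real (z - Re (as ! i)) = complex_of_real ((1 - Re (as ! i)) * (1 - p i + p i * z))" by simp
      then show ?thesis by (subst (1 2) r(1)) simp
    qed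
    have l: "(\<Prod>a\<leftarrow>as. h a) = (\<Prod>i<?d. h (as ! i))" for h :: "complex \<Rightarrow> complex"
      by (metis (no_types, lifting) atLeast0LessThan length_map nth_map prod.cong prod.list_conv_set_nth lessThan_iff)
    show ?thesis unfolding l by (simp add: f prod.distrib)
  qed
  have main: "(LINT x|gauss {..<n}. sq_vandermonde n x * complex_of_real z ^ card {i. i < n \<and> x i \<in> B})
        = ?Z * complex_of_real (\<Prod>i<?d. 1 - p i + p i * z)" for z
    unfolding pgf Z eval prod by simp
  show ?thesis
  proof (rule conjI)
    show "?Z \<noteq> 0" using Q1 unfolding Z by simp
  qed (rule exI[of _ ?d], rule exI[of _ p], rule conjI[OF p], rule allI, rule main)
qed

subsection \<open>Spectra of Hermitian matrices\<close>

lemma hermitian_matD: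
  assumes "A \<in> carrier_mat n n" "hermitian_mat A" "i < n" "j < n"
  shows "A $$ (j, i) = cnj (A $$ (i, j))"
proof -
  have "mat_adjoint A $$ (j, i) = cnj (A $$ (i, j))"
    using assms by (simp add: mat_adjoint_def mat_of_rows_def)
  then show ?thesis using assms(2) unfolding hermitian_mat_def by simp
qed

text \<open>For an eigenvector \<open>v\<close> the form \<open>v^* A v\<close> equals its conjugate
  and also \<open>z\<close> times the squared norm of \<open>v\<close>.\<close>

lemma hermitian_eigenvalue_real:
  assumes A: "A \<in> carrier_mat n n" and h: "hermitian_mat A" and e: "eigenvalue A z"
  shows "Im z = 0"
proof -
  obtain v where v: "v \<in> carrier_vec n" "v \<noteq> 0\<^sub>v n" "A *\<^sub>v v = z \<cdot>\<^sub>v v"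
    using e A unfolding eigenvalue_def eigenvector_def by auto
  define S where "S = (\<Sum>i<n. (cmod (v $ i))\<^sup>2)"
  let ?q = "\<Sum>i<n. \<Sum>j<n. cnj (v $ i) * A $$ (i, j) * v $ j"
  have row: "(\<Sum>j<n. A $$ (i, j) * v $ j) = z * v $ i" if "i < n" for i
  proof -
    have "(A *\<^sub>v v) $ i = (\<Sum>j<n. A $$ (i, j) * v $ j)"
      using that v(1) A by (simp add: scalar_prod_def atLeast0LessThan)
    then show ?thesis using v(1,3) that by simp
  qed
  have "?q = (\<Sum>i<n. cnj (v $ i) * (\<Sum>j<n. A $$ (i, j) * v $ j))"
    by (simp add: sum_distrib_left mult.assoc)
  also have "\<dots> = (\<Sum>i<n. z * (v $ i * cnj (v $ i)))"
    using row by (intro sum.cong) (auto simp: mult_ac)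
  finally have q: "?q = z * complex_of_real S"
    unfolding S_def by (simp only: sum_distrib_left of_real_sum complex_norm_square)
  have "cnj ?q = (\<Sum>i<n. \<Sum>j<n. cnj (v $ j) * cnj (A $$ (i, j)) * v $ i)"
    by (simp add: mult_ac)
  also have "\<dots> = (\<Sum>i<n. \<Sum>j<n. cnj (v $ j) * A $$ (j, i) * v $ i)"
    by (intro sum.cong refl) (simp only: hermitian_matD[OF A h, symmetric] lessThan_iff)
  also have "\<dots> = ?q" by (rule sum.swap)
  finally have "cnj (z * complex_of_real S) = z * complex_of_real S" unfolding q .
  then have "Im z * S = 0" by (simp add: complex_eq_iff)
  moreover have "S \<noteq> 0"
  proof
    assume "S = 0"
    then have "\<forall>i<n. v $ i = 0" unfolding S_def by (subst (asm) sum_nonneg_eq_0_iff) auto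
    then have "v = 0\<^sub>v n" using v(1) by (intro eq_vecI) auto
    then show False using v(2) by simp
  qed
  ultimately show ?thesis by simp
qed

lemma trace_mult_commute:
  fixes A B :: "'a::comm_semiring_0 mat"
  assumes "A \<in> carrier_mat n n" "B \<in> carrier_mat n n"
  shows "(\<Sum>i<n. (A * B) $$ (i, i)) = (\<Sum>i<n. (B * A) $$ (i, i))"
proof -
  have "(\<Sum>i<n. (A * B) $$ (i, i)) = (\<Sum>i<n. \<Sum>l<n. A $$ (i, l) * B $$ (l, i))"
    using assms by (intro sum.cong) (auto simp: scalar_prod_def atLeast0LessThan)
  also have "\<dots> = (\<Sum>l<n. \<Sum>i<n. B $$ (l, i) * A $$ (i, l))"
    by (subst sum.swap) (simp add: mult.commute)
  also have "\<dots> = (\<Sum>i<n. (B * A) $$ (i, i))"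
    using assms by (intro sum.cong) (auto simp: scalar_prod_def atLeast0LessThan)
  finally show ?thesis .
qed

lemma upper_triangular_pow:
  fixes B :: "'a::comm_ring_1 mat"
  assumes B: "B \<in> carrier_mat n n" "upper_triangular B"
  shows "i < n \<Longrightarrow> j \<le> i \<Longrightarrow> (B ^\<^sub>m k) $$ (i, j) = (if i = j then (B $$ (i, i)) ^ k else 0)"
proof (induction k arbitrary: i j)
  case 0
  then show ?case using B by auto
next
  case (Suc k)
  have P: "B ^\<^sub>m k \<in> carrier_mat n n" using B(1) by (rule pow_carrier_mat)
  have "(B ^\<^sub>m Suc k) $$ (i, j) = (\<Sum>l<n. (B ^\<^sub>m k) $$ (i, l) * B $$ (l, j))"
    using Suc.prems B P by (simp add: scalar_prod_def atLeast0LessThan)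
  also have "\<dots> = (\<Sum>l<n. if l = i then (B $$ (i, i)) ^ k * B $$ (i, j) else 0)"
  proof (intro sum.cong refl)
    fix l assume l: "l \<in> {..<n}"
    show "(B ^\<^sub>m k) $$ (i, l) * B $$ (l, j) = (if l = i then (B $$ (i, i)) ^ k * B $$ (i, j) else 0)"
    proof (cases "l \<le> i")
      case True
      then show ?thesis using Suc.IH[of i l] Suc.prems by auto
    next
      case False
      then have "B $$ (l, j) = 0" using B l Suc.prems unfolding upper_triangular_def by auto
      then show ?thesis using False by simp
    qed
  qed
  also have "\<dots> = (B $$ (i, i)) ^ k * B $$ (i, j)" using Suc.prems by simp
  also have "\<dots> = (if i = j then (B $$ (i, i)) ^ Suc k else 0)"
  proof (cases "i = j")
    case False
    then have "B $$ (i, j) = 0" using B Suc.prems unfolding upper_triangular_def by auto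
    then show ?thesis using False by simp
  qed simp
  finally show ?case .
qed

text \<open>One list serves both counts and traces. Schur triangularisation is used: traces of
  powers are invariant under similarity, and the diagonal of a power of a triangular matrix consists
  of the powers of its diagonal entries.\<close>

lemma hermitian_spectrum:
  assumes A: "A \<in> carrier_mat n n" and h: "hermitian_mat A"
  shows "\<exists>l :: nat \<Rightarrow> real. (\<forall>J. eigenvalue_count J A = card {i. i < n \<and> l i \<in> J}) \<and>
    (\<forall>k. (\<Sum>i<n. (A ^\<^sub>m k) $$ (i, i)) = complex_of_real (\<Sum>i<n. l i ^ k))"
proof -
  obtain as where as: "char_poly A = (\<Prod>a\<leftarrow>as. [:- a, 1:])" "length as = n"
    using char_poly_factorized[OF A] by blast
  have re: "a = complex_of_real (Re a)" if "a \<in> set as" for a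
  proof -
    have "poly (char_poly A) a = 0"
      unfolding as(1) poly_prod_list using that by (auto simp: prod_list_zero_iff)
    then have "Im a = 0"
      using hermitian_eigenvalue_real[OF A h] eigenvalue_root_char_poly[OF A] by blast
    then show ?thesis by (simp add: complex_eq_iff)
  qed
  define l where "l i = Re (as ! i)" for i
  have l: "as ! i = complex_of_real (l i)" if "i < n" for i
    using re[OF nth_mem, of i] that as(2) unfolding l_def by simp
  have "proots (char_poly A) = mset as"
  proof -
    have "proots (\<Prod>a\<leftarrow>xs. [:- a, 1:]) = mset xs" for xs :: "complex list"
    proof (induction xs)
      case (Cons a xs)
      have "(\<Prod>a\<leftarrow>xs. [:- a, 1:]) \<noteq> (0 :: complex poly)" by (auto simp: prod_list_zero_iff)
      then have "proots ([:- a, 1:] * (\<Prod>a\<leftarrow>xs. [:- a, 1:])) = proots [:- a, 1:] + proots (\<Prod>a\<leftarrow>xs. [:- a, 1:])"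
        by (intro proots_mult) simp_all
      then show ?case unfolding list.map prod_list.Cons Cons proots_linear_factor by simp
    qed simp
    then show ?thesis using as(1) by simp
  qed
  then have count: "eigenvalue_count J A = card {i. i < n \<and> l i \<in> J}" for J
  proof -
    have "size (filter_mset (\<lambda>z. z \<in> complex_of_real ` J) (mset as)) = length (filter (\<lambda>z. z \<in> complex_of_real ` J) as)"
      by (simp flip: mset_filter)
    also have "\<dots> = card {i. i < n \<and> as ! i \<in> complex_of_real ` J}"
      unfolding length_filter_conv_card as(2) ..
    also have "{i. i < n \<and> as ! i \<in> complex_of_real ` J} = {i. i < n \<and> l i \<in> J}"
      using l by auto
    finally show ?thesis unfolding eigenvalue_count_def eigenvalue_mset_def \<open>proots (char_poly A) = mset as\<close> .
  qed
  obtain B P Q where "schur_decomposition A as = (B, P, Q)" by (cases "schur_decomposition A as") auto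
  from schur_decomposition[OF A as(1) this]
  have sim: "similar_mat_wit A B P Q" and ut: "upper_triangular B" and diag: "diag_mat B = as" by auto
  from similar_mat_witD2[OF A sim]
  have car: "B \<in> carrier_mat n n" "P \<in> carrier_mat n n" "Q \<in> carrier_mat n n" and QP: "Q * P = 1\<^sub>m n" by auto
  have "(\<Sum>i<n. (A ^\<^sub>m k) $$ (i, i)) = complex_of_real (\<Sum>i<n. l i ^ k)" for k
  proof -
    have Bk: "B ^\<^sub>m k \<in> carrier_mat n n" using car(1) by (rule pow_carrier_mat)
    have "(\<Sum>i<n. (A ^\<^sub>m k) $$ (i, i)) = (\<Sum>i<n. ((P * B ^\<^sub>m k) * Q) $$ (i, i))"
      using similar_mat_wit_pow_id[OF sim] by simp
    also have "\<dots> = (\<Sum>i<n. (Q * (P * B ^\<^sub>m k)) $$ (i, i))"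
      by (rule trace_mult_commute) (use car Bk in auto)
    also have "Q * (P * B ^\<^sub>m k) = (Q * P) * B ^\<^sub>m k"
      using car Bk by (metis assoc_mult_mat)
    also have "\<dots> = B ^\<^sub>m k" unfolding QP using left_mult_one_mat[OF Bk] .
    also have "(\<Sum>i<n. (B ^\<^sub>m k) $$ (i, i)) = (\<Sum>i<n. (as ! i) ^ k)"
    proof (intro sum.cong refl)
      fix i assume i: "i \<in> {..<n}"
      have "as ! i = B $$ (i, i)" using i car(1) unfolding diag[symmetric] diag_mat_def by simp
      then show "(B ^\<^sub>m k) $$ (i, i) = (as ! i) ^ k"
        using upper_triangular_pow[OF car(1) ut, of i i k] i by simp
    qed
    also have "\<dots> = complex_of_real (\<Sum>i<n. l i ^ k)" using l by simp
    finally show ?thesis .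
  qed
  then show ?thesis using count by blast
qed

subsection \<open>Gaussian coordinates of the GUE\<close>

text \<open>Groups the coordinates (i, j) and (j, i), which come from the real and imaginary part of
  the same matrix entry.\<close>

lemma prod_square_split:
  fixes f :: "nat \<times> nat \<Rightarrow> 'a::comm_monoid_mult"
  shows "(\<Prod>\<alpha>\<in>{..<n} \<times> {..<n}. f \<alpha>) = (\<Prod>(i, j)\<in>{(i, j). i \<le> j \<and> j < n}. if i = j then f (i, i) else f (i, j) * f (j, i))"
proof -
  let ?U = "{(i, j). i \<le> j \<and> j < n}" and ?S = "{(i, j). i < j \<and> j < n}" and ?L = "{(i, j). j < i \<and> i < n}"
  have fin: "finite ?U" "finite ?L" "finite ?S"
    by (rule finite_subset[of _ "{..<n} \<times> {..<n}"]; auto)+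
  have sq: "{..<n} \<times> {..<n} = ?U \<union> ?L" by auto
  have disj: "?U \<inter> ?L = {}" by auto
  have "(\<Prod>\<alpha>\<in>{..<n} \<times> {..<n}. f \<alpha>) = (\<Prod>\<alpha>\<in>?U. f \<alpha>) * (\<Prod>\<alpha>\<in>?L. f \<alpha>)"
    unfolding sq by (rule prod.union_disjoint[OF fin(1,2) disj])
  also have "(\<Prod>\<alpha>\<in>?L. f \<alpha>) = (\<Prod>(i, j)\<in>?S. f (j, i))"
    by (rule prod.reindex_bij_witness[of _ prod.swap prod.swap]) auto
  also have "\<dots> = (\<Prod>(i, j)\<in>?U. if i = j then 1 else f (j, i))"
    using fin by (intro prod.mono_neutral_cong_left) (auto simp: less_le split: if_splits)
  also have "(\<Prod>\<alpha>\<in>?U. f \<alpha>) * \<dots> = (\<Prod>(i, j)\<in>?U. if i = j then f (i, i) else f (i, j) * f (j, i))"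
    unfolding prod.distrib[symmetric] by (intro prod.cong) auto
  finally show ?thesis .
qed

text \<open>The inverse of \<open>gue_entry\<close> on Hermitian matrices: positions above the
  diagonal store the real part, mirrored positions below it the imaginary part of the same entry,
  both rescaled to unit variance. The restriction to the index set places the function in the
  product space.\<close>

definition gue_coord :: "nat \<Rightarrow> complex mat \<Rightarrow> nat \<times> nat \<Rightarrow> real" where
  "gue_coord n X = (\<lambda>(i, j)\<in>gue_index n. if i = j then Re (X $$ (i, i))
     else if i < j then sqrt 2 * Re (X $$ (i, j)) else sqrt 2 * Im (X $$ (j, i)))"

lemma gue_entry_coord:
  assumes X: "X \<in> carrier_mat n n" "hermitian_mat X" and ij: "i < n" "j < n"
  shows "gue_entry n i j (gue_coord n X) = X $$ (i, j)"
proof -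
  have h: "X $$ (j, i) = cnj (X $$ (i, j))" by (rule hermitian_matD[OF X ij])
  consider "i = j" | "i < j" | "j < i" by linarith
  then show ?thesis
  proof cases
    case 1
    then have "Im (X $$ (i, i)) = 0" using arg_cong[OF h, of Im] by simp
    then show ?thesis unfolding gue_entry_eq[OF ij] using 1 ij by (simp add: gue_coord_def complex_eq_iff)
  next
    case 2
    then show ?thesis unfolding gue_entry_eq[OF ij] using ij by (simp add: gue_coord_def)
  next
    case 3
    then show ?thesis unfolding gue_entry_eq[OF ij] using ij h by (simp add: gue_coord_def complex_eq_iff)
  qed
qed

text \<open>The scalar \<open>c\<close> carries the normalisation of the matrix, while the loop
  equations remain in the unscaled coordinates.\<close>

lemma pow_mat_gue_power:
  assumes W: "W \<in> carrier_mat n n" "\<And>i j. i < n \<Longrightarrow> j < n \<Longrightarrow> W $$ (i, j) = c * gue_entry n i j x"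
    and "i < n" "j < n"
  shows "(W ^\<^sub>m k) $$ (i, j) = c ^ k * gue_power n k i j x"
  using assms(3,4)
proof (induction k arbitrary: j)
  case 0
  then show ?case using W(1) by simp
next
  case (Suc k)
  have P: "W ^\<^sub>m k \<in> carrier_mat n n" using W(1) by (rule pow_carrier_mat)
  have "(W ^\<^sub>m Suc k) $$ (i, j) = (\<Sum>l<n. (W ^\<^sub>m k) $$ (i, l) * W $$ (l, j))"
    using Suc.prems W(1) P by (simp add: scalar_prod_def atLeast0LessThan)
  also have "\<dots> = (\<Sum>l<n. (c ^ k * gue_power n k i l x) * (c * gue_entry n l j x))"
    using Suc W(2) by (intro sum.cong) auto
  finally show ?case by (simp add: sum_distrib_left mult_ac)
qed

lemma std_gauss_law:
  assumes "prob_space M" "distributed M lborel Y (normal_density 0 \<sigma>)" "\<sigma> > 0" "c * \<sigma> = 1" "B \<in> sets borel"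
  shows "measure M {\<omega> \<in> space M. c * Y \<omega> \<in> B} = measure std_gauss B"
proof -
  interpret prob_space M by fact
  have "c \<noteq> 0" using assms(4) by auto
  have "\<bar>c\<bar> * \<sigma> = 1" using assms(3,4) by (metis abs_mult abs_of_pos abs_one)
  then have d: "distributed M lborel (\<lambda>\<omega>. c * Y \<omega>) std_normal_density"
    using normal_density_affine[OF assms(2,3) \<open>c \<noteq> 0\<close>, of 0] by simp
  then have "distr M lborel (\<lambda>\<omega>. c * Y \<omega>) = std_gauss"
    unfolding std_gauss_def by (rule distributed_distr_eq_density)
  moreover have "(\<lambda>\<omega>. c * Y \<omega>) \<in> measurable M lborel"
    using distributed_measurable[OF d] .
  then have "measure (distr M lborel (\<lambda>\<omega>. c * Y \<omega>)) B = measure M ((\<lambda>\<omega>. c * Y \<omega>) -` B \<inter> space M)"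
    using assms(5) by (intro measure_distr) auto
  moreover have "(\<lambda>\<omega>. c * Y \<omega>) -` B \<inter> space M = {\<omega> \<in> space M. c * Y \<omega> \<in> B}" by auto
  ultimately show ?thesis by simp
qed

text \<open>A product measure is determined by its values on rectangles. A rectangle in the
  coordinates is an event on the entries on and above the diagonal; independence of these entries,
  then of the two parts of each, factorises its probability.\<close>

lemma GUE_coord_law:
  assumes G: "GUE n M X"
  shows "(\<lambda>\<omega>. gue_coord n (X \<omega>)) \<in> measurable M (gauss (gue_index n))"
    and "distr M (gauss (gue_index n)) (\<lambda>\<omega>. gue_coord n (X \<omega>)) = gauss (gue_index n)"
proof -
  let ?T = "\<lambda>\<omega>. gue_coord n (X \<omega>)"
  let ?U = "{(i, j). i \<le> j \<and> j < n}"
  interpret prob_space M using G unfolding GUE_def by blast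
  have ind: "indep_vars (\<lambda>_. borel) (\<lambda>(i, j) \<omega>. X \<omega> $$ (i, j)) ?U"
    using G unfolding GUE_def by blast
  have Xm: "(\<lambda>\<omega>. X \<omega> $$ (i, j)) \<in> borel_measurable M" if "i \<le> j" "j < n" for i j
    using ind that unfolding indep_vars_def2 by auto
  have Re_m: "(\<lambda>\<omega>. Re (X \<omega> $$ (i, j))) \<in> borel_measurable M"
    and Im_m: "(\<lambda>\<omega>. Im (X \<omega> $$ (i, j))) \<in> borel_measurable M" if "i \<le> j" "j < n" for i j
    using Xm[OF that] by (auto intro: measurable_compose[OF _ borel_measurable_Re] measurable_compose[OF _ borel_measurable_Im])
  have coord_m: "(\<lambda>\<omega>. ?T \<omega> \<alpha>) \<in> borel_measurable M" if mem: "\<alpha> \<in> gue_index n" for \<alpha>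
  proof -
    obtain i j where \<alpha>: "\<alpha> = (i, j)" "i < n" "j < n" using mem by (cases \<alpha>) auto
    consider "i = j" | "i < j" | "j < i" by linarith
    then show ?thesis
      unfolding \<alpha>(1) gue_coord_def using \<alpha> Re_m Im_m by cases (auto intro!: borel_measurable_times)
  qed
  show T: "?T \<in> measurable M (gauss (gue_index n))"
    unfolding gauss_def
  proof (rule measurable_PiM_single')
    show "(\<lambda>\<omega>. ?T \<omega> \<alpha>) \<in> measurable M std_gauss" if "\<alpha> \<in> gue_index n" for \<alpha>
      using coord_m[OF that] by (simp add: measurable_cong_sets[OF refl sets_std_gauss])
    show "?T \<in> space M \<rightarrow> (\<Pi>\<^sub>E \<alpha>\<in>gue_index n. space std_gauss)"
      by (auto simp: gue_coord_def)
  qed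
  show "distr M (gauss (gue_index n)) ?T = gauss (gue_index n)"
    unfolding gauss_def
  proof (rule std_gauss_product.PiM_eqI)
    fix B :: "nat \<times> nat \<Rightarrow> real set" assume B: "\<And>\<alpha>. \<alpha> \<in> gue_index n \<Longrightarrow> B \<alpha> \<in> sets std_gauss"
    have B': "B (i, j) \<in> sets borel" if "i < n" "j < n" for i j using B that by simp
    \<comment> \<open>All conditions concerning one entry of the matrix; off the diagonal these are
      the two sides with indices (i, j) and (j, i).\<close>
    define C where "C = (\<lambda>(i, j). {z. if i = j then Re z \<in> B (i, i) else sqrt 2 * Re z \<in> B (i, j) \<and> sqrt 2 * Im z \<in> B (j, i)})"
    have C: "C \<alpha> \<in> sets borel" if mem: "\<alpha> \<in> ?U" for \<alpha>
    proof -
      obtain i j where \<alpha>: "\<alpha> = (i, j)" "i \<le> j" "j < n" using mem by (cases \<alpha>) auto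
      have m: "(\<lambda>z :: complex. sqrt 2 * Re z) \<in> borel_measurable borel" "(\<lambda>z :: complex. sqrt 2 * Im z) \<in> borel_measurable borel"
        "Re \<in> borel_measurable borel" by (auto intro!: borel_measurable_times)
      have b: "B (i, i) \<in> sets borel" "B (i, j) \<in> sets borel" "B (j, i) \<in> sets borel" using B' \<alpha> by auto
      have "C \<alpha> = (if i = j then Re -` B (i, i) \<inter> space borel
         else ((\<lambda>z. sqrt 2 * Re z) -` B (i, j) \<inter> space borel) \<inter> ((\<lambda>z. sqrt 2 * Im z) -` B (j, i) \<inter> space borel))"
        unfolding C_def \<alpha>(1) by auto
      then show ?thesis using measurable_sets[OF m(1) b(2)] measurable_sets[OF m(2) b(3)] measurable_sets[OF m(3) b(1)] by auto
    qed
    have pre: "?T -` (\<Pi>\<^sub>E \<alpha>\<in>gue_index n. B \<alpha>) \<inter> space M = {\<omega> \<in> space M. \<forall>(i, j)\<in>?U. X \<omega> $$ (i, j) \<in> C (i, j)}"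
    proof -
      have "?T \<omega> \<in> (\<Pi>\<^sub>E \<alpha>\<in>gue_index n. B \<alpha>) \<longleftrightarrow> (\<forall>(i, j)\<in>?U. X \<omega> $$ (i, j) \<in> C (i, j))" for \<omega>
      proof
        assume *: "?T \<omega> \<in> (\<Pi>\<^sub>E \<alpha>\<in>gue_index n. B \<alpha>)"
        have t: "?T \<omega> (i, j) \<in> B (i, j)" if "i < n" "j < n" for i j
          using PiE_mem[OF *, of "(i, j)"] that by simp
        show "\<forall>(i, j)\<in>?U. X \<omega> $$ (i, j) \<in> C (i, j)"
        proof clarify
          fix i j assume ij: "i \<le> j" "j < n"
          then show "X \<omega> $$ (i, j) \<in> C (i, j)"
            using t[of i j] t[of j i] by (cases "i = j") (auto simp: gue_coord_def C_def)
        qed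
      next
        assume *: "\<forall>(i, j)\<in>?U. X \<omega> $$ (i, j) \<in> C (i, j)"
        have c: "X \<omega> $$ (i, j) \<in> C (i, j)" if "i \<le> j" "j < n" for i j using * that by auto
        show "?T \<omega> \<in> (\<Pi>\<^sub>E \<alpha>\<in>gue_index n. B \<alpha>)"
        proof (rule PiE_I)
          fix \<alpha> assume "\<alpha> \<in> gue_index n"
          then obtain i j where \<alpha>: "\<alpha> = (i, j)" "i < n" "j < n" by (cases \<alpha>) auto
          consider "i = j" | "i < j" | "j < i" by linarith
          then show "?T \<omega> \<alpha> \<in> B \<alpha>"
            using c[of i j] c[of j i] \<alpha> by cases (auto simp: gue_coord_def C_def)
        qed (simp add: gue_coord_def)
      qed
      then show ?thesis by auto
    qed
    have fac: "prob {\<omega> \<in> space M. X \<omega> $$ (i, j) \<in> C (i, j)} =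
      (if i = j then measure std_gauss (B (i, i)) else measure std_gauss (B (i, j)) * measure std_gauss (B (j, i)))"
      if "i \<le> j" "j < n" for i j
    proof (cases "i = j")
      case True
      have "distributed M lborel (\<lambda>\<omega>. Re (X \<omega> $$ (i, i))) std_normal_density"
        using G that True unfolding GUE_def by blast
      from std_gauss_law[OF prob_space_axioms this, of 1 "B (i, i)"] show ?thesis
        using True that B' by (simp add: C_def)
    next
      case False
      then have "i < j" using that by simp
      then have indep: "indep_var borel (\<lambda>\<omega>. Re (X \<omega> $$ (i, j))) borel (\<lambda>\<omega>. Im (X \<omega> $$ (i, j)))"
        and d: "distributed M lborel (\<lambda>\<omega>. Re (X \<omega> $$ (i, j))) (normal_density 0 (sqrt (1 / 2)))"
          "distributed M lborel (\<lambda>\<omega>. Im (X \<omega> $$ (i, j))) (normal_density 0 (sqrt (1 / 2)))"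
        using G that unfolding GUE_def by blast+
      \<comment> \<open>Multiplication by \<open>sqrt 2\<close> turns standard deviation
        \<open>sqrt (1 / 2)\<close> into 1.\<close>
      have s: "sqrt 2 * sqrt (1 / 2) = 1" by (simp flip: real_sqrt_mult)
      let ?p = "\<lambda>B. {y. sqrt 2 * y \<in> B}"
      have p: "?p B' \<in> sets borel" if "B' \<in> sets borel" for B'
      proof -
        have "(\<lambda>y. sqrt 2 * y) \<in> borel_measurable borel" by (auto intro!: borel_measurable_times)
        from measurable_sets[OF this that] show ?thesis by (simp add: vimage_def)
      qed
      have b: "B (i, j) \<in> sets borel" "B (j, i) \<in> sets borel" using B' that by auto
      have "prob {\<omega> \<in> space M. X \<omega> $$ (i, j) \<in> C (i, j)}
        = prob ((\<lambda>\<omega>. (Re (X \<omega> $$ (i, j)), Im (X \<omega> $$ (i, j)))) -` (?p (B (i, j)) \<times> ?p (B (j, i))) \<inter> space M)"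
        using False by (intro arg_cong[where f = prob]) (auto simp: C_def)
      also have "\<dots> = prob ((\<lambda>\<omega>. Re (X \<omega> $$ (i, j))) -` ?p (B (i, j)) \<inter> space M) * prob ((\<lambda>\<omega>. Im (X \<omega> $$ (i, j))) -` ?p (B (j, i)) \<inter> space M)"
        by (rule indep_varD[OF indep p[OF b(1)] p[OF b(2)]])
      also have "(\<lambda>\<omega>. Re (X \<omega> $$ (i, j))) -` ?p (B (i, j)) \<inter> space M = {\<omega> \<in> space M. sqrt 2 * Re (X \<omega> $$ (i, j)) \<in> B (i, j)}" by auto
      also have "(\<lambda>\<omega>. Im (X \<omega> $$ (i, j))) -` ?p (B (j, i)) \<inter> space M = {\<omega> \<in> space M. sqrt 2 * Im (X \<omega> $$ (i, j)) \<in> B (j, i)}" by auto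
      finally show ?thesis
        using std_gauss_law[OF prob_space_axioms d(1) _ s b(1)] std_gauss_law[OF prob_space_axioms d(2) _ s b(2)] False by simp
    qed
    have "emeasure (distr M (Pi\<^sub>M (gue_index n) (\<lambda>_. std_gauss)) ?T) (\<Pi>\<^sub>E \<alpha>\<in>gue_index n. B \<alpha>)
      = emeasure M (?T -` (\<Pi>\<^sub>E \<alpha>\<in>gue_index n. B \<alpha>) \<inter> space M)"
      using T B unfolding gauss_def by (intro emeasure_distr sets_PiM_I_finite) auto
    also have "\<dots> = ennreal (prob {\<omega> \<in> space M. \<forall>(i, j)\<in>?U. X \<omega> $$ (i, j) \<in> C (i, j)})"
      unfolding pre by (simp add: emeasure_eq_measure)
    also have "prob {\<omega> \<in> space M. \<forall>(i, j)\<in>?U. X \<omega> $$ (i, j) \<in> C (i, j)} = (\<Prod>(i, j)\<in>?U. prob {\<omega> \<in> space M. X \<omega> $$ (i, j) \<in> C (i, j)})"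
    \<comment> \<open>The product rule for independent families is applied to a nonempty index set,
      so the empty matrix is treated apart.\<close>
    proof (cases "n = 0")
      case True
      then show ?thesis by (simp add: prob_space)
    next
      case False
      have fin: "finite ?U" by (rule finite_subset[of _ "{..<n} \<times> {..<n}"]) auto
      have ne: "?U \<noteq> {}" using False by (auto intro!: exI[of _ 0])
      have "prob (\<Inter>\<alpha>\<in>?U. (case \<alpha> of (i, j) \<Rightarrow> \<lambda>\<omega>. X \<omega> $$ (i, j)) -` C \<alpha> \<inter> space M)
         = (\<Prod>\<alpha>\<in>?U. prob ((case \<alpha> of (i, j) \<Rightarrow> \<lambda>\<omega>. X \<omega> $$ (i, j)) -` C \<alpha> \<inter> space M))"
        by (rule indep_varsD_finite[OF ind ne fin C])
      moreover have "(\<Inter>\<alpha>\<in>?U. (case \<alpha> of (i, j) \<Rightarrow> \<lambda>\<omega>. X \<omega> $$ (i, j)) -` C \<alpha> \<inter> space M)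
        = {\<omega> \<in> space M. \<forall>(i, j)\<in>?U. X \<omega> $$ (i, j) \<in> C (i, j)}" using ne by auto
      moreover have "(case \<alpha> of (i, j) \<Rightarrow> \<lambda>\<omega>. X \<omega> $$ (i, j)) -` C \<alpha> \<inter> space M
        = (case \<alpha> of (i, j) \<Rightarrow> {\<omega> \<in> space M. X \<omega> $$ (i, j) \<in> C (i, j)})" for \<alpha> by (cases \<alpha>) auto
      ultimately show ?thesis by (simp add: case_prod_unfold)
    qed
    also have "\<dots> = (\<Prod>(i, j)\<in>?U. if i = j then measure std_gauss (B (i, i)) else measure std_gauss (B (i, j)) * measure std_gauss (B (j, i)))"
      using fac by (intro prod.cong) auto
    also have "\<dots> = (\<Prod>\<alpha>\<in>gue_index n. measure std_gauss (B \<alpha>))" by (rule prod_square_split[symmetric])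
    also have "ennreal \<dots> = (\<Prod>\<alpha>\<in>gue_index n. emeasure std_gauss (B \<alpha>))"
      by (simp add: prod_ennreal std_gauss.emeasure_eq_measure)
    finally show "emeasure (distr M (Pi\<^sub>M (gue_index n) (\<lambda>_. std_gauss)) ?T) (\<Pi>\<^sub>E \<alpha>\<in>gue_index n. B \<alpha>)
      = (\<Prod>\<alpha>\<in>gue_index n. emeasure std_gauss (B \<alpha>))" .
  qed auto
qed

subsection \<open>Eigenvalue counts of the GUE\<close>

lemma hermitian_matI:
  assumes "A \<in> carrier_mat n n" "\<And>i j. i < n \<Longrightarrow> j < n \<Longrightarrow> A $$ (j, i) = cnj (A $$ (i, j))"
  shows "hermitian_mat A"
proof -
  have "mat_adjoint A = A"
  proof (rule eq_matI)
    fix i j assume ij: "i < dim_row A" "j < dim_col A"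
    then have "mat_adjoint A $$ (i, j) = cnj (A $$ (j, i))"
      using assms(1) by (simp add: mat_adjoint_def mat_of_rows_def)
    then show "mat_adjoint A $$ (i, j) = A $$ (i, j)"
      using assms(2)[of j i] ij assms(1) by simp
  qed (use assms(1) in \<open>simp_all add: mat_adjoint_def mat_of_rows_def\<close>)
  then show ?thesis using assms(1) by (auto simp: hermitian_mat_def)
qed

lemma norm_gue_basis_le: "cmod (gue_basis \<alpha> i j) \<le> 1"
proof (cases \<alpha>)
  case (Pair a b)
  have norm_if: "cmod x \<le> 1 \<Longrightarrow> cmod y \<le> 1 \<Longrightarrow> cmod (if b then x else y) \<le> 1" for b x y
    by simp
  show ?thesis unfolding Pair gue_basis_def prod.case
    by (intro norm_if) (simp_all add: norm_divide)
qed

lemma norm_gue_entry_le: "cmod (gue_entry n i j x) \<le> (\<Sum>\<alpha>\<in>gue_index n. \<bar>x \<alpha>\<bar>)"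
  unfolding gue_entry_def
proof (rule sum_norm_le)
  fix \<alpha>
  show "cmod (complex_of_real (x \<alpha>) * gue_basis \<alpha> i j) \<le> \<bar>x \<alpha>\<bar>"
    using mult_left_mono[OF norm_gue_basis_le[of \<alpha> i j], of "\<bar>x \<alpha>\<bar>"] by (simp add: norm_mult)
qed

text \<open>The trace of the square is the sum of the squared eigenvalues, so this provides a
  measurable bound on the spectrum.\<close>

lemma norm_gue_trace_2_le: "cmod (gue_trace n 2 x) \<le> (real n * (\<Sum>\<alpha>\<in>gue_index n. \<bar>x \<alpha>\<bar>))\<^sup>2"
proof -
  let ?S = "\<Sum>\<alpha>\<in>gue_index n. \<bar>x \<alpha>\<bar>"
  have one: "gue_power n (Suc 0) i l x = gue_entry n i l x" if "i < n" for i l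
    using that by (simp add: if_distrib[of "\<lambda>z. z * _"] sum.delta' cong: if_cong)
  have "gue_trace n 2 x = (\<Sum>i<n. \<Sum>l<n. gue_entry n i l x * gue_entry n l i x)"
    unfolding gue_trace_def numeral_2_eq_2 gue_power.simps(2)[of n "Suc 0"]
    by (intro sum.cong refl) (simp only: one lessThan_iff)
  also have "cmod \<dots> \<le> (\<Sum>i<n. \<Sum>l<n. ?S * ?S)"
    by (intro sum_norm_le) (auto simp: norm_mult intro!: mult_mono norm_gue_entry_le sum_nonneg)
  finally show ?thesis by (simp add: power2_eq_square mult_ac)
qed

lemma sq_vandermonde_real: "complex_of_real (Re (sq_vandermonde n x)) = sq_vandermonde n x"
proof -
  have "sq_vandermonde n x = complex_of_real (\<Prod>j<n. \<Prod>i<j. (x j - x i)\<^sup>2)"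
    by (simp add: sq_vandermonde_def)
  then show ?thesis by simp
qed

lemma prod_list_mult_distrib:
  fixes f g :: "'b \<Rightarrow> 'a::comm_monoid_mult"
  shows "(\<Prod>k\<leftarrow>ks. f k * g k) = (\<Prod>k\<leftarrow>ks. f k) * (\<Prod>k\<leftarrow>ks. g k)"
  by (induction ks) (simp_all add: mult_ac)

lemma of_real_prod_list: "complex_of_real (\<Prod>k\<leftarrow>ks. f k) = (\<Prod>k\<leftarrow>ks. complex_of_real (f k))"
  by (induction ks) simp_all

lemma gauss_sum_abs_measurable: "(\<lambda>x. \<Sum>\<alpha>\<in>A. \<bar>x \<alpha>\<bar>) \<in> borel_measurable (gauss A)"
  by (intro borel_measurable_sum borel_measurable_abs gauss_coord_measurable)

text \<open>The spectrum with weight 1 and the scaled Coulomb points with the normalised Vandermonde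
  weight form two matched configurations, so the count inherits the generating function of the gas.
  The scale \<open>c\<close> is arbitrary; for \<open>n = 0\<close> the value
  \<open>1 / sqrt 0\<close> is zero.\<close>

lemma GUE_count_pgf:
  fixes c :: real
  assumes G: "GUE n M X" and J: "is_interval J"
  defines "K \<equiv> \<lambda>\<omega>. eigenvalue_count J (complex_of_real c \<cdot>\<^sub>m X \<omega>)"
  shows "(\<lambda>\<omega>. real (K \<omega>)) \<in> borel_measurable M"
    and "\<And>\<omega>. \<omega> \<in> space M \<Longrightarrow> K \<omega> \<le> n"
    and "\<exists>(d :: nat) (p :: nat \<Rightarrow> real). (\<forall>i<d. 0 \<le> p i \<and> p i \<le> 1) \<and>
      (\<forall>z :: real. (LINT \<omega>|M. z ^ K \<omega>) = (\<Prod>i<d. 1 - p i + p i * z))"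
proof -
  interpret M: prob_space M using G unfolding GUE_def by blast
  let ?W = "\<lambda>\<omega>. complex_of_real c \<cdot>\<^sub>m X \<omega>"
  let ?T = "\<lambda>\<omega>. gue_coord n (X \<omega>)"
  let ?A = "gue_index n"
  let ?S = "\<lambda>x :: nat \<times> nat \<Rightarrow> real. \<Sum>\<alpha>\<in>?A. \<bar>x \<alpha>\<bar>"
  have X: "X \<omega> \<in> carrier_mat n n" "hermitian_mat (X \<omega>)" if "\<omega> \<in> space M" for \<omega>
    using G that unfolding GUE_def by auto
  note T = GUE_coord_law(1)[OF G] and law = GUE_coord_law(2)[OF G]
  have W: "?W \<omega> \<in> carrier_mat n n" "hermitian_mat (?W \<omega>)"
    "\<And>i j. i < n \<Longrightarrow> j < n \<Longrightarrow> ?W \<omega> $$ (i, j) = complex_of_real c * gue_entry n i j (?T \<omega>)" if "\<omega> \<in> space M" for \<omega>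
  proof -
    show W1: "?W \<omega> \<in> carrier_mat n n" using X(1)[OF that] by simp
    have e: "?W \<omega> $$ (i, j) = complex_of_real c * X \<omega> $$ (i, j)" if "i < n" "j < n" for i j
      using that X(1)[OF \<open>\<omega> \<in> space M\<close>] by simp
    show "hermitian_mat (?W \<omega>)"
    proof (rule hermitian_matI[OF W1])
      fix i j assume "i < n" "j < n"
      then show "?W \<omega> $$ (j, i) = cnj (?W \<omega> $$ (i, j))"
        using hermitian_matD[OF X[OF that], of i j] by (simp only: e complex_cnj_mult complex_cnj_complex_of_real)
    qed
    show "?W \<omega> $$ (i, j) = complex_of_real c * gue_entry n i j (?T \<omega>)" if "i < n" "j < n" for i j
      unfolding e[OF that] gue_entry_coord[OF X[OF \<open>\<omega> \<in> space M\<close>] that] ..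
  qed
  define spectrum_of where "spectrum_of \<omega> l \<longleftrightarrow>
      (\<forall>J. eigenvalue_count J (?W \<omega>) = card {i. i < n \<and> l i \<in> J}) \<and>
      (\<forall>k. (\<Sum>i<n. (?W \<omega> ^\<^sub>m k) $$ (i, i)) = complex_of_real (\<Sum>i<n. l i ^ k))"
    for \<omega> and l :: "nat \<Rightarrow> real"
  have "\<forall>\<omega>\<in>space M. \<exists>l. spectrum_of \<omega> l"
    unfolding spectrum_of_def by (intro ballI hermitian_spectrum W)
  \<comment> \<open>A choice of one eigenvalue list per outcome, without any measurability in the
    outcome.\<close>
  then obtain l where l: "\<And>\<omega>. \<omega> \<in> space M \<Longrightarrow> spectrum_of \<omega> (l \<omega>)" by metis
  have count: "K \<omega> = card {i. i < n \<and> l \<omega> i \<in> J}" if "\<omega> \<in> space M" for \<omega>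
    using l[OF that] unfolding K_def spectrum_of_def by blast
  have pow: "complex_of_real (lin_stat n l (\<lambda>x. x ^ k) \<omega>) = complex_of_real (c ^ k) * gue_trace n k (?T \<omega>)"
    if "\<omega> \<in> space M" for \<omega> k
  proof -
    have "complex_of_real (lin_stat n l (\<lambda>x. x ^ k) \<omega>) = (\<Sum>i<n. (?W \<omega> ^\<^sub>m k) $$ (i, i))"
      using l[OF that] unfolding lin_stat_def spectrum_of_def by metis
    also have "\<dots> = (\<Sum>i<n. complex_of_real c ^ k * gue_power n k i i (?T \<omega>))"
      by (intro sum.cong refl pow_mat_gue_power[OF W(1,3)[OF that]]) auto
    finally show ?thesis by (simp add: gue_trace_def sum_distrib_left)
  qed
  have pow': "complex_of_real (lin_stat n (\<lambda>x i. c * x i) (\<lambda>x. x ^ k) x) = complex_of_real (c ^ k) * power_sum n k x" for k x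
    by (simp add: lin_stat_def power_sum_def power_mult_distrib sum_distrib_left)
  have P: "point_config M (\<lambda>_. 1) n l (\<lambda>\<omega>. \<bar>c\<bar> * (real n * ?S (?T \<omega>)))"
  proof
    show "(\<lambda>\<omega>. \<bar>c\<bar> * (real n * ?S (?T \<omega>))) \<in> borel_measurable M"
      by (intro borel_measurable_times borel_measurable_const measurable_compose[OF T gauss_sum_abs_measurable])
    show "0 \<le> \<bar>c\<bar> * (real n * ?S (?T \<omega>))" for \<omega> by (auto intro!: mult_nonneg_nonneg sum_nonneg)
    show "\<bar>l \<omega> i\<bar> \<le> \<bar>c\<bar> * (real n * ?S (?T \<omega>))" if \<omega>: "\<omega> \<in> space M" and i: "i < n" for \<omega> i
    proof (rule power2_le_imp_le)
      \<comment> \<open>A single squared eigenvalue is at most the trace of the squared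
        matrix.\<close>
      have "\<bar>l \<omega> i\<bar>\<^sup>2 \<le> lin_stat n l (\<lambda>x. x ^ 2) \<omega>"
        unfolding lin_stat_def power2_abs using i by (intro member_le_sum) auto
      also have "\<dots> \<le> cmod (complex_of_real (lin_stat n l (\<lambda>x. x ^ 2) \<omega>))" by simp
      also have "\<dots> = c\<^sup>2 * cmod (gue_trace n 2 (?T \<omega>))" unfolding pow[OF \<omega>] by (simp add: norm_mult norm_power)
      also have "\<dots> \<le> c\<^sup>2 * (real n * ?S (?T \<omega>))\<^sup>2" by (intro mult_left_mono norm_gue_trace_2_le) auto
      finally show "\<bar>l \<omega> i\<bar>\<^sup>2 \<le> (\<bar>c\<bar> * (real n * ?S (?T \<omega>)))\<^sup>2" by (simp add: power_mult_distrib)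
    qed (auto intro!: mult_nonneg_nonneg sum_nonneg)
    show "integrable M (\<lambda>\<omega>. 1 * exp (R * (\<bar>c\<bar> * (real n * ?S (?T \<omega>)))))" for R
    proof -
      have "integrable (distr M (gauss ?A) ?T) (\<lambda>x. exp (R * \<bar>c\<bar> * real n * ?S x))"
        unfolding law by (intro integrable_gauss_exp) simp
      then have "integrable M (\<lambda>\<omega>. exp (R * \<bar>c\<bar> * real n * ?S (?T \<omega>)))"
        by (rule integrable_distr[OF T])
      then show ?thesis by (simp only: mult.assoc mult_1_left)
    qed
    show "lin_stat n l (\<lambda>x. x ^ k) \<in> borel_measurable M" for k
    proof -
      have "(\<lambda>\<omega>. Re (complex_of_real (c ^ k) * gue_trace n k (?T \<omega>))) \<in> borel_measurable M"
        by (rule measurable_compose[OF T], rule measurable_compose[OF _ borel_measurable_Re])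
          (intro poly_fun_measurable poly_fun_mult poly_fun_const poly_fun_gue_trace)
      moreover have "lin_stat n l (\<lambda>x. x ^ k) \<omega> = Re (complex_of_real (c ^ k) * gue_trace n k (?T \<omega>))" if "\<omega> \<in> space M" for \<omega>
        unfolding pow[OF that, symmetric] by simp
      ultimately show ?thesis by (subst measurable_cong) auto
    qed
  qed simp
  \<comment> \<open>The scaling is moved from the points to the set, which is where the generating
    function of the unscaled gas is available.\<close>
  define B where "B = {t. c * t \<in> J}"
  have B: "B \<in> sets borel"
  proof -
    have "(\<lambda>t. c * t) \<in> borel_measurable borel" by (intro borel_measurable_times borel_measurable_const) simp
    from measurable_sets[OF this, of J] show ?thesis
      using real_interval_borel_measurable[OF J] by (simp add: B_def vimage_def)
  qed
  let ?Zc = "LINT x|gauss {..<n}. sq_vandermonde n x"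
  define Z where "Z = Re ?Zc"
  obtain d :: nat and p :: "nat \<Rightarrow> real" where Z0: "?Zc \<noteq> 0" and p: "\<forall>i<d. 0 \<le> p i \<and> p i \<le> 1"
    and pgf: "\<And>z :: real. (LINT x|gauss {..<n}. sq_vandermonde n x * complex_of_real z ^ card {i. i < n \<and> x i \<in> B})
        = ?Zc * complex_of_real (\<Prod>i<d. 1 - p i + p i * z)"
    using coulomb_count_pgf[OF B, of n] by blast
  have Z: "complex_of_real Z = ?Zc"
  proof -
    have "?Zc = (LINT x|gauss {..<n}. complex_of_real (Re (sq_vandermonde n x)))"
      unfolding sq_vandermonde_real ..
    then have "?Zc = complex_of_real (LINT x|gauss {..<n}. Re (sq_vandermonde n x))"
      unfolding integral_complex_of_real .
    then show ?thesis unfolding Z_def by (metis Re_complex_of_real)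
  qed
  have Z_ne: "Z \<noteq> 0" using Z0 Z by auto
  \<comment> \<open>Configurations carry real weights, so the real part of the Vandermonde factor is
    taken and divided by its total mass.\<close>
  let ?w = "\<lambda>x. Re (sq_vandermonde n x) / Z"
  have w_c: "complex_of_real (?w x) = sq_vandermonde n x / ?Zc" for x
    unfolding of_real_divide sq_vandermonde_real Z ..
  have Q: "point_config (gauss {..<n}) ?w n (\<lambda>x i. c * x i) (\<lambda>x. \<bar>c\<bar> * (\<Sum>i<n. \<bar>x i\<bar>))"
  proof
    have wm: "(\<lambda>x. Re (sq_vandermonde n x)) \<in> borel_measurable (gauss {..<n})"
      by (rule measurable_compose[OF poly_fun_measurable[OF poly_fun_sq_vandermonde] borel_measurable_Re])
    then show w: "?w \<in> borel_measurable (gauss {..<n})" by (intro borel_measurable_divide borel_measurable_const)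
    show b: "(\<lambda>x. \<bar>c\<bar> * (\<Sum>i<n. \<bar>x i\<bar>)) \<in> borel_measurable (gauss {..<n})"
      by (intro borel_measurable_times borel_measurable_const gauss_sum_abs_measurable)
    show "0 \<le> \<bar>c\<bar> * (\<Sum>i<n. \<bar>x i\<bar>)" for x :: "nat \<Rightarrow> real" by (auto intro!: mult_nonneg_nonneg sum_nonneg)
    show "\<bar>c * x i\<bar> \<le> \<bar>c\<bar> * (\<Sum>i<n. \<bar>x i\<bar>)" if "i < n" for x :: "nat \<Rightarrow> real" and i
      unfolding abs_mult using that by (intro mult_left_mono member_le_sum) auto
    show "integrable (gauss {..<n}) (\<lambda>x. ?w x * exp (R * (\<bar>c\<bar> * (\<Sum>i<n. \<bar>x i\<bar>))))" for R
    proof -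
      obtain C R' where C: "C \<ge> 0" "\<And>x. cmod (sq_vandermonde n x) \<le> C * exp (R' * (\<Sum>i<n. \<bar>x i\<bar>))"
        using poly_fun_growth[OF poly_fun_sq_vandermonde, of n] by auto
      have "integrable (gauss {..<n}) (\<lambda>x. (C / \<bar>Z\<bar>) * exp ((R' + R * \<bar>c\<bar>) * (\<Sum>i<n. \<bar>x i\<bar>)))"
        by (intro integrable_mult_right integrable_gauss_exp) simp
      then show ?thesis
      proof (rule Bochner_Integration.integrable_bound)
        have em: "(\<lambda>x. exp (R * (\<bar>c\<bar> * (\<Sum>i<n. \<bar>x i\<bar>)))) \<in> borel_measurable (gauss {..<n})"
          by (rule measurable_compose[OF _ borel_measurable_exp])
            (intro borel_measurable_times borel_measurable_const gauss_sum_abs_measurable)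
        show "(\<lambda>x. ?w x * exp (R * (\<bar>c\<bar> * (\<Sum>i<n. \<bar>x i\<bar>)))) \<in> borel_measurable (gauss {..<n})"
          by (rule borel_measurable_times[OF w em])
        show "AE x in gauss {..<n}. norm (?w x * exp (R * (\<bar>c\<bar> * (\<Sum>i<n. \<bar>x i\<bar>))))
          \<le> norm ((C / \<bar>Z\<bar>) * exp ((R' + R * \<bar>c\<bar>) * (\<Sum>i<n. \<bar>x i\<bar>)))"
        proof (rule AE_I2)
          fix x :: "nat \<Rightarrow> real"
          let ?s = "\<Sum>i<n. \<bar>x i\<bar>"
          have "\<bar>?w x\<bar> = cmod (sq_vandermonde n x) / \<bar>Z\<bar>"
            by (metis abs_divide norm_of_real sq_vandermonde_real)
          also have "\<dots> \<le> C * exp (R' * ?s) / \<bar>Z\<bar>" using C(2)[of x] by (intro divide_right_mono) auto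
          finally have "\<bar>?w x\<bar> * exp (R * (\<bar>c\<bar> * ?s)) \<le> C * exp (R' * ?s) / \<bar>Z\<bar> * exp (R * (\<bar>c\<bar> * ?s))"
            by (intro mult_right_mono) auto
          also have "\<dots> = (C / \<bar>Z\<bar>) * exp ((R' + R * \<bar>c\<bar>) * ?s)"
            by (simp add: distrib_right exp_add mult.assoc)
          finally show "norm (?w x * exp (R * (\<bar>c\<bar> * ?s))) \<le> norm ((C / \<bar>Z\<bar>) * exp ((R' + R * \<bar>c\<bar>) * ?s))"
            using C(1) by (simp add: abs_mult)
        qed
      qed
    qed
    show "lin_stat n (\<lambda>x i. c * x i) (\<lambda>x. x ^ k) \<in> borel_measurable (gauss {..<n})" for k
    proof -
      have "(\<lambda>x. Re (complex_of_real (c ^ k) * power_sum n k x)) \<in> borel_measurable (gauss {..<n})"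
        by (rule measurable_compose[OF _ borel_measurable_Re])
          (intro poly_fun_measurable poly_fun_mult poly_fun_const poly_fun_power_sum)
      moreover have "lin_stat n (\<lambda>x i. c * x i) (\<lambda>x. x ^ k) = (\<lambda>x. Re (complex_of_real (c ^ k) * power_sum n k x))"
        unfolding pow'[symmetric] by simp
      ultimately show ?thesis by simp
    qed
  qed
  have moments: "(LINT \<omega>|M. 1 * (\<Prod>k\<leftarrow>ks. lin_stat n l (\<lambda>x. x ^ k) \<omega>))
    = (LINT x|gauss {..<n}. ?w x * (\<Prod>k\<leftarrow>ks. lin_stat n (\<lambda>x i. c * x i) (\<lambda>x. x ^ k) x))" for ks
  proof -
    let ?L = "\<lambda>\<omega>. \<Prod>k\<leftarrow>ks. lin_stat n l (\<lambda>x. x ^ k) \<omega>"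
    let ?R = "\<lambda>x. \<Prod>k\<leftarrow>ks. lin_stat n (\<lambda>x i. c * x i) (\<lambda>x. x ^ k) x"
    let ?t = "\<lambda>x. \<Prod>k\<leftarrow>ks. gue_trace n k x"
    let ?C = "\<Prod>k\<leftarrow>ks. complex_of_real (c ^ k)"
    have "complex_of_real (LINT \<omega>|M. 1 * ?L \<omega>)
      = (LINT \<omega>|M. complex_of_real (?L \<omega>))"
      unfolding integral_complex_of_real by simp
    also have "\<dots> = (LINT \<omega>|M. ?C * ?t (?T \<omega>))"
      by (intro Bochner_Integration.integral_cong refl) (simp only: of_real_prod_list pow prod_list_mult_distrib)
    also have "\<dots> = ?C * (LINT \<omega>|M. ?t (?T \<omega>))"
      by (rule integral_mult_right_zero)
    also have "(LINT \<omega>|M. ?t (?T \<omega>)) = (LINT x|distr M (gauss ?A) ?T. ?t x)"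
      by (rule integral_distr[symmetric, OF T]) (intro poly_fun_measurable poly_fun_prod_list poly_fun_gue_trace)
    also have "\<dots> = (LINT x|gauss ?A. ?t x)" unfolding law ..
    finally have lhs: "complex_of_real (LINT \<omega>|M. 1 * ?L \<omega>)
      = ?C * (LINT x|gauss ?A. ?t x)" .
    have "complex_of_real (LINT x|gauss {..<n}. ?w x * ?R x)
      = (LINT x|gauss {..<n}. complex_of_real (?w x * ?R x))"
      unfolding integral_complex_of_real ..
    also have "\<dots> = (LINT x|gauss {..<n}. (?C / ?Zc) * (sq_vandermonde n x * (\<Prod>k\<leftarrow>ks. power_sum n k x)))"
      unfolding of_real_mult of_real_prod_list pow' prod_list_mult_distrib w_c
      by (intro Bochner_Integration.integral_cong refl) (simp add: field_simps)
    also have "\<dots> = (?C / ?Zc) * (LINT x|gauss {..<n}. sq_vandermonde n x * (\<Prod>k\<leftarrow>ks. power_sum n k x))"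
      by (rule integral_mult_right_zero)
    also have "\<dots> = ?C * (LINT x|gauss ?A. ?t x)"
      unfolding coulomb_moments_eq_gue_moments using Z0 by simp
    finally have "complex_of_real (LINT x|gauss {..<n}. ?w x * ?R x)
      = complex_of_real (LINT \<omega>|M. 1 * ?L \<omega>)"
      unfolding lhs .
    then show ?thesis unfolding of_real_eq_iff by (rule sym)
  qed
  interpret moment_matching M "\<lambda>_. 1" n l "\<lambda>\<omega>. \<bar>c\<bar> * (real n * ?S (?T \<omega>))"
      "gauss {..<n}" ?w "\<lambda>x i. c * x i" "\<lambda>x. \<bar>c\<bar> * (\<Sum>i<n. \<bar>x i\<bar>)"
    by (rule moment_matching.intro[OF P Q], rule moment_matching_axioms.intro, rule moments)
  show "(\<lambda>\<omega>. real (K \<omega>)) \<in> borel_measurable M"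
    using count_distribution(2)[OF J] by (subst measurable_cong[OF arg_cong[where f = real, OF count]])
  show "K \<omega> \<le> n" if "\<omega> \<in> space M" for \<omega>
    unfolding count[OF that] using card_mono[of "{..<n}" "{i. i < n \<and> l \<omega> i \<in> J}"] by auto
  have main: "(LINT \<omega>|M. z ^ K \<omega>) = (\<Prod>i<d. 1 - p i + p i * z)" for z :: real
  proof -
    have "(LINT \<omega>|M. z ^ K \<omega>) = (LINT \<omega>|M. 1 * z ^ card {i. i < n \<and> l \<omega> i \<in> J})"
      by (intro Bochner_Integration.integral_cong) (auto simp: count)
    also have "\<dots> = (LINT x|gauss {..<n}. ?w x * z ^ card {i. i < n \<and> c * x i \<in> J})"
      by (rule count_distribution(1)[OF J, of "\<lambda>k. z ^ k"])
    finally have "complex_of_real (LINT \<omega>|M. z ^ K \<omega>)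
      = (LINT x|gauss {..<n}. complex_of_real (?w x * z ^ card {i. i < n \<and> c * x i \<in> J}))"
      unfolding integral_complex_of_real by simp
    also have "\<dots> = (LINT x|gauss {..<n}. (1 / ?Zc) * (sq_vandermonde n x * complex_of_real z ^ card {i. i < n \<and> x i \<in> B}))"
      unfolding of_real_mult w_c by (simp add: B_def)
    also have "\<dots> = (1 / ?Zc) * (?Zc * complex_of_real (\<Prod>i<d. 1 - p i + p i * z))"
      unfolding integral_mult_right_zero pgf ..
    also have "\<dots> = complex_of_real (\<Prod>i<d. 1 - p i + p i * z)" using Z0 by simp
    finally show ?thesis by (simp only: of_real_eq_iff)
  qed
  show "\<exists>(d :: nat) (p :: nat \<Rightarrow> real). (\<forall>i<d. 0 \<le> p i \<and> p i \<le> 1) \<and>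
      (\<forall>z :: real. (LINT \<omega>|M. z ^ K \<omega>) = (\<Prod>i<d. 1 - p i + p i * z))"
    by (rule exI[of _ d], rule exI[of _ p], rule conjI[OF p], rule allI, rule main)
qed

text \<open>The exponent \<open>t * a^2 * Z\<close> equals \<open>s * (N - E)\<close> with
  \<open>s = t * a / sqrt V\<close>, which tends to zero. The quadratic part
  \<open>s^2 * V / 2\<close> is exactly \<open>t^2 * a^2 / 2\<close>, and the error
  \<open>exp 1 * \<bar>s\<bar>^3 * V\<close> divided by \<open>a^2\<close> is
  \<open>exp 1 * \<bar>t\<bar>^3 * \<bar>a\<bar> / sqrt V\<close>.\<close>

theorem theorem1p1:
  fixes M :: "nat \<Rightarrow> 'a measure"
    and X W :: "nat \<Rightarrow> 'a \<Rightarrow> complex mat"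
    and J :: "nat \<Rightarrow> real set"
    and N :: "nat \<Rightarrow> 'a \<Rightarrow> real"
    and E V a :: "nat \<Rightarrow> real"
  assumes GUE: "\<And>n. GUE n (M n) (X n)"
    and W: "\<And>n \<omega>. W n \<omega> = complex_of_real (1 / sqrt (real n)) \<cdot>\<^sub>m X n \<omega>"
    and interval: "\<And>n. is_interval (J n)"
    and N: "\<And>n \<omega>. N n \<omega> = real (eigenvalue_count (J n) (W n \<omega>))"
    and E: "\<And>n. E n = prob_space.expectation (M n) (N n)"
    and V: "\<And>n. V n = prob_space.variance (M n) (N n)"
    and V_infinity: "filterlim V at_top sequentially"
    and a_lower: "much_less (\<lambda>_. 1) a"
    and a_upper: "much_less a (\<lambda>n. sqrt (V n))"
  shows "satisfies_MDP M (\<lambda>n \<omega>. (N n \<omega> - E n) / (a n * sqrt (V n)))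
           (\<lambda>n. (a n)\<^sup>2) (\<lambda>x. x\<^sup>2 / 2)"
proof -
  have prob: "prob_space (M n)" for n using GUE[of n] unfolding GUE_def by blast
  define K where "K n \<omega> = eigenvalue_count (J n) (complex_of_real (1 / sqrt (real n)) \<cdot>\<^sub>m X n \<omega>)" for n \<omega>
  have NK: "N n = (\<lambda>\<omega>. real (K n \<omega>))" for n unfolding K_def N W ..
  have N_meas: "N n \<in> borel_measurable (M n)" for n
    unfolding NK K_def by (rule GUE_count_pgf(1)[OF GUE interval])
  have K_le: "K n \<omega> \<le> n" if "\<omega> \<in> space (M n)" for n \<omega>
    unfolding K_def by (rule GUE_count_pgf(2)[OF GUE interval that])
  have cumulants: "\<bar>ln (LINT \<omega>|M n. exp (s * (N n \<omega> - E n))) - s\<^sup>2 / 2 * V n\<bar> \<le> exp 1 * \<bar>s\<bar> ^ 3 * V n"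
    if s: "\<bar>s\<bar> \<le> 1" for n s
  proof -
    interpret prob_space "M n" by (rule prob)
    obtain d :: nat and p :: "nat \<Rightarrow> real" where p: "\<forall>i<d. 0 \<le> p i \<and> p i \<le> 1"
      and pgf: "\<And>z :: real. expectation (\<lambda>\<omega>. z ^ K n \<omega>) = (\<Prod>i<d. 1 - p i + p i * z)"
      using GUE_count_pgf(3)[OF GUE[of n] interval[of n], of "1 / sqrt (real n)"] unfolding K_def by blast
    show ?thesis
      unfolding E V NK
      by (rule bernoulli_sum_cumulants[where n = n and p = p and d = d])
        (use N_meas[of n] K_le p pgf s in \<open>auto simp: NK\<close>)
  qed
  have V_pos: "\<forall>\<^sub>F n in sequentially. V n > 0" using V_infinity by (simp add: filterlim_at_top_dense)
  have a_ne: "\<forall>\<^sub>F n in sequentially. a n \<noteq> 0" and inv_a: "(\<lambda>n. 1 / a n) \<longlonglongrightarrow> 0"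
    using a_lower unfolding much_less_def by auto
  have ratio: "(\<lambda>n. a n / sqrt (V n)) \<longlonglongrightarrow> 0" using a_upper unfolding much_less_def by auto
  \<comment> \<open>Only the size of \<open>a n\<close> is controlled, its sign is free, so
    divergence is shown for the square through \<open>1 / a n\<close>.\<close>
  have speed: "filterlim (\<lambda>n. (a n)\<^sup>2) at_top sequentially"
  proof -
    have "(\<lambda>n. (1 / a n)\<^sup>2) \<longlonglongrightarrow> 0\<^sup>2" by (intro tendsto_power inv_a)
    moreover have "\<forall>\<^sub>F n in sequentially. 0 < (1 / a n)\<^sup>2" using a_ne by eventually_elim simp
    ultimately have "filterlim (\<lambda>n. inverse ((1 / a n)\<^sup>2)) at_top sequentially"
      by (intro filterlim_inverse_at_top) auto
    then show ?thesis by (simp add: power_divide)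
  qed
  show ?thesis
  proof (rule satisfies_MDP_quadratic[where B = "\<lambda>n. (real n + \<bar>E n\<bar>) / \<bar>a n * sqrt (V n)\<bar>"])
    show "prob_space (M n)" for n by (rule prob)
    show "(\<lambda>\<omega>. (N n \<omega> - E n) / (a n * sqrt (V n))) \<in> borel_measurable (M n)" for n
      by (intro borel_measurable_divide borel_measurable_diff N_meas borel_measurable_const)
    show "\<bar>(N n \<omega> - E n) / (a n * sqrt (V n))\<bar> \<le> (real n + \<bar>E n\<bar>) / \<bar>a n * sqrt (V n)\<bar>"
      if "\<omega> \<in> space (M n)" for n \<omega>
    proof -
      have "\<bar>N n \<omega> - E n\<bar> \<le> real n + \<bar>E n\<bar>" using K_le[OF that] unfolding NK by linarith
      then show ?thesis unfolding abs_divide by (intro divide_right_mono) auto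
    qed
    show "filterlim (\<lambda>n. (a n)\<^sup>2) at_top sequentially" by (rule speed)
    show "(\<lambda>n. ln (LINT \<omega>|M n. exp (t * (a n)\<^sup>2 * ((N n \<omega> - E n) / (a n * sqrt (V n))))) / (a n)\<^sup>2) \<longlonglongrightarrow> t\<^sup>2 / 2" for t
    proof (rule LIM_zero_cancel, rule Lim_null_comparison)
      have small: "(\<lambda>n. t * (a n / sqrt (V n))) \<longlonglongrightarrow> t * 0" by (intro tendsto_intros ratio)
      \<comment> \<open>The cumulant estimate holds for tilts of absolute value at most 1, a range
        entered for large \<open>n\<close>.\<close>
      then have "\<forall>\<^sub>F n in sequentially. \<bar>t * (a n / sqrt (V n))\<bar> < 1"
        using order_tendstoD(2)[OF tendsto_rabs[OF small], of 1] by simp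
      with V_pos a_ne
      show "\<forall>\<^sub>F n in sequentially. norm (ln (LINT \<omega>|M n. exp (t * (a n)\<^sup>2 * ((N n \<omega> - E n) / (a n * sqrt (V n))))) / (a n)\<^sup>2 - t\<^sup>2 / 2)
         \<le> exp 1 * \<bar>t\<bar> ^ 3 * \<bar>a n / sqrt (V n)\<bar>"
      proof eventually_elim
        case (elim n)
        let ?s = "t * (a n / sqrt (V n))"
        have e: "t * (a n)\<^sup>2 * ((N n \<omega> - E n) / (a n * sqrt (V n))) = ?s * (N n \<omega> - E n)" for \<omega>
          using elim by (simp add: power2_eq_square)
        have sq: "sqrt (V n) * sqrt (V n) = V n" "sqrt (V n) > 0" using elim by simp_all
        have V2: "?s\<^sup>2 / 2 * V n = t\<^sup>2 / 2 * (a n)\<^sup>2"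
          using sq by (simp add: power2_eq_square field_simps)
        have cube: "\<bar>y\<bar> ^ 3 = y\<^sup>2 * \<bar>y\<bar>" for y :: real by (simp add: power3_eq_cube power2_eq_square)
        have "?s\<^sup>2 * V n = t\<^sup>2 * (a n)\<^sup>2" using V2 by simp
        then have "exp 1 * (?s\<^sup>2 * V n) * \<bar>?s\<bar> = exp 1 * (t\<^sup>2 * (a n)\<^sup>2) * (\<bar>t\<bar> * \<bar>a n / sqrt (V n)\<bar>)"
          by (simp only: abs_mult)
        then have V3: "exp 1 * \<bar>?s\<bar> ^ 3 * V n = exp 1 * \<bar>t\<bar> ^ 3 * \<bar>a n / sqrt (V n)\<bar> * (a n)\<^sup>2"
          unfolding cube by (simp only: mult_ac)
        have "\<bar>ln (LINT \<omega>|M n. exp (?s * (N n \<omega> - E n))) - t\<^sup>2 / 2 * (a n)\<^sup>2\<bar> \<le> exp 1 * \<bar>t\<bar> ^ 3 * \<bar>a n / sqrt (V n)\<bar> * (a n)\<^sup>2"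
          using cumulants[of ?s n] elim unfolding V2 V3 by simp
        then have "\<bar>ln (LINT \<omega>|M n. exp (?s * (N n \<omega> - E n))) - t\<^sup>2 / 2 * (a n)\<^sup>2\<bar> / (a n)\<^sup>2 \<le> exp 1 * \<bar>t\<bar> ^ 3 * \<bar>a n / sqrt (V n)\<bar>"
          using elim by (simp add: pos_divide_le_eq)
        moreover have "(y - t\<^sup>2 / 2 * (a n)\<^sup>2) / (a n)\<^sup>2 = y / (a n)\<^sup>2 - t\<^sup>2 / 2" for y
          using elim by (simp add: diff_divide_distrib)
        ultimately show ?case unfolding e by (metis abs_divide abs_power2 real_norm_def)
      qed
      have "(\<lambda>n. exp 1 * \<bar>t\<bar> ^ 3 * \<bar>a n / sqrt (V n)\<bar>) \<longlonglongrightarrow> exp 1 * \<bar>t\<bar> ^ 3 * \<bar>0\<bar>"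
        by (intro tendsto_intros ratio)
      then show "(\<lambda>n. exp 1 * \<bar>t\<bar> ^ 3 * \<bar>a n / sqrt (V n)\<bar>) \<longlonglongrightarrow> 0" by simp
    qed
  qed
qed

end
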